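(* Let $\xi:[0,1]\to\mathbb{R}$ be a smooth function, not identically zero, with $\int_0^1\xi(y)\,dy=0$, and let $C>0$. Then there is $m_0$ such that for every integer $m\ge m_0$ there is $\bar r>0$ such that for all $0<r_0\le\bar r$ the following holds for every $\hat G\in\hat{\mathcal S}^m_{r_0}$. Assume that $L_0=0$ and $L_1>0$. Let $U=[\epsilon,1]\subset(0,1]$ with $\epsilon>0$ small, and let $x\in(0,1)$. Then for Lebesgue almost all $y\in[0,1]$, the number of $i\ge0$ with $\hat g^i_y(x)\in U$ is infinite, but $$\lim_{n\to\infty}\frac1n\sum_{i=0}^{n-1}\mathbf 1_U(\hat g^i_y(x))=0,$$ where $\mathbf 1_U$ is the characteristic function of $U$.
   Context: For an integer $m\ge2$, $E_m:[0,1]\to[0,1]$ is the expanding map $E_m(y)=my-\lfloor my\rfloor$. For fixed $\xi$ and $C>0$, and for $r_0>0$, $\hat{\mathcal S}^m_{r_0}$ is the set of skew product maps $\hat G:[0,1]\times[0,1]\to[0,1]\times[0,1]$, $\hat G(y,x)=(E_m(y),\hat g_y(x))$, where $(y,x)\mapsto\hat g_y(x)$ is smooth, each $\hat g_y:[0,1]\to[0,1]$ is strictly increasing, and $$\hat g_y(x)=\frac{e^{\xi(y)}x}{1+(e^{\xi(y)}-1)x}+r(y,x)$$ with $|r(y,x)|\le Cx^2$, $|r(y,x)|\le C|1-x|$, and $|r(y,x)|,|\partial_x r(y,x)|,|\partial_y r(y,x)|\le r_0$ for all $(y,x)$. (In particular $\hat g_y(0)=0$, $\hat g_y(1)=1$.)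 Iterates: $\hat g^n_y=\hat g_{E_m^{n-1}(y)}\circ\cdots\circ\hat g_y$, with $\hat g^0_y=\mathrm{id}$. The fiber Lyapunov exponents are $L_0=\int_0^1\ln\hat g_y'(0)\,dy$ (which equals $\int_0^1\xi(y)\,dy=0$) and $L_1=\int_0^1\ln\hat g_y'(1)\,dy$, where $'$ denotes the derivative in $x$. *)

theory Defs
  imports "HOL-Analysis.Analysis"
begin

text \<open>\<open>C\<^sup>k\<close> on an open set \<open>U\<close>, for maps on a finite-dimensional space: continuity of
  \<open>x \<mapsto> Df(x)\<close> is continuity of \<open>x \<mapsto> Df(x) v\<close> for every direction \<open>v\<close>.\<close>

primrec Ck_on :: "nat \<Rightarrow> ('a::euclidean_space \<Rightarrow> 'b::euclidean_space) \<Rightarrow> 'a set \<Rightarrow> bool" where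
  "Ck_on 0 f U \<longleftrightarrow> continuous_on U f"
| "Ck_on (Suc k) f U \<longleftrightarrow>
     (\<forall>x\<in>U. f differentiable (at x)) \<and>
     (\<forall>v. Ck_on k (\<lambda>x. frechet_derivative f (at x) v) U)"

text \<open>Smoothness on a set that need not be open, such as a closed interval or a closed square:
  existence of a \<open>C\<^sup>\<infinity>\<close> extension to an open neighbourhood.\<close>

definition smooth_on :: "'a::euclidean_space set \<Rightarrow> ('a \<Rightarrow> 'b::euclidean_space) \<Rightarrow> bool" where
  "smooth_on S f \<longleftrightarrow>
     (\<exists>U F. open U \<and> S \<subseteq> U \<and> (\<forall>k. Ck_on k F U) \<and> (\<forall>x\<in>S. F x = f x))"

definition expanding_map :: "nat \<Rightarrow> real \<Rightarrow> real" where
  "expanding_map m y = real m * y - of_int \<lfloor>real m * y\<rfloor>"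

text \<open>Maps of the unit square are represented by functions on the whole plane; only their
  values on the square matter. Accordingly, all derivatives are taken within \<open>[0,1]\<close>, i.e. they
  are one-sided at the end points.\<close>

definition fiber_map :: "(real \<times> real \<Rightarrow> real \<times> real) \<Rightarrow> real \<Rightarrow> real \<Rightarrow> real" where
  "fiber_map G y x = snd (G (y, x))"

definition remainder ::
  "(real \<Rightarrow> real) \<Rightarrow> (real \<times> real \<Rightarrow> real \<times> real) \<Rightarrow> real \<Rightarrow> real \<Rightarrow> real" where
  "remainder \<xi> G y x =
     fiber_map G y x - exp (\<xi> y) * x / (1 + (exp (\<xi> y) - 1) * x)"

definition skew_products ::
  "(real \<Rightarrow> real) \<Rightarrow> real \<Rightarrow> nat \<Rightarrow> real \<Rightarrow> (real \<times> real \<Rightarrow> real \<times> real) set" where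
  "skew_products \<xi> C m r0 = {G.
     (\<forall>y\<in>{0..1}. \<forall>x\<in>{0..1}. fst (G (y, x)) = expanding_map m y) \<and>
     smooth_on ({0..1} \<times> {0..1}) (\<lambda>(y, x). fiber_map G y x) \<and>
     (\<forall>y\<in>{0..1}. fiber_map G y ` {0..1} \<subseteq> {0..1} \<and> strict_mono_on {0..1} (fiber_map G y)) \<and>
     (\<forall>y\<in>{0..1}. \<forall>x\<in>{0..1}.
        \<bar>remainder \<xi> G y x\<bar> \<le> C * x\<^sup>2 \<and>
        \<bar>remainder \<xi> G y x\<bar> \<le> C * \<bar>1 - x\<bar> \<and>
        \<bar>remainder \<xi> G y x\<bar> \<le> r0 \<and>
        \<bar>vector_derivative (\<lambda>t. remainder \<xi> G y t) (at x within {0..1})\<bar> \<le> r0 \<and>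
        \<bar>vector_derivative (\<lambda>t. remainder \<xi> G t x) (at y within {0..1})\<bar> \<le> r0)}"

primrec fiber_iterate ::
  "nat \<Rightarrow> (real \<times> real \<Rightarrow> real \<times> real) \<Rightarrow> nat \<Rightarrow> real \<Rightarrow> real \<Rightarrow> real" where
  "fiber_iterate m G 0 y = id"
| "fiber_iterate m G (Suc n) y =
     fiber_map G ((expanding_map m ^^ n) y) \<circ> fiber_iterate m G n y"

text \<open>The fiber Lyapunov exponents \<open>L\<^sub>0\<close> and \<open>L\<^sub>1\<close> are the values at \<open>p = 0\<close> and \<open>p = 1\<close>.\<close>

definition fiber_lyapunov :: "(real \<times> real \<Rightarrow> real \<times> real) \<Rightarrow> real \<Rightarrow> real" where
  "fiber_lyapunov G p =
     integral {0..1} (\<lambda>y. ln (vector_derivative (fiber_map G y) (at p within {0..1})))"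

end

theory Submission
  imports Defs "HOL-Library.Discrete_Functions"
begin

text \<open>In the coordinate \<open>u = ln (x / (1 - x))\<close> the fibre dynamics is a walk whose increment is
  \<open>\<xi>(y) + O(e\<^sup>u)\<close> as \<open>u\<close> tends to \<open>-\<infinity>\<close>, stays close to \<open>\<xi>(y)\<close> everywhere, and tends to
  \<open>- ln g\<^sub>y'(1)\<close> as \<open>u\<close> tends to \<open>\<infinity>\<close>. Given the first \<open>n\<close> base-\<open>m\<close> digits of \<open>y\<close>, the remainder of \<open>y\<close>
  is uniform, and the position is a function of it that is almost constant far to the left when
  \<open>m\<close> is large. So there the walk is driftless with variance bounded below: for small \<open>s\<close>,
  \<open>e\<^bsup>su\<^esup>\<close> has drift at least \<open>const s\<^sup>2 e\<^bsup>su\<^esup>\<close>, while \<open>e\<^bsup>\<eta>u\<^esup>/\<eta>\<close> has drift \<open>O(\<eta>)\<close>.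
  The supermartingale \<open>1 - e\<^bsup>\<eta>u\<^esup> - \<eta> e\<^bsup>su\<^esup>\<close>, with \<open>\<eta>\<close> tending to \<open>0\<close>, shows that the walk always
  comes back from the left. The bounded function \<open>e\<^bsup>\<eta>u\<^esup>/\<eta> - e\<^bsup>su\<^esup>\<close>, truncated from above, has
  drift at most \<open>O(\<eta>)\<close>, and at most \<open>O(\<eta>) - const\<close> on a strip far to the left; by the law of
  large numbers such a strip is visited with frequency \<open>0\<close>. Some digit moves every point to the
  left by a definite amount, which carries this over to all strips, and the negative mean
  increment \<open>-L\<^sub>1\<close> near \<open>u = \<infinity>\<close> takes care of the remaining half-line.\<close>

section \<open>Digit expansions\<close>

text \<open>The increment depends on the whole remainder of \<open>y\<close> and not only on the
  next digit, so positions alone form no Markov chain. Curves over the remainder do, provided some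
  regularity of curves survives every step. The obstacle is uniformity: \<open>m\<close> has to be
  fixed before the map is known, but the dependence of the increment on \<open>y\<close> involves
  the mixed second derivative of the fibre maps, which \<open>r0\<close> does not control. The
  deviation of the increment from \<xi> is at most \<open>c0 * exp u\<close>, and it is Lipschitz in
  \<open>y\<close> with an uncontrolled constant. The geometric mean of the two bounds has Hoelder
  exponent 1/2 and a factor \<open>exp (u / 2)\<close>; hence the square roots in the modulus and in
  the conditions on \<open>m\<close>. The uncontrolled constant \<open>B\<close> enters linearly on
  both sides of the invariance estimate, so it does not affect how large \<open>m\<close> must be;
  it only decides how far left the walk looks driftless. Between that region and \<open>K1\<close>
  no drift estimate is used, only bounded increments and the digit that pushes left.\<close>

abbreviation unit_interval :: "real measure" where
  "unit_interval \<equiv> restrict_space lborel {0..<1}"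

lemma space_unit [simp]: "space unit_interval = {0..<1}"
  by (simp add: space_restrict_space)

lemma emeasure_unit: "emeasure unit_interval {0..<1} = 1"
  by (subst emeasure_restrict_space) auto

lemma measure_unit [simp]: "measure unit_interval {0..<1} = 1"
  by (simp add: measure_def emeasure_unit)

interpretation U: finite_measure unit_interval
  by standard (simp add: emeasure_unit)

lemma integral_unit_const [simp]: "(\<integral>t. c \<partial>unit_interval) = (c::real)"
  by simp

lemma integrable_unit:
  fixes f :: "real \<Rightarrow> real"
  assumes "f \<in> borel_measurable unit_interval" "\<And>t. t \<in> {0..<1} \<Longrightarrow> \<bar>f t\<bar> \<le> B"
  shows "integrable unit_interval f"
  by (rule U.integrable_const_bound[of _ B]) (use assms in auto)

lemma integral_unit_mono:
  fixes f g :: "real \<Rightarrow> real"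
  assumes "integrable unit_interval f" "integrable unit_interval g"
    "\<And>t. t \<in> {0..<1} \<Longrightarrow> f t \<le> g t"
  shows "(\<integral>t. f t \<partial>unit_interval) \<le> (\<integral>t. g t \<partial>unit_interval)"
  using assms by (intro integral_mono) auto

lemma integral_unit_le:
  fixes f :: "real \<Rightarrow> real"
  assumes "integrable unit_interval f" "\<And>t. t \<in> {0..<1} \<Longrightarrow> f t \<le> c"
  shows "(\<integral>t. f t \<partial>unit_interval) \<le> c"
  using integral_unit_mono[OF assms(1), of "\<lambda>_. c"] assms(2) by simp

lemma integral_unit_ge:
  fixes f :: "real \<Rightarrow> real"
  assumes "integrable unit_interval f" "\<And>t. t \<in> {0..<1} \<Longrightarrow> c \<le> f t"
  shows "c \<le> (\<integral>t. f t \<partial>unit_interval)"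
  using integral_unit_mono[of "\<lambda>_. c", OF _ assms(1)] assms(2) by simp

lemma borel_measurable_unit_cong:
  assumes "\<And>t. t \<in> {0..<1} \<Longrightarrow> f t = g t"
  shows "f \<in> borel_measurable unit_interval \<longleftrightarrow> g \<in> borel_measurable unit_interval"
  by (rule measurable_cong) (use assms in auto)

lemma continuous_imp_measurable_unit:
  fixes f :: "real \<Rightarrow> real"
  assumes "continuous_on {0..<1} f"
  shows "f \<in> borel_measurable unit_interval"
  using borel_measurable_continuous_on_restrict[OF assms]
  by (simp add: measurable_def space_restrict_space sets_restrict_space)

definition average :: "nat \<Rightarrow> (nat \<Rightarrow> real) \<Rightarrow> real" where
  "average m f = (\<Sum>a<m. f a) / real m"

definition digit :: "nat \<Rightarrow> real \<Rightarrow> nat" where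
  "digit m y = nat \<lfloor>real m * y\<rfloor>"

definition branch :: "nat \<Rightarrow> nat \<Rightarrow> real \<Rightarrow> real" where
  "branch m a t = (real a + t) / real m"

locale expansion =
  fixes m :: nat
  assumes m_ge_2: "m \<ge> 2"
begin

abbreviation E :: "real \<Rightarrow> real" where "E \<equiv> expanding_map m"

lemma m_pos [simp]: "0 < real m" "0 < m" and m_nz [simp]: "m \<noteq> 0"
  using m_ge_2 by auto

lemma branch_in: "a < m \<Longrightarrow> t \<in> {0..<1} \<Longrightarrow> branch m a t \<in> {0..<1}"
proof -
  assume "a < m" "t \<in> {0..<1}"
  then have "real a + 1 \<le> real m" by linarith
  then show ?thesis
    using \<open>t \<in> {0..<1}\<close> by (auto simp: branch_def field_simps)
qed

lemma digit_branch [simp]: "t \<in> {0..<1} \<Longrightarrow> digit m (branch m a t) = a"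
  by (auto simp: digit_def branch_def floor_eq_iff nat_eq_iff)

lemma E_branch [simp]:
  assumes "t \<in> {0..<1}" shows "E (branch m a t) = t"
proof -
  have "\<lfloor>real a + t\<rfloor> = int a" using assms by (auto simp: floor_eq_iff)
  then show ?thesis by (simp add: expanding_map_def branch_def)
qed

lemma E_in [simp]: "E y \<in> {0..<1}"
  unfolding expanding_map_def by (simp add: frac_lt_1 flip: frac_def)

lemma E_iterate_in: "y \<in> {0..<1} \<Longrightarrow> (E ^^ n) y \<in> {0..<1}"
  by (cases n) (use E_in in auto)

lemma digit_less: "y \<in> {0..<1} \<Longrightarrow> digit m y < m"
proof -
  assume y: "y \<in> {0..<1}"
  then have "real m * y < real m" by simp
  then have "\<lfloor>real m * y\<rfloor> < int m" by linarith
  then show ?thesis by (cases "0 \<le> \<lfloor>real m * y\<rfloor>") (auto simp: digit_def nat_less_iff)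
qed

lemma branch_digit [simp]: "y \<in> {0..<1} \<Longrightarrow> branch m (digit m y) (E y) = y"
  by (simp add: branch_def digit_def expanding_map_def)

lemma average_mono: "(\<And>a. a < m \<Longrightarrow> f a \<le> g a) \<Longrightarrow> average m f \<le> average m g"
  unfolding average_def by (intro divide_right_mono sum_mono) auto

lemma average_cong: "(\<And>a. a < m \<Longrightarrow> f a = g a) \<Longrightarrow> average m f = average m g"
  unfolding average_def by (intro arg_cong2[where f="(/)"] sum.cong) auto

lemma average_const [simp]: "average m (\<lambda>_. c) = c"
  by (simp add: average_def)

lemma average_add: "average m (\<lambda>a. f a + g a) = average m f + average m g"
  by (simp add: average_def sum.distrib add_divide_distrib)

lemma average_diff: "average m (\<lambda>a. f a - g a) = average m f - average m g"
  by (simp add: average_def sum_subtractf diff_divide_distrib)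

lemma average_abs_le:
  assumes "\<And>a. a < m \<Longrightarrow> \<bar>f a\<bar> \<le> B" shows "\<bar>average m f\<bar> \<le> B"
proof -
  have "average m f \<le> average m (\<lambda>_. B)" "average m (\<lambda>_. - B) \<le> average m f"
    using assms by (intro average_mono; force)+
  then show ?thesis by simp
qed

lemma measurable_digit: "digit m \<in> unit_interval \<rightarrow>\<^sub>M count_space UNIV"
proof -
  have "digit m \<in> borel \<rightarrow>\<^sub>M count_space UNIV" unfolding digit_def by measurable
  then show ?thesis by (intro measurable_restrict_space1) simp
qed

lemma measurable_E: "E \<in> unit_interval \<rightarrow>\<^sub>M unit_interval"
proof -
  have "E \<in> borel \<rightarrow>\<^sub>M borel" unfolding expanding_map_def by measurable
  then have "E \<in> unit_interval \<rightarrow>\<^sub>M lborel" by (intro measurable_restrict_space1) simp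
  then show ?thesis by (intro measurable_restrict_space2) (use E_in in auto)
qed

lemma self_similar_measurable:
  fixes f :: "real \<Rightarrow> real"
  assumes "\<And>a. a < m \<Longrightarrow> (\<lambda>t. f (branch m a t)) \<in> borel_measurable unit_interval"
  shows "f \<in> borel_measurable unit_interval"
proof -
  \<comment> \<open>The countable composition rule asks for measurability at every natural number,
    hence the value 0 at indices that are not digits.\<close>
  define F where "F a t = (if a < m then f (branch m a t) else 0)" for a t
  have F: "F a \<in> borel_measurable unit_interval" for a
    using assms[of a] unfolding F_def by (cases "a < m") simp_all
  have "(\<lambda>y. F (digit m y) (E y)) \<in> borel_measurable unit_interval"
    by (rule measurable_compose_countable[OF _ measurable_digit])
      (use F measurable_E in \<open>simp add: measurable_compose[OF measurable_E F]\<close>)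
  then show ?thesis
    by (subst borel_measurable_unit_cong[of _ "\<lambda>y. F (digit m y) (E y)"])
      (auto simp: F_def digit_less)
qed

text \<open>Each branch covers an interval of length \<open>1 / m\<close>, and the affine
  substitution \<open>y = branch m a t\<close> stretches it to the whole interval. This is how the
  first digit is conditioned on throughout: it is uniform and independent of
  \<open>E y\<close>.\<close>

lemma self_similar_integral:
  fixes f :: "real \<Rightarrow> real"
  assumes meas: "\<And>a. a < m \<Longrightarrow> (\<lambda>t. f (branch m a t)) \<in> borel_measurable unit_interval"
    and bd: "\<And>y. y \<in> {0..<1} \<Longrightarrow> \<bar>f y\<bar> \<le> B"
  shows "(\<integral>y. f y \<partial>unit_interval) = average m (\<lambda>a. \<integral>t. f (branch m a t) \<partial>unit_interval)"
proof -
  define g where "g y = indicator {0..<1} y *\<^sub>R f y" for y :: real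
  have fm: "f \<in> borel_measurable unit_interval" by (rule self_similar_measurable[OF meas])
  have gi: "integrable lborel g"
    using integrable_unit[OF fm, of B] bd unfolding g_def
    by (subst (asm) integrable_restrict_space) auto
  let ?I = "\<lambda>a. {real a / real m ..< (real a + 1) / real m}"
  have disj: "a = b" if "a < m" "b < m" "y \<in> ?I a" "y \<in> ?I b" for a b y
  proof -
    have "digit m y = c" if "y \<in> ?I c" for c
      using that by (auto simp: digit_def nat_eq_iff floor_eq_iff field_simps)
    then show ?thesis using that by metis
  qed
  have split: "g y = (\<Sum>a<m. indicator (?I a) y *\<^sub>R g y)" for y
  proof (cases "y \<in> {0..<1}")
    case False then show ?thesis by (simp add: g_def)
  next
    case True
    have "y \<in> ?I (digit m y)"
    proof -
      have "real (digit m y) \<le> real m * y" "real m * y < real (digit m y) + 1"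
        using True by (auto simp: digit_def)
      then show ?thesis by (simp add: field_simps)
    qed
    then have "indicator (?I a) y = (if a = digit m y then 1 else 0 :: real)" if "a < m" for a
      using disj[OF that digit_less[OF True]] by (auto simp: indicator_def)
    then have "(\<Sum>a<m. indicator (?I a) y *\<^sub>R g y) = (\<Sum>a<m. if a = digit m y then g y else 0)"
      by (intro sum.cong) auto
    then show ?thesis using digit_less[OF True] by simp
  qed
  have piece: "(\<integral>y. indicator (?I a) y *\<^sub>R g y \<partial>lborel)
      = (\<integral>t. f (branch m a t) \<partial>unit_interval) / real m" if "a < m" for a
  proof -
    have eq: "indicator (?I a) (real a / m + (1 / m) * t) *\<^sub>R g (real a / m + (1/m) * t)
        = indicator {0..<1} t *\<^sub>R f (branch m a t)" for t
    proof (cases "t \<in> {0..<1}")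
      case True
      then show ?thesis using branch_in[OF that True]
        by (auto simp: g_def branch_def indicator_def field_simps)
    next
      case False
      then show ?thesis by (auto simp: indicator_def field_simps)
    qed
    have "(\<integral>y. indicator (?I a) y *\<^sub>R g y \<partial>lborel)
       = \<bar>1 / real m\<bar> *\<^sub>R (\<integral>t. indicator (?I a) (real a / m + (1/m) * t) *\<^sub>R
            g (real a / m + (1 / m) * t) \<partial>lborel)"
      by (rule lborel_integral_real_affine) simp
    also have "\<dots> = (\<integral>t. indicator {0..<1} t *\<^sub>R f (branch m a t) \<partial>lborel) / m"
      unfolding eq by simp
    finally show ?thesis by (subst integral_restrict_space) auto
  qed
  have "(\<integral>y. f y \<partial>unit_interval) = (\<integral>y. g y \<partial>lborel)"
    unfolding g_def by (subst integral_restrict_space) auto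
  also have "\<dots> = (\<integral>y. (\<Sum>a<m. indicator (?I a) y *\<^sub>R g y) \<partial>lborel)"
    by (rule Bochner_Integration.integral_cong[OF refl split])
  also have "\<dots> = (\<Sum>a<m. \<integral>y. indicator (?I a) y *\<^sub>R g y \<partial>lborel)"
    by (rule Bochner_Integration.integral_sum) (rule integrable_mult_indicator[OF _ gi], simp)
  also have "\<dots> = (\<Sum>a<m. (\<integral>t. f (branch m a t) \<partial>unit_interval) / m)"
    by (intro sum.cong piece) auto
  finally show ?thesis by (simp add: average_def sum_divide_distrib)
qed

end

section \<open>Chains driven by digits\<close>

text \<open>From \<open>k\<^sup>2\<close> to any index before the next square there are at most
  \<open>2 * k\<close> steps, over which \<open>S\<close> changes by at most
  \<open>2 * k * B\<close>; divided by \<open>k\<^sup>2\<close> this vanishes.\<close>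

lemma subseq_squares_imp_tendsto_0:
  fixes S :: "nat \<Rightarrow> real"
  assumes bd: "\<And>n. \<bar>S (Suc n) - S n\<bar> \<le> B"
    and sq: "(\<lambda>k. S (k\<^sup>2) / real (k\<^sup>2)) \<longlonglongrightarrow> 0"
  shows "(\<lambda>n. S n / real n) \<longlonglongrightarrow> 0"
proof -
  have B: "B \<ge> 0" using bd[of 0] by linarith
  have diff: "\<bar>S (n + d) - S n\<bar> \<le> real d * B" for n d
  proof (induction d)
    case (Suc d)
    then show ?case using bd[of "n + d"] by (simp add: algebra_simps)
  qed simp
  have fl: "filterlim floor_sqrt at_top sequentially"
  proof (rule filterlim_at_top_mono)
    show "filterlim (\<lambda>n. nat \<lfloor>sqrt (real n)\<rfloor>) at_top sequentially"
      by (intro filterlim_compose[OF filterlim_nat_sequentially]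
          filterlim_compose[OF filterlim_floor_sequentially]
          filterlim_compose[OF sqrt_at_top filterlim_real_sequentially])
    show "\<forall>\<^sub>F n in sequentially. nat \<lfloor>sqrt (real n)\<rfloor> \<le> floor_sqrt n"
    proof (intro always_eventually allI le_floor_sqrtI)
      fix n
      have "real (nat \<lfloor>sqrt (real n)\<rfloor>) \<le> sqrt (real n)" by simp
      then have "real (nat \<lfloor>sqrt (real n)\<rfloor>) ^ 2 \<le> real n"
        by (metis of_nat_0_le_iff power_mono real_sqrt_pow2)
      then show "(nat \<lfloor>sqrt (real n)\<rfloor>)\<^sup>2 \<le> n"
        by (metis of_nat_le_iff of_nat_power)
    qed
  qed
  define g where "g k = \<bar>S (k\<^sup>2) / real (k\<^sup>2)\<bar> + 2 * B / real k" for k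
  have "g \<longlonglongrightarrow> 0"
    unfolding g_def
    by (rule tendsto_eq_intros tendsto_rabs_zero sq tendsto_divide_0 tendsto_const
        filterlim_real_at_infinity_sequentially | simp)+
  then have lim: "(\<lambda>n. g (floor_sqrt n)) \<longlonglongrightarrow> 0"
    by (rule filterlim_compose[OF _ fl])
  have bound: "\<bar>S n / real n\<bar> \<le> g (floor_sqrt n)" if "n > 0" for n
  proof -
    define k where "k = floor_sqrt n"
    have k0: "k > 0" using that by (simp add: k_def)
    have k1: "k\<^sup>2 \<le> n" and k2: "n < (Suc k)\<^sup>2"
      by (simp_all add: k_def Suc_floor_sqrt_power2_gt)
    have "n - k\<^sup>2 \<le> 2 * k" using k2 by (simp add: power2_eq_square)
    then have "real (n - k\<^sup>2) * B \<le> real (2 * k) * B"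
      using B by (intro mult_right_mono) (simp_all only: of_nat_le_iff)
    then have *: "\<bar>S n\<bar> \<le> \<bar>S (k\<^sup>2)\<bar> + real (2 * k) * B"
      using diff[of "k\<^sup>2" "n - k\<^sup>2"] k1 by simp
    have kk: "real (k\<^sup>2) \<le> real n" using k1 by (simp only: of_nat_le_iff)
    have "\<bar>S n / real n\<bar> \<le> \<bar>S n\<bar> / real (k\<^sup>2)"
      unfolding abs_divide abs_of_nat by (rule frac_le[OF _ order_refl _ kk]) (use k0 in auto)
    also have "\<dots> \<le> (\<bar>S (k\<^sup>2)\<bar> + real (2 * k) * B) / real (k\<^sup>2)"
      using * by (intro divide_right_mono) auto
    also have "\<dots> = g k" using k0 by (simp add: g_def field_simps power2_eq_square)
    finally show ?thesis by (simp add: k_def)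
  qed
  show ?thesis
    by (rule Lim_null_comparison[OF _ lim])
      (use bound in \<open>auto intro!: eventually_sequentiallyI[of 1]\<close>)
qed

text \<open>For uniformly distributed \<open>y\<close> the digits are independent and uniform, so
  \<open>state n \<phi> y\<close> is a Markov chain that applies each \<open>T a\<close> with
  probability \<open>1 / m\<close>. Expectations are integrals over \<open>y\<close>;
  \<open>Adm\<close> is the invariant set on which estimates hold.\<close>

locale driven_chain = expansion m for m +
  fixes T :: "nat \<Rightarrow> 'c \<Rightarrow> 'c" and Adm :: "'c set"
  assumes T_Adm: "a < m \<Longrightarrow> \<phi> \<in> Adm \<Longrightarrow> T a \<phi> \<in> Adm"
begin

primrec state :: "nat \<Rightarrow> 'c \<Rightarrow> real \<Rightarrow> 'c" where
  "state 0 \<phi> y = \<phi>"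
| "state (Suc n) \<phi> y = state n (T (digit m y) \<phi>) (E y)"

lemma state_Adm: "y \<in> {0..<1} \<Longrightarrow> \<phi> \<in> Adm \<Longrightarrow> state n \<phi> y \<in> Adm"
  by (induction n arbitrary: \<phi> y) (simp_all add: T_Adm digit_less del: atLeastLessThan_iff)

text \<open>The recursive definition consumes the first digit, which suits induction through
  \<open>self_similar_integral\<close>; this form consumes the last one and describes a step forward
  in time.\<close>

lemma state_Suc: "state (Suc n) \<phi> y = T (digit m ((E ^^ n) y)) (state n \<phi> y)"
proof (induction n arbitrary: \<phi> y)
  case (Suc n)
  have "state (Suc (Suc n)) \<phi> y = state (Suc n) (T (digit m y) \<phi>) (E y)" by simp
  also have "\<dots> = T (digit m ((E ^^ n) (E y))) (state n (T (digit m y) \<phi>) (E y))"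
    by (rule Suc.IH)
  finally show ?case by (simp add: funpow_swap1)
qed simp

section \<open>Sums along the chain with conditional mean 0, and their law of large numbers\<close>

definition path_sum :: "('c \<Rightarrow> nat \<Rightarrow> real) \<Rightarrow> nat \<Rightarrow> 'c \<Rightarrow> real \<Rightarrow> real" where
  "path_sum Y n \<phi> y = (\<Sum>i<n. Y (state i \<phi> y) (digit m ((E ^^ i) y)))"

lemma path_sum_0 [simp]: "path_sum Y 0 \<phi> y = 0"
  by (simp add: path_sum_def)

lemma path_sum_branch:
  "t \<in> {0..<1} \<Longrightarrow> path_sum Y (Suc n) \<phi> (branch m a t) = Y \<phi> a + path_sum Y n (T a \<phi>) t"
  unfolding path_sum_def
  by (subst sum.lessThan_Suc_shift) (simp add: funpow_swap1 del: atLeastLessThan_iff funpow.simps(2),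
      simp add: funpow_Suc_right del: atLeastLessThan_iff funpow.simps(2))

lemma path_sum_measurable: "path_sum Y n \<phi> \<in> borel_measurable unit_interval"
proof (induction n arbitrary: \<phi>)
  case (Suc n)
  show ?case
  proof (rule self_similar_measurable)
    fix a
    show "(\<lambda>t. path_sum Y (Suc n) \<phi> (branch m a t)) \<in> borel_measurable unit_interval"
      by (rule borel_measurable_unit_cong[THEN iffD2, OF path_sum_branch], assumption)
        (intro borel_measurable_add borel_measurable_const Suc)
  qed
qed (simp add: path_sum_def[abs_def])

lemma path_sum_branch_measurable:
  "(\<lambda>t. path_sum Y (Suc n) \<phi> (branch m a t)) \<in> borel_measurable unit_interval"
  by (rule borel_measurable_unit_cong[THEN iffD2, OF path_sum_branch], assumption)
    (intro borel_measurable_add borel_measurable_const path_sum_measurable)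

lemma path_sum_bound:
  assumes "\<And>\<phi> a. \<phi> \<in> Adm \<Longrightarrow> a < m \<Longrightarrow> \<bar>Y \<phi> a\<bar> \<le> B" "\<phi> \<in> Adm" "y \<in> {0..<1}"
  shows "\<bar>path_sum Y n \<phi> y\<bar> \<le> real n * B"
proof -
  have "\<bar>path_sum Y n \<phi> y\<bar> \<le> (\<Sum>i<n. \<bar>Y (state i \<phi> y) (digit m ((E ^^ i) y))\<bar>)"
    unfolding path_sum_def by (rule sum_abs)
  also have "\<dots> \<le> (\<Sum>i<n. B)"
    by (intro sum_mono assms(1) state_Adm digit_less E_iterate_in assms(2,3))
  finally show ?thesis by simp
qed

text \<open>Once the first digit is split off, what remains is a path sum from the new state, so the
  induction covers all starting states at once.\<close>

lemma path_sum_mean_0: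
  assumes Y: "\<And>\<phi> a. \<phi> \<in> Adm \<Longrightarrow> a < m \<Longrightarrow> \<bar>Y \<phi> a\<bar> \<le> B"
    and mean: "\<And>\<phi>. \<phi> \<in> Adm \<Longrightarrow> average m (Y \<phi>) = 0"
    and "\<phi> \<in> Adm"
  shows "(\<integral>y. path_sum Y n \<phi> y \<partial>unit_interval) = 0"
  using \<open>\<phi> \<in> Adm\<close>
proof (induction n arbitrary: \<phi>)
  case (Suc n)
  have "(\<integral>y. path_sum Y (Suc n) \<phi> y \<partial>unit_interval)
      = average m (\<lambda>a. \<integral>t. path_sum Y (Suc n) \<phi> (branch m a t) \<partial>unit_interval)"
  proof (rule self_similar_integral)
    show "(\<lambda>t. path_sum Y (Suc n) \<phi> (branch m a t)) \<in> borel_measurable unit_interval" for a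
      by (rule path_sum_branch_measurable)
  qed (rule path_sum_bound[OF Y Suc.prems])
  also have "\<dots> = average m (Y \<phi>)"
  proof (rule average_cong)
    fix a assume a: "a < m"
    have "(\<integral>t. path_sum Y (Suc n) \<phi> (branch m a t) \<partial>unit_interval)
        = (\<integral>t. Y \<phi> a + path_sum Y n (T a \<phi>) t \<partial>unit_interval)"
      by (rule Bochner_Integration.integral_cong) (simp_all add: path_sum_branch)
    also have "\<dots> = Y \<phi> a + (\<integral>t. path_sum Y n (T a \<phi>) t \<partial>unit_interval)"
      using integrable_unit[OF path_sum_measurable path_sum_bound[OF Y T_Adm[OF a Suc.prems]]]
      by (subst Bochner_Integration.integral_add) auto
    finally show "(\<integral>t. path_sum Y (Suc n) \<phi> (branch m a t) \<partial>unit_interval) = Y \<phi> a"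
      using Suc.IH[OF T_Adm[OF a Suc.prems]] by simp
  qed
  finally show ?case using mean Suc.prems by simp
qed (simp add: path_sum_def[abs_def])

text \<open>Orthogonality of martingale increments: after splitting off the first digit, the mixed
  term contains the integral of the remaining path sum, which is 0, so only squares add up.\<close>

lemma path_sum_variance:
  assumes Y: "\<And>\<phi> a. \<phi> \<in> Adm \<Longrightarrow> a < m \<Longrightarrow> \<bar>Y \<phi> a\<bar> \<le> B"
    and mean: "\<And>\<phi>. \<phi> \<in> Adm \<Longrightarrow> average m (Y \<phi>) = 0"
    and "\<phi> \<in> Adm"
  shows "(\<integral>y. (path_sum Y n \<phi> y)\<^sup>2 \<partial>unit_interval) \<le> real n * B\<^sup>2"
  using \<open>\<phi> \<in> Adm\<close>
proof (induction n arbitrary: \<phi>)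
  case (Suc n)
  have sqb: "\<bar>(path_sum Y k \<psi> t)\<^sup>2\<bar> \<le> (real k * B)\<^sup>2" if "\<psi> \<in> Adm" "t \<in> {0..<1}" for k \<psi> t
    using power_mono[OF path_sum_bound[of Y B, OF Y that] abs_ge_zero, of k 2] by simp
  have "(\<integral>y. (path_sum Y (Suc n) \<phi> y)\<^sup>2 \<partial>unit_interval)
      = average m (\<lambda>a. \<integral>t. (path_sum Y (Suc n) \<phi> (branch m a t))\<^sup>2 \<partial>unit_interval)"
  proof (rule self_similar_integral)
    show "(\<lambda>t. (path_sum Y (Suc n) \<phi> (branch m a t))\<^sup>2) \<in> borel_measurable unit_interval" for a
      by (intro borel_measurable_power path_sum_branch_measurable)
  qed (rule sqb[OF Suc.prems])
  also have "\<dots> \<le> average m (\<lambda>_. B\<^sup>2 + real n * B\<^sup>2)"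
  proof (rule average_mono)
    fix a assume a: "a < m"
    note Ta = T_Adm[OF a Suc.prems]
    have i1: "integrable unit_interval (path_sum Y n (T a \<phi>))"
      by (rule integrable_unit[OF path_sum_measurable path_sum_bound[OF Y Ta]])
    have i2: "integrable unit_interval (\<lambda>t. (path_sum Y n (T a \<phi>) t)\<^sup>2)"
      by (rule integrable_unit[OF _ sqb[OF Ta]]) (use path_sum_measurable in measurable)
    have "(\<integral>t. (path_sum Y (Suc n) \<phi> (branch m a t))\<^sup>2 \<partial>unit_interval)
        = (\<integral>t. (Y \<phi> a)\<^sup>2 + (2 * Y \<phi> a * path_sum Y n (T a \<phi>) t + (path_sum Y n (T a \<phi>) t)\<^sup>2)
            \<partial>unit_interval)"
      by (rule Bochner_Integration.integral_cong) (simp_all add: path_sum_branch power2_sum)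
    also have "\<dots> = (Y \<phi> a)\<^sup>2 + (2 * Y \<phi> a * (\<integral>t. path_sum Y n (T a \<phi>) t \<partial>unit_interval)
        + (\<integral>t. (path_sum Y n (T a \<phi>) t)\<^sup>2 \<partial>unit_interval))"
      using i1 i2
      by (subst Bochner_Integration.integral_add, simp, simp)
        (subst Bochner_Integration.integral_add, auto)
    also have "\<dots> = (Y \<phi> a)\<^sup>2 + (\<integral>t. (path_sum Y n (T a \<phi>) t)\<^sup>2 \<partial>unit_interval)"
      using path_sum_mean_0[of Y, OF Y mean Ta] by simp
    also have "\<dots> \<le> B\<^sup>2 + real n * B\<^sup>2"
      using Suc.IH[OF Ta] power_mono[OF Y[OF Suc.prems a] abs_ge_zero, of 2] by simp
    finally show "(\<integral>t. (path_sum Y (Suc n) \<phi> (branch m a t))\<^sup>2 \<partial>unit_interval)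
      \<le> B\<^sup>2 + real n * B\<^sup>2" .
  qed
  finally show ?case by (simp add: algebra_simps)
qed simp

text \<open>Along the squares the second moments of the averages are at most
  \<open>B\<^sup>2 / k\<^sup>2\<close>, hence summable, so these averages tend to 0 almost
  everywhere; bounded terms fill the gaps between squares. Conditional mean 0 replaces
  independence.\<close>

lemma path_sum_law_of_large_numbers:
  assumes Y: "\<And>\<phi> a. \<phi> \<in> Adm \<Longrightarrow> a < m \<Longrightarrow> \<bar>Y \<phi> a\<bar> \<le> B"
    and mean: "\<And>\<phi>. \<phi> \<in> Adm \<Longrightarrow> average m (Y \<phi>) = 0"
    and \<phi>: "\<phi> \<in> Adm"
  shows "AE y in unit_interval. (\<lambda>n. path_sum Y n \<phi> y / real n) \<longlonglongrightarrow> 0"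
proof -
  define Z where "Z k y = (path_sum Y ((Suc k)\<^sup>2) \<phi> y / real ((Suc k)\<^sup>2))\<^sup>2" for k y
  have Zm: "Z k \<in> borel_measurable unit_interval" for k
    unfolding Z_def using path_sum_measurable[of Y "(Suc k)\<^sup>2" \<phi>] by measurable
  have Zb: "\<bar>Z k y\<bar> \<le> B\<^sup>2" if "y \<in> {0..<1}" for k y
  proof -
    have "\<bar>path_sum Y ((Suc k)\<^sup>2) \<phi> y\<bar> / real ((Suc k)\<^sup>2) \<le> B"
      using path_sum_bound[of Y B \<phi> y "(Suc k)\<^sup>2", OF Y \<phi> that]
      by (simp add: divide_le_eq mult.commute del: of_nat_power of_nat_Suc)
    then have "\<bar>path_sum Y ((Suc k)\<^sup>2) \<phi> y / real ((Suc k)\<^sup>2)\<bar> \<le> B"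
      by (simp add: abs_divide)
    from power_mono[OF this abs_ge_zero, of 2] show ?thesis
      unfolding Z_def abs_power2 power2_abs .
  qed
  have Zint: "(\<integral>y. Z k y \<partial>unit_interval) \<le> B\<^sup>2 / (real (Suc k))\<^sup>2" for k
  proof -
    let ?K = "real ((Suc k)\<^sup>2)"
    have "(\<integral>y. Z k y \<partial>unit_interval)
        = (\<integral>y. (path_sum Y ((Suc k)\<^sup>2) \<phi> y)\<^sup>2 \<partial>unit_interval) / ?K\<^sup>2"
      unfolding Z_def power_divide by simp
    also have "\<dots> \<le> (?K * B\<^sup>2) / ?K\<^sup>2"
      by (intro divide_right_mono path_sum_variance[of Y B, OF Y mean \<phi>]) auto
    also have "\<dots> = B\<^sup>2 / ?K" by (simp add: power2_eq_square)
    finally show ?thesis by simp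
  qed
  have nnZ: "(\<integral>\<^sup>+y. ennreal (Z k y) \<partial>unit_interval) \<le> ennreal (B\<^sup>2 * inverse ((real (Suc k))\<^sup>2))" for k
  proof -
    have "(\<integral>\<^sup>+y. ennreal (Z k y) \<partial>unit_interval) = ennreal (\<integral>y. Z k y \<partial>unit_interval)"
      by (rule nn_integral_eq_integral[OF integrable_unit[OF Zm Zb]]) (auto simp: Z_def)
    also have "\<dots> \<le> ennreal (B\<^sup>2 * inverse ((real (Suc k))\<^sup>2))"
      using Zint[of k] by (intro ennreal_leI) (simp add: divide_inverse)
    finally show ?thesis .
  qed
  have nn: "0 \<le> B\<^sup>2 * inverse ((real (Suc k))\<^sup>2)" for k
    by (intro mult_nonneg_nonneg) auto
  have summ: "summable (\<lambda>k. B\<^sup>2 * inverse ((real (Suc k))\<^sup>2))"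
    using inverse_power_summable[of 2, where ?'a=real]
    by (intro summable_mult) (subst summable_Suc_iff, simp)
  have "(\<integral>\<^sup>+y. (\<Sum>k. ennreal (Z k y)) \<partial>unit_interval) = (\<Sum>k. \<integral>\<^sup>+y. ennreal (Z k y) \<partial>unit_interval)"
    by (rule nn_integral_suminf) (use Zm in measurable)
  also have "\<dots> \<le> (\<Sum>k. ennreal (B\<^sup>2 * inverse ((real (Suc k))\<^sup>2)))"
    by (intro suminf_le nnZ) auto
  also have "\<dots> < \<infinity>"
    unfolding suminf_ennreal2[OF nn summ]
    by (simp only: infinity_ennreal_def ennreal_less_top)
  finally have fin: "(\<integral>\<^sup>+y. (\<Sum>k. ennreal (Z k y)) \<partial>unit_interval) < \<infinity>" .
  have "(\<lambda>y. \<Sum>k. ennreal (Z k y)) \<in> borel_measurable unit_interval"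
    by (intro borel_measurable_suminf_order measurable_compose[OF Zm measurable_ennreal])
  then have "AE y in unit_interval. (\<Sum>k. ennreal (Z k y)) \<noteq> \<infinity>"
    by (rule nn_integral_PInf_AE) (rule less_imp_neq[OF fin])
  then show ?thesis
  proof (rule AE_mp, intro AE_I2 impI)
    fix y assume "y \<in> space unit_interval" and fin: "(\<Sum>k. ennreal (Z k y)) \<noteq> \<infinity>"
    then have y: "y \<in> {0..<1}" by simp
    have "summable (\<lambda>k. Z k y)"
      by (rule summable_suminf_not_top) (use fin in \<open>auto simp: Z_def\<close>)
    then have "(\<lambda>k. sqrt (Z k y)) \<longlonglongrightarrow> 0"
      using tendsto_real_sqrt[OF summable_LIMSEQ_zero] by fastforce
    then have "(\<lambda>k. \<bar>path_sum Y ((Suc k)\<^sup>2) \<phi> y / real ((Suc k)\<^sup>2)\<bar>) \<longlonglongrightarrow> 0"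
      unfolding Z_def real_sqrt_abs .
    then have "(\<lambda>k. path_sum Y ((Suc k)\<^sup>2) \<phi> y / real ((Suc k)\<^sup>2)) \<longlonglongrightarrow> 0"
      by (rule tendsto_rabs_zero_cancel)
    then have sq: "(\<lambda>k. path_sum Y (k\<^sup>2) \<phi> y / real (k\<^sup>2)) \<longlonglongrightarrow> 0"
      by (subst filterlim_sequentially_Suc[symmetric])
    show "(\<lambda>n. path_sum Y n \<phi> y / real n) \<longlonglongrightarrow> 0"
    proof (rule subseq_squares_imp_tendsto_0[OF _ sq])
      show "\<bar>path_sum Y (Suc n) \<phi> y - path_sum Y n \<phi> y\<bar> \<le> B" for n
        unfolding path_sum_def
        using Y[OF state_Adm[OF y \<phi>] digit_less[OF E_iterate_in[OF y]]] by simp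
    qed
  qed
qed

end

section \<open>Walks over the expanding map\<close>

text \<open>The square root of \<open>min 1 (exp u)\<close>: the factor that remains at position
  \<open>u\<close> when the bound of order \<open>exp u\<close> on the deviation from \<xi> is
  averaged geometrically with a Lipschitz bound in \<open>y\<close>.\<close>

definition weight :: "real \<Rightarrow> real" where
  "weight u = exp (min u 0 / 2)"

lemma weight_nonneg [simp]: "0 \<le> weight u"
  and weight_le_1 [simp]: "weight u \<le> 1"
  by (auto simp: weight_def)

lemma weight_mono: "u \<le> v \<Longrightarrow> weight u \<le> weight v"
  by (auto simp: weight_def)

lemma weight_shift:
  assumes "u - M \<le> v" "0 \<le> M" shows "weight u \<le> exp (M / 2) * weight v"
  using assms by (auto simp: weight_def min_def simp flip: exp_add)

text \<open>Conditioning on the first \<open>n\<close> digits of \<open>y\<close> turns the position after \<open>n\<close> steps into a curve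
  over the uniformly distributed remainder of \<open>y\<close>. In the modulus of continuity below, \<open>\<kappa>\<close> is small
  for large \<open>m\<close>, whereas \<open>B\<close> depends on the map and may be large: the curves are nearly constant
  only far to the left, where the weight is negligible.\<close>

definition curves :: "real \<Rightarrow> real \<Rightarrow> (real \<Rightarrow> real) set" where
  "curves \<kappa> B = {\<phi>. \<forall>t\<in>{0..<1}. \<forall>t'\<in>{0..<1}.
     \<bar>\<phi> t - \<phi> t'\<bar> \<le> (\<kappa> + B * weight (\<phi> t)) * sqrt \<bar>t - t'\<bar>}"

text \<open>\<zeta> approximates the increment to the right of \<open>K1\<close>, and
  \<open>astar\<close> is a digit that pushes every point left. \<open>B\<close>, \<open>K1\<close>
  and \<open>L\<close> depend on the individual map; the two conditions in \<open>m_large\<close>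
  avoid them. \<open>\<kappa>_small\<close> keeps the oscillation of curves far left small against
  the standard deviation of \<xi>.\<close>

locale driven_walk = expansion m for m +
  fixes D :: "real \<Rightarrow> real \<Rightarrow> real" and \<xi> \<zeta> :: "real \<Rightarrow> real"
    and M \<kappa> B c0 Lu L\<xi> \<sigma>2 c1 K1 L :: real and astar :: nat
  assumes pos: "M > 0" "\<kappa> > 0" "B \<ge> 0" "c0 > 0" "Lu \<ge> 0" "L\<xi> \<ge> 0" "\<sigma>2 > 0" "c1 > 0" "L > 0"
    and D_cont: "continuous_on ({0..<1} \<times> UNIV) (\<lambda>(y, u). D y u)"
    and D_bound: "y \<in> {0..<1} \<Longrightarrow> \<bar>D y u\<bar> \<le> M"
    and D_left: "y \<in> {0..<1} \<Longrightarrow> \<bar>D y u - \<xi> y\<bar> \<le> c0 * exp u"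
    and step_Lipschitz: "y \<in> {0..<1} \<Longrightarrow> \<bar>(u + D y u) - (v + D y v)\<bar> \<le> Lu * \<bar>u - v\<bar>"
    and D_holder: "y \<in> {0..<1} \<Longrightarrow> z \<in> {0..<1} \<Longrightarrow>
        \<bar>D y u - D z u\<bar> \<le> L\<xi> * \<bar>y - z\<bar> + B * weight u * sqrt \<bar>y - z\<bar>"
    and m_large: "L\<xi> + Lu * \<kappa> \<le> \<kappa> * sqrt m" "(1 + Lu) * exp (M / 2) \<le> sqrt m"
    and \<xi>_cont: "continuous_on {0..<1} \<xi>"
    and \<xi>_bound: "y \<in> {0..<1} \<Longrightarrow> \<bar>\<xi> y\<bar> \<le> M"
    and \<xi>_mean: "(\<integral>y. \<xi> y \<partial>unit_interval) = 0"
    and \<xi>_variance: "(\<integral>y. (\<xi> y)\<^sup>2 \<partial>unit_interval) = \<sigma>2"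
    and \<kappa>_small: "28 * (2 * \<kappa>)\<^sup>2 \<le> \<sigma>2"
    and astar: "astar < m" "t \<in> {0..<1} \<Longrightarrow> D (branch m astar t) u \<le> - c1"
    and \<zeta>_cont: "continuous_on {0..<1} \<zeta>"
    and \<zeta>_bound: "y \<in> {0..<1} \<Longrightarrow> \<bar>\<zeta> y\<bar> \<le> M"
    and \<zeta>_mean: "(\<integral>y. \<zeta> y \<partial>unit_interval) = - L"
    and D_right: "y \<in> {0..<1} \<Longrightarrow> K1 \<le> u \<Longrightarrow> \<bar>D y u - \<zeta> y\<bar> \<le> L / 2"
begin

definition "next_curve \<phi> y = \<phi> y + D y (\<phi> y)"

text \<open>After the digit \<open>a\<close> has been read, only the part of the curve over the
  \<open>a\<close>-th branch remains possible; \<open>T a\<close> moves it and stretches it back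
  over the whole interval.\<close>

definition T :: "nat \<Rightarrow> (real \<Rightarrow> real) \<Rightarrow> real \<Rightarrow> real" where
  "T a \<phi> t = next_curve \<phi> (branch m a t)"

abbreviation Adm :: "(real \<Rightarrow> real) set" where "Adm \<equiv> curves \<kappa> B"

lemma curve_holder:
  assumes "\<phi> \<in> Adm" "t \<in> {0..<1}" "t' \<in> {0..<1}"
  shows "\<bar>\<phi> t - \<phi> t'\<bar> \<le> (\<kappa> + B * weight (\<phi> t)) * sqrt \<bar>t - t'\<bar>"
  using assms unfolding curves_def by blast

lemma curve_osc:
  assumes "\<phi> \<in> Adm" "t \<in> {0..<1}" "t' \<in> {0..<1}"
  shows "\<bar>\<phi> t - \<phi> t'\<bar> \<le> \<kappa> + B * weight (\<phi> t)"
proof -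
  have "sqrt \<bar>t - t'\<bar> \<le> 1" using assms by (auto simp: abs_if)
  then have "(\<kappa> + B * weight (\<phi> t)) * sqrt \<bar>t - t'\<bar> \<le> (\<kappa> + B * weight (\<phi> t)) * 1"
    using pos by (intro mult_left_mono) auto
  then show ?thesis using curve_holder[OF assms] by simp
qed

lemma B_weight_le: "B * weight u \<le> B"
  using pos mult_left_mono[OF weight_le_1] by fastforce

lemma curve_osc':
  assumes "\<phi> \<in> Adm" "t \<in> {0..<1}" "t' \<in> {0..<1}"
  shows "\<bar>\<phi> t - \<phi> t'\<bar> \<le> \<kappa> + B"
  using curve_osc[OF assms] B_weight_le[of "\<phi> t"] by linarith

lemma const_Adm: "(\<lambda>_. c) \<in> Adm"
  using pos by (auto simp: curves_def)

lemma curve_cont: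
  assumes \<phi>: "\<phi> \<in> Adm" shows "continuous_on {0..<1} \<phi>"
  unfolding continuous_on
proof
  fix t :: real assume t: "t \<in> {0..<1}"
  have "((\<lambda>s. (\<kappa> + B * weight (\<phi> t)) * sqrt \<bar>t - s\<bar>) \<longlongrightarrow> (\<kappa> + B * weight (\<phi> t)) * sqrt \<bar>t - t\<bar>)
      (at t within {0..<1})"
    by (intro tendsto_intros)
  then have lim: "((\<lambda>s. (\<kappa> + B * weight (\<phi> t)) * sqrt \<bar>t - s\<bar>) \<longlongrightarrow> 0) (at t within {0..<1})"
    by simp
  have "((\<lambda>s. \<phi> s - \<phi> t) \<longlongrightarrow> 0) (at t within {0..<1})"
    by (rule Lim_null_comparison[OF _ lim])
      (use curve_holder[OF \<phi> t] in \<open>auto simp: eventually_at_filter abs_minus_commute\<close>)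
  then show "(\<phi> \<longlongrightarrow> \<phi> t) (at t within {0..<1})"
    by (simp add: LIM_zero_iff)
qed

lemma next_cont:
  assumes \<phi>: "\<phi> \<in> Adm" shows "continuous_on {0..<1} (next_curve \<phi>)"
proof -
  have "continuous_on {0..<1} ((\<lambda>(y, u). D y u) \<circ> (\<lambda>y. (y, \<phi> y)))"
    by (intro continuous_on_compose continuous_on_Pair continuous_on_id curve_cont[OF \<phi>]
        continuous_on_subset[OF D_cont]) auto
  then show ?thesis
    unfolding next_curve_def comp_def by (auto intro!: continuous_intros curve_cont[OF \<phi>])
qed

lemma next_bound: "y \<in> {0..<1} \<Longrightarrow> \<bar>next_curve \<phi> y - \<phi> y\<bar> \<le> M"
  using D_bound by (simp add: next_curve_def)

text \<open>Stretching a branch divides the Hoelder modulus by \<open>sqrt m\<close>, while the step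
  multiplies oscillations by at most \<open>Lu\<close> and adds the variation of \<open>D\<close> in
  \<open>y\<close>. The weight can shrink by the factor \<open>exp (M / 2)\<close> when the point
  moves left. The first condition in \<open>m_large\<close> absorbs the part with \<kappa>, the
  second the part with \<open>B\<close>, where \<open>B\<close> is a common factor.\<close>

lemma T_Adm:
  assumes a: "a < m" and \<phi>: "\<phi> \<in> Adm" shows "T a \<phi> \<in> Adm"
  unfolding curves_def
proof (intro CollectI ballI)
  fix t t' :: real assume t: "t \<in> {0..<1}" and t': "t' \<in> {0..<1}"
  define y z where "y = branch m a t" and "z = branch m a t'"
  have y: "y \<in> {0..<1}" and z: "z \<in> {0..<1}"
    using branch_in[OF a] t t' by (auto simp: y_def z_def simp del: atLeastLessThan_iff)
  define h where "h = sqrt \<bar>t - t'\<bar>"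
  have h: "0 \<le> h" "h \<le> 1" using t t' by (auto simp: h_def abs_if)
  have "\<bar>y - z\<bar> = \<bar>t - t'\<bar> / m"
    by (simp add: y_def z_def branch_def abs_divide flip: diff_divide_distrib)
  then have yz: "\<bar>y - z\<bar> = (h / sqrt m)\<^sup>2" and sq: "sqrt \<bar>y - z\<bar> = h / sqrt m"
    by (simp_all add: h_def power_divide real_sqrt_divide)
  let ?w = "weight (\<phi> y)"
  have m1: "1 \<le> sqrt m" using m_ge_2 by simp
  \<comment> \<open>This fits the Lipschitz variation of \<xi> into the Hoelder modulus.\<close>
  have hm: "(h / sqrt m)\<^sup>2 \<le> h / sqrt m"
  proof -
    have "h \<le> sqrt m" using h m1 by linarith
    then have "h / sqrt m \<le> 1" by (simp add: divide_le_eq)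
    then show ?thesis unfolding power2_eq_square by (rule mult_left_le) (use h in auto)
  qed
  have "\<bar>T a \<phi> t - T a \<phi> t'\<bar> = \<bar>(\<phi> y + D y (\<phi> y)) - (\<phi> z + D z (\<phi> z))\<bar>"
    by (simp add: T_def next_curve_def y_def z_def)
  also have "\<dots> \<le> \<bar>D y (\<phi> y) - D z (\<phi> y)\<bar> + \<bar>(\<phi> y + D z (\<phi> y)) - (\<phi> z + D z (\<phi> z))\<bar>"
    by linarith
  also have "\<dots> \<le> (L\<xi> * \<bar>y - z\<bar> + B * ?w * sqrt \<bar>y - z\<bar>) + Lu * \<bar>\<phi> y - \<phi> z\<bar>"
    by (intro add_mono D_holder step_Lipschitz y z)
  also have "\<dots> \<le> (L\<xi> * (h / sqrt m) + B * ?w * (h / sqrt m)) + Lu * ((\<kappa> + B * ?w) * (h / sqrt m))"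
    using pos h hm curve_holder[OF \<phi> y z]
    by (intro add_mono mult_left_mono) (auto simp: yz sq)
  also have "\<dots> = ((L\<xi> + Lu * \<kappa>) + B * ((1 + Lu) * ?w)) * (h / sqrt m)"
    by (simp add: algebra_simps)
  also have "\<dots> \<le> (\<kappa> * sqrt m + B * (sqrt m * weight (T a \<phi> t))) * (h / sqrt m)"
  proof -
    have "T a \<phi> t - \<phi> y \<le> M" "\<phi> y - T a \<phi> t \<le> M"
      using next_bound[OF y, of \<phi>] by (auto simp: T_def y_def abs_if split: if_splits)
    then have "?w \<le> exp (M / 2) * weight (T a \<phi> t)" using pos by (intro weight_shift) auto
    then have "(1 + Lu) * ?w \<le> (1 + Lu) * (exp (M / 2) * weight (T a \<phi> t))"
      using pos by (intro mult_left_mono) auto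
    also have "\<dots> \<le> sqrt m * weight (T a \<phi> t)"
      using m_large(2) by (simp add: mult_right_mono flip: mult.assoc)
    finally show ?thesis
      using pos m_large(1) h by (intro mult_right_mono add_mono mult_left_mono) auto
  qed
  also have "\<dots> = (\<kappa> + B * weight (T a \<phi> t)) * h"
    using m1 by (simp add: field_simps)
  finally show "\<bar>T a \<phi> t - T a \<phi> t'\<bar> \<le> (\<kappa> + B * weight (T a \<phi> t)) * sqrt \<bar>t - t'\<bar>"
    by (simp add: h_def)
qed

sublocale driven_chain m T Adm
  by standard (rule T_Adm)

section \<open>Single orbits and integrals along curves\<close>

primrec walk :: "nat \<Rightarrow> real \<Rightarrow> real \<Rightarrow> real" where
  "walk 0 u y = u"
| "walk (Suc n) u y = walk n u y + D ((E ^^ n) y) (walk n u y)"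

lemma walk_front: "walk (Suc n) u y = walk n (u + D y u) (E y)"
proof (induction n)
  case (Suc n)
  then show ?case by (simp add: funpow_swap1)
qed simp

text \<open>The digits read so far determine the curve, and the actual remainder
  \<open>(E ^^ n) y\<close> picks the point on it; this is the bridge from curves back to
  orbits.\<close>

lemma state_walk: "y \<in> {0..<1} \<Longrightarrow> state n \<phi> y ((E ^^ n) y) = walk n (\<phi> y) y"
proof (induction n arbitrary: \<phi> y)
  case (Suc n)
  have "state (Suc n) \<phi> y ((E ^^ Suc n) y) = state n (T (digit m y) \<phi>) (E y) ((E ^^ n) (E y))"
    by (simp add: funpow_swap1)
  also have "\<dots> = walk n (T (digit m y) \<phi> (E y)) (E y)"
    by (rule Suc.IH) (rule E_in)
  also have "\<dots> = walk (Suc n) (\<phi> y) y"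
    using Suc.prems unfolding walk_front by (simp add: T_def next_curve_def)
  finally show ?case .
qed simp

lemma curve_range:
  assumes "\<phi> \<in> Adm"
  shows "\<exists>b>0. (\<forall>t\<in>{0..<1}. \<bar>\<phi> t\<bar> \<le> b)"
proof (intro exI[of _ "\<bar>\<phi> 0\<bar> + (\<kappa> + B) + 1"] conjI ballI)
  show "0 < \<bar>\<phi> 0\<bar> + (\<kappa> + B) + 1" using pos by simp
  show "\<bar>\<phi> t\<bar> \<le> \<bar>\<phi> 0\<bar> + (\<kappa> + B) + 1" if "t \<in> {0..<1}" for t
    using curve_osc'[OF assms that, of 0] by auto
qed

lemma continuous_on_bounded_interval_integrable:
  fixes f g :: "real \<Rightarrow> real"
  assumes g: "continuous_on {0..<1} g" "\<And>t. t \<in> {0..<1} \<Longrightarrow> \<bar>g t\<bar> \<le> b"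
    and f: "continuous_on UNIV f"
  shows "integrable unit_interval (\<lambda>t. f (g t))" "\<exists>C. \<forall>t\<in>{0..<1}. \<bar>f (g t)\<bar> \<le> C"
proof -
  have "compact (f ` {-b..b})"
    by (intro compact_continuous_image continuous_on_subset[OF f]) auto
  then obtain C where C: "\<And>x. x \<in> f ` {-b..b} \<Longrightarrow> \<bar>x\<bar> \<le> C"
    by (metis bounded_iff compact_imp_bounded real_norm_def)
  have bd: "\<bar>f (g t)\<bar> \<le> C" if "t \<in> {0..<1}" for t
    using g(2)[OF that] by (intro C) (auto simp: abs_le_iff)
  show "\<exists>C. \<forall>t\<in>{0..<1}. \<bar>f (g t)\<bar> \<le> C" using bd by blast
  have "continuous_on {0..<1} (f \<circ> g)"
    by (intro continuous_on_compose g continuous_on_subset[OF f]) auto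
  then show "integrable unit_interval (\<lambda>t. f (g t))"
    by (intro integrable_unit[OF continuous_imp_measurable_unit bd]) (auto simp: comp_def)
qed

lemma next_range:
  assumes "\<phi> \<in> Adm"
  shows "\<exists>b. (\<forall>t\<in>{0..<1}. \<bar>next_curve \<phi> t\<bar> \<le> b)"
proof -
  obtain b where b: "\<forall>t\<in>{0..<1}. \<bar>\<phi> t\<bar> \<le> b" using curve_range[OF assms] by blast
  have "\<bar>next_curve \<phi> t\<bar> \<le> b + M" if "t \<in> {0..<1}" for t
    using next_bound[OF that, of \<phi>] bspec[OF b that] by linarith
  then show ?thesis by blast
qed

lemma integrable_curve:
  "\<phi> \<in> Adm \<Longrightarrow> continuous_on UNIV f \<Longrightarrow> integrable unit_interval (\<lambda>t. f (\<phi> t) :: real)"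
  using curve_range[of \<phi>] continuous_on_bounded_interval_integrable(1)[OF curve_cont] by blast

lemma integrable_next:
  "\<phi> \<in> Adm \<Longrightarrow> continuous_on UNIV f \<Longrightarrow> integrable unit_interval (\<lambda>t. f (next_curve \<phi> t) :: real)"
  using next_range[of \<phi>] continuous_on_bounded_interval_integrable(1)[OF next_cont] by blast

text \<open>A uniform digit followed by a uniform remainder is a uniform \<open>y\<close>. Hence the
  integral of \<open>f\<close> along a curve has as one-step drift the integral of
  \<open>f (next_curve \<phi> y) - f (\<phi> y)\<close>, a comparison at the same \<open>y\<close>.
  All potentials below are such integrals or truncations of them.\<close>

lemma average_T:
  fixes f :: "real \<Rightarrow> real"
  assumes \<phi>: "\<phi> \<in> Adm" and f: "continuous_on UNIV f"
  shows "average m (\<lambda>a. \<integral>t. f (T a \<phi> t) \<partial>unit_interval) = (\<integral>y. f (next_curve \<phi> y) \<partial>unit_interval)"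
proof -
  obtain b where b: "\<And>t. t \<in> {0..<1} \<Longrightarrow> \<bar>next_curve \<phi> t\<bar> \<le> b"
    using next_range[OF \<phi>] by blast
  obtain C where C: "\<And>t. t \<in> {0..<1} \<Longrightarrow> \<bar>f (next_curve \<phi> t)\<bar> \<le> C"
    using continuous_on_bounded_interval_integrable(2)[OF next_cont[OF \<phi>] b f] by blast
  have "(\<integral>y. f (next_curve \<phi> y) \<partial>unit_interval)
      = average m (\<lambda>a. \<integral>t. f (next_curve \<phi> (branch m a t)) \<partial>unit_interval)"
  proof (rule self_similar_integral[OF _ C])
    fix a assume "a < m"
    then have "integrable unit_interval (\<lambda>t. f (T a \<phi> t))"
      by (intro integrable_curve T_Adm \<phi> f)
    then show "(\<lambda>t. f (next_curve \<phi> (branch m a t))) \<in> borel_measurable unit_interval"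
      by (simp add: T_def)
  qed
  then show ?thesis by (simp add: T_def)
qed

end

section \<open>Exponential functions of the walk\<close>

text \<open>The quadratic Taylor polynomials of \<open>exp\<close> at \<open>- x\<close> and at
  \<open>x\<close> have the product \<open>1 + x ^ 4 / 4\<close>.\<close>

lemma exp_minus_le_quadratic: "0 \<le> x \<Longrightarrow> exp (- x) \<le> 1 - x + x\<^sup>2 / 2" for x :: real
proof -
  assume x: "0 \<le> x"
  have "1 \<le> (1 - x + x\<^sup>2 / 2) * (1 + x + x\<^sup>2 / 2)"
    using x by (simp add: algebra_simps power2_eq_square)
  also have "\<dots> \<le> (1 - x + x\<^sup>2 / 2) * exp x"
  proof (rule mult_left_mono[OF exp_lower_Taylor_quadratic[OF x]])
    have "0 \<le> (x - 1)\<^sup>2 + 1" by simp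
    then show "0 \<le> 1 - x + x\<^sup>2 / 2" by (simp add: power2_eq_square algebra_simps)
  qed
  finally show ?thesis by (simp add: exp_minus field_simps)
qed

lemma exp_minus_ge_quadratic:
  fixes x :: real
  assumes "0 \<le> x" "x \<le> 1" shows "1 - x + x\<^sup>2 / 4 \<le> exp (- x)"
proof -
  define g where "g t = exp (- t) - 1 + t - t\<^sup>2 / 4" for t :: real
  have "g 0 \<le> g x"
  proof (rule DERIV_nonneg_imp_nondecreasing[OF assms(1)])
    fix t assume t: "0 \<le> t" "t \<le> x"
    have "(g has_real_derivative (- exp (- t) + 1 - t / 2)) (at t)"
      unfolding g_def by (auto intro!: derivative_eq_intros)
    moreover have "0 \<le> - exp (- t) + 1 - t / 2"
    proof -
      have "t * t \<le> t" using t assms by (simp add: mult_left_le)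
      then show ?thesis using exp_minus_le_quadratic[OF t(1)] by (simp add: power2_eq_square)
    qed
    ultimately show "\<exists>d. (g has_real_derivative d) (at t) \<and> 0 \<le> d" by blast
  qed
  then show ?thesis by (simp add: g_def)
qed

lemma exp_quadratic_bounds:
  fixes z :: real
  assumes "\<bar>z\<bar> \<le> 1"
  shows "1 + z + z\<^sup>2 / 4 \<le> exp z" "exp z \<le> 1 + z + z\<^sup>2"
proof -
  have z2: "0 \<le> z\<^sup>2" by simp
  show "1 + z + z\<^sup>2 / 4 \<le> exp z"
  proof (cases "0 \<le> z")
    case True
    show ?thesis using exp_lower_Taylor_quadratic[OF True] z2 by linarith
  next
    case False
    then show ?thesis using exp_minus_ge_quadratic[of "- z"] assms by simp
  qed
  show "exp z \<le> 1 + z + z\<^sup>2"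
  proof (cases "0 \<le> z")
    case True
    then show ?thesis using exp_bound[of z] assms by simp
  next
    case False
    then have "exp z \<le> 1 + z + z\<^sup>2 / 2" using exp_minus_le_quadratic[of "- z"] by simp
    then show ?thesis using z2 by linarith
  qed
qed

context driven_walk
begin

text \<open>\<open>N\<close> bounds the distance of the next position from the reference level
  \<open>\<phi> 0\<close>; \<open>s0\<close> keeps \<open>s0 * N\<close> below 1, where the
  quadratic bounds for \<open>exp\<close> apply. \<theta> is half of the drift coefficient
  \<open>s0\<^sup>2 * \<sigma>2 / 20\<close> found below; the other half pays for
  \<open>defect\<close>, which bounds the deviation of the increment from \<xi>.\<close>

definition "N = M + 2 * \<kappa>"
definition "s0 = 1 / (2 * (N + 1))"
definition "\<theta> = s0\<^sup>2 * \<sigma>2 / 40"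
definition "defect c = c0 * exp (c + 2 * \<kappa>)"

definition far_left :: "real \<Rightarrow> bool" where
  "far_left c \<longleftrightarrow> c + 2 * \<kappa> + M \<le> 0 \<and> B * weight c \<le> \<kappa> \<and> defect c \<le> 2 * \<kappa> \<and>
     2 * defect c \<le> \<theta> * exp (s0 * c)"

lemma s0_pos: "s0 > 0" and s0_half: "s0 \<le> 1 / 2" and s0_N: "s0 * N \<le> 1"
  and \<theta>_pos: "\<theta> > 0"
  using pos by (auto simp: N_def s0_def \<theta>_def field_simps add_pos_pos)

text \<open>The quantities to be made small decay at least like \<open>exp (c / 2)\<close>. For the
  last condition \<open>exp c\<close> is split into two such factors, one of which is at most
  \<open>exp (s0 * c)\<close> because \<open>s0 \<le> 1 / 2\<close>.\<close>

lemma far_left_eventually: "\<exists>K0. \<forall>c\<le>K0. far_left c"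
proof -
  have 1: "\<forall>\<^sub>F c in at_bot. c \<le> - (2 * \<kappa> + M)" by (rule eventually_le_at_bot)
  have e: "filterlim (\<lambda>c::real. c / 2) at_bot at_bot"
    by (rule filterlim_tendsto_pos_mult_at_bot[of "\<lambda>_. 1/2" "1/2", simplified]) (auto intro: filterlim_ident)
  have e2: "((\<lambda>c. exp (c / 2)) \<longlongrightarrow> (0::real)) at_bot"
    by (rule filterlim_compose[OF exp_at_bot e])
  have lim: "((\<lambda>c. a * exp (c / 2)) \<longlongrightarrow> (0::real)) at_bot" for a
    using tendsto_mult_right_zero[OF e2] .
  have 2: "\<forall>\<^sub>F c in at_bot. B * exp (c / 2) < \<kappa>" "\<forall>\<^sub>F c in at_bot. c0 * exp (2 * \<kappa>) * exp (c / 2) < 2 * \<kappa>"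
     "\<forall>\<^sub>F c in at_bot. 2 * c0 * exp (2 * \<kappa>) * exp (c / 2) < \<theta>"
    using pos \<theta>_pos by (auto intro!: order_tendstoD(2)[OF lim])
  have "\<forall>\<^sub>F c in at_bot. far_left c"
    using 1 2
  proof eventually_elim
    case (elim c)
    then have c: "c \<le> 0" using pos by linarith
    have e1: "exp c = exp (c / 2) * exp (c / 2)" by (simp flip: exp_add)
    have "exp (c / 2) \<le> 1" using c by simp
    then have d1: "exp c \<le> exp (c / 2)" unfolding e1 by (simp add: mult_left_le)
    have "s0 * c \<ge> (1 / 2) * c" using c s0_half by (rule mult_right_mono_neg[rotated])
    then have d2: "exp c \<le> exp (c / 2) * exp (s0 * c)"
      unfolding e1 by (intro mult_left_mono) auto
    have D: "defect c = c0 * exp (2 * \<kappa>) * exp c" by (simp add: defect_def exp_add)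
    have "defect c \<le> c0 * exp (2 * \<kappa>) * exp (c / 2)"
      unfolding D using d1 pos by (intro mult_left_mono) auto
    moreover have "2 * defect c \<le> \<theta> * exp (s0 * c)"
    proof -
      have "2 * defect c \<le> 2 * c0 * exp (2 * \<kappa>) * exp (c / 2) * exp (s0 * c)"
        unfolding D using d2 pos by (simp add: mult_left_mono mult.assoc)
      also have "2 * c0 * exp (2 * \<kappa>) * exp (c / 2) * exp (s0 * c) \<le> \<theta> * exp (s0 * c)"
        using elim by (intro mult_right_mono) auto
      finally show ?thesis .
    qed
    ultimately show ?case
      using elim c unfolding far_left_def by (simp add: weight_def)
  qed
  then show ?thesis by (auto simp: eventually_at_bot_linorder)
qed

lemma far_left_curve:
  assumes "\<phi> \<in> Adm" "far_left (\<phi> 0)" "t \<in> {0..<1}"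
  shows "\<bar>\<phi> t - \<phi> 0\<bar> \<le> 2 * \<kappa>" "\<phi> t \<le> 0" "next_curve \<phi> t \<le> 0"
proof -
  show *: "\<bar>\<phi> t - \<phi> 0\<bar> \<le> 2 * \<kappa>"
    using curve_osc[OF assms(1), of 0 t] assms(2,3) by (auto simp: far_left_def abs_minus_commute)
  show "\<phi> t \<le> 0" "next_curve \<phi> t \<le> 0"
    using * assms(2) next_bound[OF assms(3), of \<phi>] pos unfolding far_left_def by linarith+
qed

lemma integrable_\<xi>: "integrable unit_interval \<xi>" "integrable unit_interval (\<lambda>y. (\<xi> y)\<^sup>2)"
  by (rule continuous_on_bounded_interval_integrable(1)[OF \<xi>_cont \<xi>_bound];
      auto intro!: continuous_intros)+

lemma far_left_increment:
  assumes \<phi>: "\<phi> \<in> Adm" and c: "far_left (\<phi> 0)" and y: "y \<in> {0..<1}"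
  defines "v \<equiv> \<phi> y - \<phi> 0" and "\<Delta> \<equiv> D y (\<phi> y)"
  shows "\<bar>v\<bar> \<le> 2 * \<kappa>" "\<bar>\<Delta> - \<xi> y\<bar> \<le> defect (\<phi> 0)" "\<bar>v + \<Delta>\<bar> \<le> N"
proof -
  show v: "\<bar>v\<bar> \<le> 2 * \<kappa>" using far_left_curve(1)[OF \<phi> c y] by (simp add: v_def)
  have "c0 * exp (\<phi> y) \<le> defect (\<phi> 0)"
    unfolding defect_def using v pos by (intro mult_left_mono) (auto simp: v_def)
  then show "\<bar>\<Delta> - \<xi> y\<bar> \<le> defect (\<phi> 0)"
    using D_left[OF y, of "\<phi> y"] by (simp add: \<Delta>_def)
  show "\<bar>v + \<Delta>\<bar> \<le> N" using v D_bound[OF y, of "\<phi> y"] by (simp add: \<Delta>_def N_def)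
qed

lemma scaled_small: "0 < s \<Longrightarrow> s \<le> s0 \<Longrightarrow> \<bar>w\<bar> \<le> N \<Longrightarrow> \<bar>s * w\<bar> \<le> 1"
  using s0_N mult_mono[of s s0 "\<bar>w\<bar>" N] s0_pos by (simp add: abs_mult)

text \<open>Relative to the level \<open>\<phi> 0\<close> the linear terms in \<open>v\<close>
  cancel between the two exponentials, and \<xi> has mean 0, so the second order decides. The
  variance outweighs the oscillation of the curve since \<open>1 / 8 - 2 / 28 = 3 / 56\<close>
  exceeds \<open>1 / 20\<close>.\<close>

lemma exp_drift_lower:
  assumes \<phi>: "\<phi> \<in> Adm" and c: "far_left (\<phi> 0)" and s: "0 < s" "s \<le> s0"
  shows "exp (s * \<phi> 0) * (s\<^sup>2 * \<sigma>2 / 20 - s * defect (\<phi> 0)) \<le>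
    (\<integral>y. exp (s * next_curve \<phi> y) \<partial>unit_interval) - (\<integral>y. exp (s * \<phi> y) \<partial>unit_interval)"
proof -
  define c d where "c = \<phi> 0" and "d = defect c"
  have d: "0 \<le> d" "d \<le> 2 * \<kappa>" using c pos by (auto simp: far_left_def defect_def c_def d_def)
  define k where "k = (2 * \<kappa>)\<^sup>2"
  have pw: "exp (s * c) * (s * \<xi> y + (s\<^sup>2 / 8 * (\<xi> y)\<^sup>2 + (- s * d - 2 * s\<^sup>2 * k)))
      \<le> exp (s * next_curve \<phi> y) - exp (s * \<phi> y)" if y: "y \<in> {0..<1}" for y
  proof -
    define v \<Delta> where "v = \<phi> y - \<phi> 0" and "\<Delta> = D y (\<phi> y)"
    note f = far_left_increment[OF \<phi> c y, folded v_def \<Delta>_def, folded c_def, folded d_def]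
    have "\<bar>v\<bar> \<le> N" using f(1) pos by (simp add: N_def)
    then have e: "1 + s * (v + \<Delta>) + (s * (v + \<Delta>))\<^sup>2 / 4 \<le> exp (s * (v + \<Delta>))"
        "exp (s * v) \<le> 1 + s * v + (s * v)\<^sup>2"
      by (intro exp_quadratic_bounds scaled_small[OF s] f(3))+
    have e1: "1 + (s * v + s * \<Delta>) + s\<^sup>2 * (v + \<Delta>)\<^sup>2 / 4 \<le> exp (s * (v + \<Delta>))"
      using e(1)[unfolded power_mult_distrib] by (simp only: distrib_left)
    have e2: "exp (s * v) \<le> 1 + s * v + s\<^sup>2 * v\<^sup>2"
      using e(2)[unfolded power_mult_distrib] .
    have v2: "v\<^sup>2 \<le> k" unfolding k_def using power_mono[OF f(1), of 2] by simp
    have "\<bar>v + (\<Delta> - \<xi> y)\<bar> \<le> 2 * (2 * \<kappa>)" using f(1,2) d by linarith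
    from power_mono[OF this, of 2] have w2: "(v + (\<Delta> - \<xi> y))\<^sup>2 \<le> 4 * k"
      by (simp add: k_def power_mult_distrib)
    \<comment> \<open>With \<open>w = v + (\<Delta> - \<xi> y)\<close> this is the square of
      \<open>\<xi> y + 2 * w\<close>; it separates the variance of \<xi> from the perturbation
      \<open>w\<close> inside \<open>(\<xi> y + w)\<^sup>2\<close>.\<close>
    have "0 \<le> (v + \<Delta> + (v + (\<Delta> - \<xi> y)))\<^sup>2" by simp
    then have q: "(\<xi> y)\<^sup>2 / 2 - (v + (\<Delta> - \<xi> y))\<^sup>2 \<le> (v + \<Delta>)\<^sup>2"
      by (simp add: power2_eq_square algebra_simps)
    have "s * (\<xi> y - d) \<le> s * \<Delta>" using f(2) s by (intro mult_left_mono) auto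
    moreover have "s\<^sup>2 * ((\<xi> y)\<^sup>2 / 2 - 4 * k) / 4 \<le> s\<^sup>2 * (v + \<Delta>)\<^sup>2 / 4"
      using q w2 by (intro divide_right_mono mult_left_mono) auto
    moreover have "s\<^sup>2 * v\<^sup>2 \<le> s\<^sup>2 * k" using v2 by (intro mult_left_mono) auto
    ultimately have "s * \<xi> y + (s\<^sup>2 / 8 * (\<xi> y)\<^sup>2 + (- s * d - 2 * s\<^sup>2 * k))
        \<le> exp (s * (v + \<Delta>)) - exp (s * v)"
      using e1 e2 by (simp add: algebra_simps)
    then have "exp (s * c) * (s * \<xi> y + (s\<^sup>2 / 8 * (\<xi> y)\<^sup>2 + (- s * d - 2 * s\<^sup>2 * k)))
        \<le> exp (s * c) * (exp (s * (v + \<Delta>)) - exp (s * v))" by (intro mult_left_mono) auto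
    also have "\<dots> = exp (s * next_curve \<phi> y) - exp (s * \<phi> y)"
      by (simp add: v_def \<Delta>_def c_def next_curve_def algebra_simps flip: exp_add)
    finally show ?thesis .
  qed
  have i1: "integrable unit_interval (\<lambda>y. exp (s * next_curve \<phi> y))"
    and i2: "integrable unit_interval (\<lambda>y. exp (s * \<phi> y))"
    by (intro integrable_next integrable_curve \<phi> continuous_intros)+
  have "28 * k \<le> \<sigma>2" using \<kappa>_small by (simp add: k_def)
  then have "s\<^sup>2 * (\<sigma>2 / 20) \<le> s\<^sup>2 * (\<sigma>2 / 8 - 2 * k)"
    using pos by (intro mult_left_mono) auto
  then have "exp (s * c) * (s\<^sup>2 * \<sigma>2 / 20 - s * d)
      \<le> exp (s * c) * (s\<^sup>2 / 8 * \<sigma>2 + (- s * d - 2 * s\<^sup>2 * k))"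
    by (intro mult_left_mono) (auto simp: algebra_simps)
  also have "\<dots> = (\<integral>y. exp (s * c) * (s * \<xi> y + (s\<^sup>2 / 8 * (\<xi> y)\<^sup>2 + (- s * d - 2 * s\<^sup>2 * k)))
      \<partial>unit_interval)"
    using integrable_\<xi> by (simp add: \<xi>_mean \<xi>_variance)
  also have "\<dots> \<le> (\<integral>y. exp (s * next_curve \<phi> y) - exp (s * \<phi> y) \<partial>unit_interval)"
    by (intro integral_unit_mono pw) (use integrable_\<xi> i1 i2 in auto)
  also have "\<dots> = (\<integral>y. exp (s * next_curve \<phi> y) \<partial>unit_interval) - (\<integral>y. exp (s * \<phi> y) \<partial>unit_interval)"
    using i1 i2 by simp
  finally show ?thesis by (simp add: c_def d_def)
qed

text \<open>Here a crude bound by \<open>N\<close> for the second order is enough: after division by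
  \<open>s\<close> it contributes only \<open>s * N\<^sup>2\<close>, which vanishes with
  \<open>s\<close>.\<close>

lemma exp_drift_upper:
  assumes \<phi>: "\<phi> \<in> Adm" and c: "far_left (\<phi> 0)" and s: "0 < s" "s \<le> s0"
  shows "(\<integral>y. exp (s * next_curve \<phi> y) \<partial>unit_interval) - (\<integral>y. exp (s * \<phi> y) \<partial>unit_interval)
    \<le> exp (s * \<phi> 0) * (s * defect (\<phi> 0) + s\<^sup>2 * N\<^sup>2)"
proof -
  define c d where "c = \<phi> 0" and "d = defect c"
  have pw: "exp (s * next_curve \<phi> y) - exp (s * \<phi> y)
      \<le> exp (s * c) * (s * \<xi> y + (s * d + s\<^sup>2 * N\<^sup>2))" if y: "y \<in> {0..<1}" for y
  proof -
    define v \<Delta> where "v = \<phi> y - \<phi> 0" and "\<Delta> = D y (\<phi> y)"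
    note f = far_left_increment[OF \<phi> c y, folded v_def \<Delta>_def, folded c_def, folded d_def]
    have e: "exp (s * (v + \<Delta>)) \<le> 1 + s * (v + \<Delta>) + (s * (v + \<Delta>))\<^sup>2" "1 + s * v \<le> exp (s * v)"
      by (intro exp_quadratic_bounds(2) scaled_small[OF s] f(3)) (rule exp_ge_add_one_self)
    have e1: "exp (s * (v + \<Delta>)) \<le> 1 + (s * v + s * \<Delta>) + s\<^sup>2 * (v + \<Delta>)\<^sup>2"
      using e(1)[unfolded power_mult_distrib] by (simp only: distrib_left)
    have "s * \<Delta> \<le> s * (\<xi> y + d)" using f(2) s by (intro mult_left_mono) auto
    moreover have "s\<^sup>2 * (v + \<Delta>)\<^sup>2 \<le> s\<^sup>2 * N\<^sup>2"
      using power_mono[OF f(3), of 2] by (intro mult_left_mono) auto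
    ultimately have "exp (s * (v + \<Delta>)) - exp (s * v) \<le> s * \<xi> y + (s * d + s\<^sup>2 * N\<^sup>2)"
      using e1 e(2) unfolding distrib_left by linarith
    then have "exp (s * c) * (exp (s * (v + \<Delta>)) - exp (s * v))
        \<le> exp (s * c) * (s * \<xi> y + (s * d + s\<^sup>2 * N\<^sup>2))" by (intro mult_left_mono) auto
    moreover have "exp (s * c) * (exp (s * (v + \<Delta>)) - exp (s * v))
        = exp (s * next_curve \<phi> y) - exp (s * \<phi> y)"
      by (simp add: v_def \<Delta>_def c_def next_curve_def algebra_simps flip: exp_add)
    ultimately show ?thesis by simp
  qed
  have i1: "integrable unit_interval (\<lambda>y. exp (s * next_curve \<phi> y))"
    and i2: "integrable unit_interval (\<lambda>y. exp (s * \<phi> y))"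
    by (intro integrable_next integrable_curve \<phi> continuous_intros)+
  have "(\<integral>y. exp (s * next_curve \<phi> y) \<partial>unit_interval) - (\<integral>y. exp (s * \<phi> y) \<partial>unit_interval)
      = (\<integral>y. exp (s * next_curve \<phi> y) - exp (s * \<phi> y) \<partial>unit_interval)"
    using i1 i2 by simp
  also have "\<dots> \<le> (\<integral>y. exp (s * c) * (s * \<xi> y + (s * d + s\<^sup>2 * N\<^sup>2)) \<partial>unit_interval)"
    by (intro integral_unit_mono pw) (use integrable_\<xi> i1 i2 in auto)
  also have "\<dots> = exp (s * c) * (s * d + s\<^sup>2 * N\<^sup>2)"
    using integrable_\<xi> by (simp add: \<xi>_mean)
  finally show ?thesis by (simp add: c_def d_def)
qed

end

section \<open>Recurrence\<close>

context driven_walk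
begin

lemma measurable_curve: "\<phi> \<in> Adm \<Longrightarrow> \<phi> \<in> borel_measurable unit_interval"
  by (intro continuous_imp_measurable_unit curve_cont)

lemma walk_branch:
  "t \<in> {0..<1} \<Longrightarrow> walk (Suc i) (\<phi> (branch m a t)) (branch m a t) = walk i (T a \<phi> t) t"
  unfolding walk_front by (simp add: T_def next_curve_def)

lemma measurable_walk: "\<phi> \<in> Adm \<Longrightarrow> (\<lambda>y. walk i (\<phi> y) y) \<in> borel_measurable unit_interval"
proof (induction i arbitrary: \<phi>)
  case 0
  then show ?case by (simp add: measurable_curve)
next
  case (Suc i)
  show ?case
  proof (rule self_similar_measurable)
    fix a assume "a < m"
    then show "(\<lambda>t. walk (Suc i) (\<phi> (branch m a t)) (branch m a t)) \<in> borel_measurable unit_interval"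
      by (intro borel_measurable_unit_cong[THEN iffD2, OF walk_branch] Suc T_Adm)
  qed
qed

section \<open>The probability of staying left of a level\<close>

definition stays_below :: "real \<Rightarrow> nat set \<Rightarrow> (real \<Rightarrow> real) \<Rightarrow> real \<Rightarrow> real" where
  "stays_below K I \<phi> y = (if \<forall>i\<in>I. walk i (\<phi> y) y < K then 1 else 0)"

lemma measurable_stays_below:
  assumes "\<phi> \<in> Adm" shows "stays_below K I \<phi> \<in> borel_measurable unit_interval"
proof -
  have "Measurable.pred unit_interval (\<lambda>y. \<forall>i\<in>I. walk i (\<phi> y) y < K)"
    by (intro pred_intros_countable(1) pred_intros_countable_bounded(3)
        borel_measurable_pred_less measurable_walk[OF assms] borel_measurable_const countableI_type)
  from predE[OF this] show ?thesis
    unfolding stays_below_def[abs_def] by (intro measurable_If borel_measurable_const)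
qed

lemma integrable_stays_below: "\<phi> \<in> Adm \<Longrightarrow> integrable unit_interval (stays_below K I \<phi>)"
  by (rule integrable_unit[OF measurable_stays_below, of _ _ _ 1]) (auto simp: stays_below_def)

lemma stays_below_branch:
  "t \<in> {0..<1} \<Longrightarrow> stays_below K (Suc ` I) \<phi> (branch m a t) = stays_below K I (T a \<phi>) t"
  by (simp add: stays_below_def walk_branch del: walk.simps atLeastLessThan_iff)

text \<open>The Markov property at the first step: shifted times are times of the chain restarted
  from \<open>T a \<phi>\<close>.\<close>

lemma integral_stays_below_Suc:
  assumes \<phi>: "\<phi> \<in> Adm"
  shows "(\<integral>y. stays_below K (Suc ` I) \<phi> y \<partial>unit_interval)
    = average m (\<lambda>a. \<integral>t. stays_below K I (T a \<phi>) t \<partial>unit_interval)"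
proof -
  have "(\<integral>y. stays_below K (Suc ` I) \<phi> y \<partial>unit_interval)
    = average m (\<lambda>a. \<integral>t. stays_below K (Suc ` I) \<phi> (branch m a t) \<partial>unit_interval)"
  proof (rule self_similar_integral[where B = 1])
    fix a assume "a < m"
    then show "(\<lambda>t. stays_below K (Suc ` I) \<phi> (branch m a t)) \<in> borel_measurable unit_interval"
      by (intro borel_measurable_unit_cong[THEN iffD2, OF stays_below_branch] measurable_stays_below
          T_Adm \<phi>)
  qed (auto simp: stays_below_def)
  also have "\<dots> = average m (\<lambda>a. \<integral>t. stays_below K I (T a \<phi>) t \<partial>unit_interval)"
    by (intro average_cong Bochner_Integration.integral_cong) (simp_all add: stays_below_branch)
  finally show ?thesis .
qed

text \<open>It is 0 for \<open>u \<ge> 0\<close>, tends to \<open>1 + \<eta>\<close> at the far left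
  and is of order \<eta> on bounded ranges. Alone, \<open>exp (\<eta> * u)\<close> gains order
  \<open>\<eta>\<^sup>2\<close> per step against a loss of order \<open>\<eta> * defect\<close>,
  which would force the level to the left as \<eta> shrinks. The gain of the term with the fixed
  exponent \<open>s0\<close> covers this loss at a level independent of \<eta>.\<close>

definition barrier :: "real \<Rightarrow> real \<Rightarrow> real" where
  "barrier \<eta> u = 1 + \<eta> - exp (\<eta> * min u 0) - \<eta> * exp (s0 * min u 0)"

lemma barrier_cont: "continuous_on UNIV (barrier \<eta>)"
  unfolding barrier_def[abs_def] by (intro continuous_intros)

lemma barrier_nonneg: "0 < \<eta> \<Longrightarrow> 0 \<le> barrier \<eta> u"
proof -
  assume \<eta>: "0 < \<eta>"
  have "exp (\<eta> * min u 0) \<le> 1" "exp (s0 * min u 0) \<le> 1"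
    using \<eta> s0_pos by (simp_all add: mult_nonneg_nonpos)
  then have "\<eta> * exp (s0 * min u 0) \<le> \<eta> * 1" using \<eta> by (intro mult_left_mono) auto
  then show ?thesis using \<open>exp (\<eta> * min u 0) \<le> 1\<close> unfolding barrier_def by linarith
qed

lemma barrier_le: "0 < \<eta> \<Longrightarrow> 0 \<le> b \<Longrightarrow> - b \<le> u \<Longrightarrow> barrier \<eta> u \<le> \<eta> * (b + 1)"
proof -
  assume \<eta>: "0 < \<eta>" "0 \<le> b" "- b \<le> u"
  have "- (\<eta> * b) \<le> \<eta> * min u 0" using \<eta> mult_left_mono[of "- b" "min u 0" \<eta>] by auto
  moreover have "1 + \<eta> * min u 0 \<le> exp (\<eta> * min u 0)" by (rule exp_ge_add_one_self)
  moreover have "0 \<le> \<eta> * exp (s0 * min u 0)" using \<eta> by simp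
  moreover have "\<eta> * (b + 1) = \<eta> * b + \<eta>" by (simp add: distrib_left)
  ultimately show ?thesis unfolding barrier_def by linarith
qed

lemma barrier_ge_1: "0 < \<eta> \<Longrightarrow> \<exists>R. \<forall>u\<le>R. 1 \<le> barrier \<eta> u"
proof -
  assume \<eta>: "0 < \<eta>"
  have lim: "((\<lambda>u. exp (a * u)) \<longlongrightarrow> (0::real)) at_bot" if "0 < a" for a
    by (rule filterlim_compose[OF exp_at_bot])
      (rule filterlim_tendsto_pos_mult_at_bot[OF tendsto_const that filterlim_ident])
  have "((\<lambda>u. exp (\<eta> * u) + \<eta> * exp (s0 * u)) \<longlongrightarrow> 0 + \<eta> * 0) at_bot"
    by (intro tendsto_intros lim \<eta> s0_pos)
  then have "\<forall>\<^sub>F u in at_bot. exp (\<eta> * u) + \<eta> * exp (s0 * u) < \<eta>"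
    using \<eta> by (intro order_tendstoD(2)) auto
  moreover have "\<forall>\<^sub>F u in at_bot. u \<le> (0::real)" by (rule eventually_le_at_bot)
  ultimately have "\<forall>\<^sub>F u in at_bot. 1 \<le> barrier \<eta> u"
    by eventually_elim (auto simp: barrier_def)
  then show ?thesis by (auto simp: eventually_at_bot_linorder)
qed

lemma integral_clamp:
  assumes "\<And>t. t \<in> {0..<1} \<Longrightarrow> g t \<le> 0"
  shows "(\<integral>t. f (min (g t) 0) \<partial>unit_interval) = (\<integral>t. f (g t) \<partial>unit_interval)"
  by (rule Bochner_Integration.integral_cong) (use assms in \<open>auto simp: min_absorb1\<close>)

lemma far_left_defect:
  assumes "far_left c"
  shows "defect c * (1 + s0) \<le> \<theta> * exp (s0 * c)" "0 \<le> defect c" "c \<le> 0"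
proof -
  show d: "0 \<le> defect c" using pos by (simp add: defect_def)
  show "c \<le> 0" using assms pos by (simp add: far_left_def)
  have "defect c * (1 + s0) \<le> defect c * 2" using d s0_half by (intro mult_left_mono) auto
  then show "defect c * (1 + s0) \<le> \<theta> * exp (s0 * c)" using assms by (simp add: far_left_def)
qed

lemma two_\<theta>: "s0\<^sup>2 * \<sigma>2 / 20 = 2 * \<theta>"
  by (simp add: \<theta>_def)

text \<open>The losses from both exponentials, together \<open>\<eta> * defect * (1 + s0)\<close>,
  use up at most half of the gain
  \<open>2 * \<eta> * \<theta> * exp (s0 * \<phi> 0)\<close>.\<close>

lemma barrier_drift:
  assumes \<phi>: "\<phi> \<in> Adm" and c: "far_left (\<phi> 0)" and \<eta>: "0 < \<eta>" "\<eta> \<le> s0"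
  shows "(\<integral>y. barrier \<eta> (next_curve \<phi> y) \<partial>unit_interval)
     \<le> (\<integral>y. barrier \<eta> (\<phi> y) \<partial>unit_interval) - \<eta> * (\<theta> * exp (s0 * \<phi> 0))"
proof -
  let ?c = "\<phi> 0" let ?d = "defect (\<phi> 0)"
  note L = far_left_curve(2,3)[OF \<phi> c]
  note D = far_left_defect[OF c]
  let ?I = "\<lambda>s g. \<integral>y. exp (s * g y) \<partial>unit_interval"
  have i: "integrable unit_interval (\<lambda>y. exp (s * next_curve \<phi> y))"
     "integrable unit_interval (\<lambda>y. exp (s * \<phi> y))" for s
    by (intro integrable_next integrable_curve \<phi> continuous_intros)+
  have e: "(\<integral>y. barrier \<eta> (g y) \<partial>unit_interval) = 1 + \<eta> - ?I \<eta> g - \<eta> * ?I s0 g"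
    if "\<And>t. t \<in> {0..<1} \<Longrightarrow> g t \<le> 0"
      "\<And>s. integrable unit_interval (\<lambda>y. exp (s * g y))" for g
  proof -
    have "(\<integral>y. barrier \<eta> (g y) \<partial>unit_interval)
        = (\<integral>y. 1 + \<eta> - exp (\<eta> * g y) - \<eta> * exp (s0 * g y) \<partial>unit_interval)"
      unfolding barrier_def using that(1)
      by (rule integral_clamp[of g "\<lambda>u. 1 + \<eta> - exp (\<eta> * u) - \<eta> * exp (s0 * u)"])
    then show ?thesis using that(2) by simp
  qed
  have 1: "- (\<eta> * ?d) \<le> ?I \<eta> (next_curve \<phi>) - ?I \<eta> \<phi>"
  proof -
    have "exp (\<eta> * ?c) * (\<eta> * ?d) \<le> 1 * (\<eta> * ?d)"
      using D \<eta> by (intro mult_right_mono) (auto simp: mult_nonneg_nonpos)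
    moreover have "0 \<le> exp (\<eta> * ?c) * (\<eta>\<^sup>2 * \<sigma>2 / 20)" using pos by simp
    ultimately show ?thesis
      using exp_drift_lower[OF \<phi> c \<eta>] by (simp add: right_diff_distrib)
  qed
  have 2: "2 * \<theta> * exp (s0 * ?c) - s0 * ?d \<le> ?I s0 (next_curve \<phi>) - ?I s0 \<phi>"
  proof -
    have "exp (s0 * ?c) * (s0 * ?d) \<le> 1 * (s0 * ?d)"
      using D s0_pos by (intro mult_right_mono) (auto simp: mult_nonneg_nonpos)
    then show ?thesis
      using exp_drift_lower[OF \<phi> c s0_pos order_refl] unfolding two_\<theta>
      by (simp add: right_diff_distrib mult.commute)
  qed
  have "\<eta> * (\<theta> * exp (s0 * ?c)) \<le> \<eta> * (2 * \<theta> * exp (s0 * ?c) - s0 * ?d - ?d)"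
    using D(1) \<eta> by (intro mult_left_mono) (auto simp: algebra_simps)
  also have "\<dots> \<le> \<eta> * (?I s0 (next_curve \<phi>) - ?I s0 \<phi>) - \<eta> * ?d"
    using mult_left_mono[OF 2, of \<eta>] \<eta> by (simp add: algebra_simps)
  finally show ?thesis
    using 1 e[OF L(2) i(1)] e[OF L(1) i(2)] by (simp add: algebra_simps)
qed

text \<open>The margin \<open>2 * \<kappa>\<close> lets the condition reach the reference level
  \<open>\<phi> 0\<close> of every curve with at least one point at or below
  \<open>K\<close>.\<close>

definition "left_level K \<longleftrightarrow> (\<forall>c\<le>K + 2 * \<kappa>. far_left c)"

lemma left_level_exists: "\<exists>K. left_level K"
proof -
  obtain K0 where "\<forall>c\<le>K0. far_left c" using far_left_eventually by blast
  then have "left_level (K0 - 2 * \<kappa>)" by (simp add: left_level_def)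
  then show ?thesis ..
qed

lemma left_level_far_left:
  assumes K: "left_level K" and \<phi>: "\<phi> \<in> Adm" and t: "t \<in> {0..<1}" "\<phi> t \<le> K"
  shows "far_left (\<phi> 0)"
proof -
  have "far_left K" using K pos by (simp add: left_level_def)
  then have "B * weight (\<phi> t) \<le> \<kappa>"
    using mult_left_mono[OF weight_mono[OF t(2)], of B] pos by (simp add: far_left_def)
  then have "\<phi> 0 \<le> K + 2 * \<kappa>"
    using curve_osc[OF \<phi> t(1), of 0] t(2) by simp
  then show ?thesis using K by (simp add: left_level_def)
qed

text \<open>Optional stopping in quantitative form. Left of \<open>R\<close> the barrier is at least
  1 and the bound is trivial. The geometric term accounts for curves lingering between
  \<open>R\<close> and \<open>K\<close>: there the barrier falls by at least \<delta> per step,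
  which pays for replacing \<open>(1 - \<delta>) ^ n\<close> by
  \<open>(1 - \<delta>) ^ Suc n\<close>.\<close>

lemma stays_below_decay:
  assumes K: "left_level K" and \<eta>: "0 < \<eta>" "\<eta> \<le> s0"
  shows "\<exists>\<rho>. 0 \<le> \<rho> \<and> \<rho> < 1 \<and> (\<forall>n. \<forall>\<phi>\<in>Adm. (\<integral>y. stays_below K {..n} \<phi> y \<partial>unit_interval)
      \<le> (\<integral>y. barrier \<eta> (\<phi> y) \<partial>unit_interval) + \<rho> ^ n)"
proof -
  obtain R where R: "\<And>u. u \<le> R \<Longrightarrow> 1 \<le> barrier \<eta> u" using barrier_ge_1[OF \<eta>(1)] by blast
  define \<delta> where "\<delta> = min 1 (\<eta> * (\<theta> * exp (s0 * (R - 2 * \<kappa>))))"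
  have \<delta>: "0 < \<delta>" "\<delta> \<le> 1" using \<eta> \<theta>_pos by (auto simp: \<delta>_def)
  have ib: "integrable unit_interval (\<lambda>y. barrier \<eta> (\<phi> y))" if "\<phi> \<in> Adm" for \<phi>
    by (rule integrable_curve[OF that barrier_cont])
  have nonneg: "0 \<le> (\<integral>y. barrier \<eta> (\<phi> y) \<partial>unit_interval)" if "\<phi> \<in> Adm" for \<phi>
    by (intro integral_unit_ge ib that barrier_nonneg \<eta>)
  have "(\<integral>y. stays_below K {..n} \<phi> y \<partial>unit_interval)
      \<le> (\<integral>y. barrier \<eta> (\<phi> y) \<partial>unit_interval) + (1 - \<delta>) ^ n" if "\<phi> \<in> Adm" for n \<phi>
    using that
  proof (induction n arbitrary: \<phi>)
    case 0
    have "(\<integral>y. stays_below K {..0} \<phi> y \<partial>unit_interval) \<le> 1"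
      by (intro integral_unit_le integrable_stays_below 0) (simp add: stays_below_def)
    then show ?case using nonneg[OF 0] by simp
  next
    case (Suc n)
    have p: "0 \<le> (1 - \<delta>) ^ n" "0 \<le> (1 - \<delta>) ^ Suc n" "(1 - \<delta>) ^ n \<le> 1"
      using \<delta> by (auto simp: power_le_one)
    consider "\<forall>t\<in>{0..<1}. K \<le> \<phi> t" | "\<exists>t\<in>{0..<1}. \<phi> t < K" "\<phi> 0 + 2 * \<kappa> \<le> R"
      | "\<exists>t\<in>{0..<1}. \<phi> t < K" "R < \<phi> 0 + 2 * \<kappa>" by force
    then show ?case
    proof cases
      case 1
      have "(\<integral>y. stays_below K {..Suc n} \<phi> y \<partial>unit_interval) = (\<integral>y. 0 \<partial>unit_interval)"
        by (rule Bochner_Integration.integral_cong)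
          (use 1 in \<open>auto simp: stays_below_def not_less intro!: bexI[of _ 0]\<close>)
      then show ?thesis using nonneg[OF Suc.prems] p by simp
    next
      case 2
      then have c: "far_left (\<phi> 0)"
        using left_level_far_left[OF K Suc.prems] by fastforce
      have "1 \<le> (\<integral>y. barrier \<eta> (\<phi> y) \<partial>unit_interval)"
      proof (rule integral_unit_ge[OF ib[OF Suc.prems] R])
        fix t :: real assume "t \<in> {0..<1}"
        then show "\<phi> t \<le> R" using far_left_curve(1)[OF Suc.prems c, of t] 2(2) by linarith
      qed
      moreover have "(\<integral>y. stays_below K {..Suc n} \<phi> y \<partial>unit_interval) \<le> 1"
        by (intro integral_unit_le integrable_stays_below Suc.prems) (simp add: stays_below_def)
      ultimately show ?thesis using p by linarith
    next
      case 3
      then have c: "far_left (\<phi> 0)"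
        using left_level_far_left[OF K Suc.prems] by fastforce
      \<comment> \<open>The condition at time 0 is dropped, since such a curve may lie partly above
        \<open>K\<close>.\<close>
      have "(\<integral>y. stays_below K {..Suc n} \<phi> y \<partial>unit_interval)
          \<le> (\<integral>y. stays_below K (Suc ` {..n}) \<phi> y \<partial>unit_interval)"
        by (intro integral_unit_mono integrable_stays_below Suc.prems)
          (auto simp: stays_below_def simp del: walk.simps)
      also have "\<dots> = average m (\<lambda>a. \<integral>t. stays_below K {..n} (T a \<phi>) t \<partial>unit_interval)"
        by (rule integral_stays_below_Suc[OF Suc.prems])
      also have "\<dots> \<le> average m (\<lambda>a. (\<integral>y. barrier \<eta> (T a \<phi> y) \<partial>unit_interval) + (1 - \<delta>) ^ n)"
        by (intro average_mono Suc.IH T_Adm Suc.prems)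
      also have "\<dots> = (\<integral>y. barrier \<eta> (next_curve \<phi> y) \<partial>unit_interval) + (1 - \<delta>) ^ n"
        by (simp add: average_add average_T[OF Suc.prems barrier_cont])
      also have "\<dots> \<le> (\<integral>y. barrier \<eta> (\<phi> y) \<partial>unit_interval) - \<delta> + (1 - \<delta>) ^ n"
      proof -
        have "\<eta> * (\<theta> * exp (s0 * (R - 2 * \<kappa>))) \<le> \<eta> * (\<theta> * exp (s0 * \<phi> 0))"
          using 3(2) \<eta> \<theta>_pos s0_pos by (intro mult_left_mono) auto
        then have "\<delta> \<le> \<eta> * (\<theta> * exp (s0 * \<phi> 0))" by (simp add: \<delta>_def)
        then show ?thesis using barrier_drift[OF Suc.prems c \<eta>] by linarith
      qed
      also have "\<dots> \<le> (\<integral>y. barrier \<eta> (\<phi> y) \<partial>unit_interval) + (1 - \<delta>) ^ Suc n"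
        using mult_left_mono[OF p(3), of \<delta>] \<delta> by (simp add: algebra_simps)
      finally show ?thesis .
    qed
  qed
  then show ?thesis using \<delta> by (intro exI[of _ "1 - \<delta>"]) auto
qed

text \<open>First the number of steps tends to infinity for fixed \<eta>, which removes
  \<open>\<rho> ^ n\<close> although \<rho> depends on \<eta>. Only then \<eta> tends to 0, and the
  barrier vanishes uniformly on the bounded range of the initial curve.\<close>

lemma stays_below_forever_null:
  assumes K: "left_level K" and \<phi>: "\<phi> \<in> Adm"
  shows "(\<integral>y. stays_below K UNIV \<phi> y \<partial>unit_interval) = 0"
proof -
  let ?q = "\<integral>y. stays_below K UNIV \<phi> y \<partial>unit_interval"
  obtain b where b: "0 < b" "\<And>t. t \<in> {0..<1} \<Longrightarrow> \<bar>\<phi> t\<bar> \<le> b" using curve_range[OF \<phi>] by blast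
  have le: "?q \<le> \<eta> * (b + 1)" if \<eta>: "0 < \<eta>" "\<eta> \<le> s0" for \<eta>
  proof -
    obtain \<rho> where l: "0 \<le> \<rho>" "\<rho> < 1" and
      bd: "\<And>n. (\<integral>y. stays_below K {..n} \<phi> y \<partial>unit_interval)
        \<le> (\<integral>y. barrier \<eta> (\<phi> y) \<partial>unit_interval) + \<rho> ^ n"
      using stays_below_decay[OF K \<eta>] \<phi> by blast
    have B: "(\<integral>y. barrier \<eta> (\<phi> y) \<partial>unit_interval) \<le> \<eta> * (b + 1)"
    proof (rule integral_unit_le[OF integrable_curve[OF \<phi> barrier_cont] barrier_le[OF \<eta>(1)]])
      show "- b \<le> \<phi> t" if "t \<in> {0..<1}" for t using b(2)[OF that] by linarith
    qed (use b in auto)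
    have "?q \<le> \<eta> * (b + 1) + \<rho> ^ n" for n
    proof -
      have "?q \<le> (\<integral>y. stays_below K {..n} \<phi> y \<partial>unit_interval)"
        by (intro integral_unit_mono integrable_stays_below \<phi>) (auto simp: stays_below_def)
      then show ?thesis using bd[of n] B by linarith
    qed
    moreover have "(\<lambda>n. \<eta> * (b + 1) + \<rho> ^ n) \<longlonglongrightarrow> \<eta> * (b + 1) + 0"
      by (intro tendsto_intros LIMSEQ_power_zero) (use l in auto)
    ultimately show ?thesis by (intro LIMSEQ_le_const[of _ "\<eta> * (b + 1)"]) auto
  qed
  have "?q \<le> 0"
  proof (rule field_le_epsilon)
    fix e :: real assume e: "0 < e"
    define \<eta> where "\<eta> = min s0 (e / (b + 1))"
    have \<eta>: "0 < \<eta>" "\<eta> \<le> s0" using e b s0_pos by (auto simp: \<eta>_def)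
    have "\<eta> * (b + 1) \<le> (e / (b + 1)) * (b + 1)"
      using b by (intro mult_right_mono) (auto simp: \<eta>_def)
    then show "?q \<le> 0 + e" using le[OF \<eta>] b by simp
  qed
  moreover have "0 \<le> ?q"
    by (intro integral_unit_ge integrable_stays_below \<phi>) (simp add: stays_below_def)
  ultimately show ?thesis by simp
qed

lemma stays_below_eventually_null:
  assumes K: "left_level K"
  shows "\<phi> \<in> Adm \<Longrightarrow> (\<integral>y. stays_below K {n..} \<phi> y \<partial>unit_interval) = 0"
proof (induction n arbitrary: \<phi>)
  case 0
  have "{0::nat..} = UNIV" by auto
  then show ?case using stays_below_forever_null[OF K 0] by simp
next
  case (Suc n)
  have "{Suc n..} = Suc ` {n..}" using Suc_le_D by (fastforce simp: image_iff)
  then have "(\<integral>y. stays_below K {Suc n..} \<phi> y \<partial>unit_interval)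
      = average m (\<lambda>a. \<integral>t. stays_below K {n..} (T a \<phi>) t \<partial>unit_interval)"
    using integral_stays_below_Suc[OF Suc.prems, of K "{n..}"] by simp
  also have "\<dots> = average m (\<lambda>_. 0)" by (intro average_cong Suc.IH T_Adm Suc.prems)
  finally show ?case by simp
qed

theorem infinitely_many_visits:
  assumes K: "left_level K" and \<phi>: "\<phi> \<in> Adm"
  shows "AE y in unit_interval. infinite {i. K \<le> walk i (\<phi> y) y}"
proof -
  have "AE y in unit_interval. stays_below K {n..} \<phi> y = 0" for n
    by (rule iffD1[OF integral_nonneg_eq_0_iff_AE[OF integrable_stays_below[OF \<phi>] AE_I2]
          stays_below_eventually_null[OF K \<phi>]]) (simp add: stays_below_def)
  then have "AE y in unit_interval. \<forall>n. stays_below K {n..} \<phi> y = 0" by (simp add: AE_all_countable)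
  then show ?thesis
  proof eventually_elim
    case (elim y)
    have "\<exists>i\<ge>n. K \<le> walk i (\<phi> y) y" for n
      using spec[OF elim, of n] by (auto simp: stays_below_def not_less split: if_splits)
    then show ?case by (simp add: infinite_nat_iff_unbounded_le)
  qed
qed

end

section \<open>Zero frequency\<close>

lemma sandwich_0:
  fixes f :: "nat \<Rightarrow> real"
  assumes "\<And>n. 0 \<le> f n" "\<And>e. 0 < e \<Longrightarrow> \<exists>g. g \<longlonglongrightarrow> 0 \<and> (\<forall>n. f n \<le> e + g n)"
  shows "f \<longlonglongrightarrow> 0"
proof (rule order_tendstoI)
  show "\<forall>\<^sub>F n in sequentially. a < f n" if "a < 0" for a
    using that assms(1) by (intro always_eventually allI) (rule less_le_trans)
  show "\<forall>\<^sub>F n in sequentially. f n < a" if a: "0 < a" for a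
  proof -
    obtain g where g: "g \<longlonglongrightarrow> 0" "\<And>n. f n \<le> a / 2 + g n" using assms(2)[of "a / 2"] a by auto
    have "\<forall>\<^sub>F n in sequentially. g n < a / 2" using order_tendstoD(2)[OF g(1), of "a / 2"] a by simp
    then show ?thesis
    proof eventually_elim
      case (elim n)
      then show ?case using g(2)[of n] by linarith
    qed
  qed
qed

context driven_chain
begin

section \<open>Visit frequencies of sets of states, and drifts of potentials\<close>

definition visits :: "'c set \<Rightarrow> nat \<Rightarrow> 'c \<Rightarrow> real \<Rightarrow> real" where
  "visits P n \<phi> y = (\<Sum>i<n. indicator P (state i \<phi> y))"

definition rare :: "'c set \<Rightarrow> 'c \<Rightarrow> bool" where
  "rare P \<phi> \<longleftrightarrow> (AE y in unit_interval. (\<lambda>n. visits P n \<phi> y / real n) \<longlonglongrightarrow> 0)"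

lemma visits_nonneg: "0 \<le> visits P n \<phi> y"
  unfolding visits_def by (intro sum_nonneg) auto

definition drift :: "('c \<Rightarrow> real) \<Rightarrow> 'c \<Rightarrow> real" where
  "drift Q \<phi> = average m (\<lambda>a. Q (T a \<phi>)) - Q \<phi>"

text \<open>Subtracting the drift turns \<open>Q\<close> along the chain into a sum with conditional
  mean 0. For \<open>Q\<close> bounded below, upper bounds on the drift thereby become bounds on
  visit frequencies.\<close>

lemma drift_law_of_large_numbers:
  assumes Q: "\<And>\<phi> a. \<phi> \<in> Adm \<Longrightarrow> a < m \<Longrightarrow> \<bar>Q (T a \<phi>) - Q \<phi>\<bar> \<le> B"
    and \<phi>: "\<phi> \<in> Adm"
  shows "AE y in unit_interval.
    (\<lambda>n. (Q (state n \<phi> y) - (\<Sum>i<n. drift Q (state i \<phi> y))) / real n) \<longlonglongrightarrow> 0"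
proof -
  define Y where "Y \<phi> a = (Q (T a \<phi>) - Q \<phi>) - drift Q \<phi>" for \<phi> a
  have dr: "drift Q \<phi> = average m (\<lambda>a. Q (T a \<phi>) - Q \<phi>)" for \<phi>
    by (simp add: drift_def average_diff)
  have dB: "\<bar>drift Q \<phi>\<bar> \<le> B" if "\<phi> \<in> Adm" for \<phi>
    unfolding dr by (intro average_abs_le Q that)
  have YB: "\<bar>Y \<phi> a\<bar> \<le> 2 * B" if "\<phi> \<in> Adm" "a < m" for \<phi> a
    using Q[OF that] dB[OF that(1)] unfolding Y_def by linarith
  have Y0: "average m (Y \<phi>) = 0" for \<phi>
  proof -
    have "average m (Y \<phi>) = average m (\<lambda>a. Q (T a \<phi>) - Q \<phi>) - average m (\<lambda>_. drift Q \<phi>)"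
      unfolding Y_def[abs_def] by (rule average_diff)
    then show ?thesis by (simp add: dr)
  qed
  have tel: "path_sum Y n \<phi> y = Q (state n \<phi> y) - Q \<phi> - (\<Sum>i<n. drift Q (state i \<phi> y))" for n y
  proof -
    have "path_sum Y n \<phi> y = (\<Sum>i<n. Q (state (Suc i) \<phi> y) - Q (state i \<phi> y))
        - (\<Sum>i<n. drift Q (state i \<phi> y))"
      unfolding path_sum_def Y_def state_Suc by (rule sum_subtractf)
    also have "(\<Sum>i<n. Q (state (Suc i) \<phi> y) - Q (state i \<phi> y)) = Q (state n \<phi> y) - Q (state 0 \<phi> y)"
      by (rule sum_lessThan_telescope)
    finally show ?thesis by simp
  qed
  have "AE y in unit_interval. (\<lambda>n. path_sum Y n \<phi> y / real n) \<longlonglongrightarrow> 0"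
    by (rule path_sum_law_of_large_numbers[OF YB Y0 \<phi>])
  then show ?thesis
  proof eventually_elim
    case (elim y)
    have "(\<lambda>n. path_sum Y n \<phi> y / real n + Q \<phi> / real n) \<longlonglongrightarrow> 0 + 0"
      by (intro tendsto_add elim tendsto_divide_0[OF tendsto_const]
          filterlim_real_at_infinity_sequentially)
    then show ?case by (simp add: tel flip: add_divide_distrib)
  qed
qed

lemma rare_subset: "rare P \<phi> \<Longrightarrow> P' \<subseteq> P \<Longrightarrow> rare P' \<phi>"
  unfolding rare_def
proof (elim AE_mp, intro AE_I2 impI)
  fix y assume "P' \<subseteq> P" and lim: "(\<lambda>n. visits P n \<phi> y / real n) \<longlonglongrightarrow> 0"
  then have "visits P' n \<phi> y \<le> visits P n \<phi> y" for n
    unfolding visits_def by (intro sum_mono) (auto simp: indicator_def)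
  then show "(\<lambda>n. visits P' n \<phi> y / real n) \<longlonglongrightarrow> 0"
    by (intro Lim_null_comparison[OF _ lim] always_eventually allI)
      (simp add: visits_nonneg abs_of_nonneg divide_right_mono)
qed

lemma rare_Un:
  assumes "rare P \<phi>" "rare P' \<phi>" shows "rare (P \<union> P') \<phi>"
  using assms unfolding rare_def
proof eventually_elim
  case (elim y)
  have "visits (P \<union> P') n \<phi> y \<le> visits P n \<phi> y + visits P' n \<phi> y" for n
    unfolding visits_def sum.distrib[symmetric] by (intro sum_mono) (auto simp: indicator_def)
  then show ?case
    by (intro Lim_null_comparison[OF _ tendsto_add[OF elim, simplified]] always_eventually allI)
      (simp add: visits_nonneg abs_of_nonneg divide_right_mono flip: add_divide_distrib)
qed

text \<open>If one prescribed digit, which comes up with frequency \<open>1/m\<close> independently of the past,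
  sends \<open>P\<close> into \<open>P'\<close>, then \<open>P'\<close> is visited at least \<open>1/m\<close> times as often as \<open>P\<close>.\<close>

lemma rare_pullback:
  assumes b: "b < m" and P: "\<And>\<psi>. \<psi> \<in> Adm \<Longrightarrow> \<psi> \<in> P \<Longrightarrow> T b \<psi> \<in> P'" and \<phi>: "\<phi> \<in> Adm"
    and rare: "rare P' \<phi>"
  shows "rare P \<phi>"
proof -
  define Y where "Y \<psi> a = indicator P \<psi> * ((if a = b then 1 else 0) - 1 / real m)" for \<psi> a
  have m1: "1 / real m \<le> 1" using m_ge_2 by simp
  have YB: "\<bar>Y \<psi> a\<bar> \<le> 1" for \<psi> a
    using m1 by (auto simp: Y_def indicator_def)
  have Y0: "average m (Y \<psi>) = 0" for \<psi>
    using b by (simp add: Y_def[abs_def] average_def sum_subtractf flip: sum_distrib_left)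
  have "AE y in unit_interval. (\<lambda>n. path_sum Y n \<phi> y / real n) \<longlonglongrightarrow> 0"
    by (rule path_sum_law_of_large_numbers[OF YB Y0 \<phi>])
  then show ?thesis
    using rare AE_space[of unit_interval] unfolding rare_def
  proof eventually_elim
    case (elim y)
    then have y: "y \<in> {0..<1}" by simp
    have ineq: "visits P n \<phi> y / real n
      \<le> real m * (visits P' n \<phi> y / real n + 1 / real n - path_sum Y n \<phi> y / real n)" for n
    proof -
      have "visits P n \<phi> y / real m + path_sum Y n \<phi> y
          = (\<Sum>i<n. indicator P (state i \<phi> y) * (if digit m ((E ^^ i) y) = b then 1 else 0))"
        unfolding visits_def path_sum_def Y_def sum_divide_distrib sum.distrib[symmetric]
        by (intro sum.cong) (auto simp: algebra_simps)
      also have "\<dots> \<le> (\<Sum>i<n. indicator P' (state (Suc i) \<phi> y))"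
      proof (rule sum_mono)
        fix i
        have "state (Suc i) \<phi> y \<in> P'" if "state i \<phi> y \<in> P" "digit m ((E ^^ i) y) = b"
          unfolding state_Suc that(2) by (intro P state_Adm y \<phi> that)
        then show "indicator P (state i \<phi> y) * (if digit m ((E ^^ i) y) = b then 1 else 0)
            \<le> (indicator P' (state (Suc i) \<phi> y) :: real)"
          by (auto simp: indicator_def simp del: state.simps)
      qed
      also have "\<dots> \<le> visits P' (Suc n) \<phi> y"
        unfolding visits_def sum.lessThan_Suc_shift by simp
      also have "\<dots> \<le> visits P' n \<phi> y + 1"
        by (simp add: visits_def indicator_def del: state.simps)
      finally have "visits P n \<phi> y / real m \<le> visits P' n \<phi> y + 1 - path_sum Y n \<phi> y" by simp
      then have "visits P n \<phi> y \<le> real m * (visits P' n \<phi> y + 1 - path_sum Y n \<phi> y)"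
        by (simp add: divide_le_eq mult.commute)
      then have "visits P n \<phi> y / real n \<le> real m * (visits P' n \<phi> y + 1 - path_sum Y n \<phi> y) / real n"
        by (rule divide_right_mono) simp
      then show ?thesis
        by (simp only: times_divide_eq_right[symmetric] add_divide_distrib diff_divide_distrib)
    qed
    have "(\<lambda>n. 1 / real n) \<longlonglongrightarrow> 0" by (rule lim_1_over_n)
    then have "(\<lambda>n. real m * (visits P' n \<phi> y / real n + 1 / real n - path_sum Y n \<phi> y / real n))
        \<longlonglongrightarrow> real m * (0 + 0 - 0)"
      using elim by (intro tendsto_intros) auto
    then have lim: "(\<lambda>n. real m * (visits P' n \<phi> y / real n + 1 / real n - path_sum Y n \<phi> y / real n))
        \<longlonglongrightarrow> 0" by simp
    show ?case
      by (rule Lim_null_comparison[OF _ lim])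
        (use ineq in \<open>simp add: visits_nonneg\<close>)
  qed
qed

end

context driven_walk
begin

definition strip :: "real \<Rightarrow> real \<Rightarrow> (real \<Rightarrow> real) set" where
  "strip a b = {\<phi>. \<forall>t\<in>{0..<1}. a \<le> \<phi> t \<and> \<phi> t \<le> b}"

text \<open>Its first term is a bounded substitute for the driftless coordinate \<open>u\<close>,
  shifted by \<open>1 / \<eta>\<close>: the value of \<open>u\<close> itself after \<open>n\<close>
  steps could be negative of order \<open>n\<close>, and the frequency bound would be lost. The
  subtracted exponential has positive drift and supplies the strict decrease.\<close>

definition ramp :: "real \<Rightarrow> real \<Rightarrow> real" where
  "ramp \<eta> u = exp (\<eta> * min u 0) / \<eta> - exp (s0 * min u 0)"

lemma ramp_cont: "0 < \<eta> \<Longrightarrow> continuous_on UNIV (ramp \<eta>)"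
  unfolding ramp_def[abs_def] by (intro continuous_intros) auto

text \<open>For \<open>x \<le> 0\<close> the derivative
  \<open>exp (\<eta> * x) - s0 * exp (s0 * x)\<close> is nonnegative because of
  \<open>\<eta> \<le> s0\<close> and \<open>s0 \<le> 1\<close>. This makes truncation at the value
  \<open>ramp \<eta> K\<close> meaningful for curves on either side of \<open>K\<close>.\<close>

lemma ramp_mono:
  assumes \<eta>: "0 < \<eta>" "\<eta> \<le> s0" and "u \<le> v" shows "ramp \<eta> u \<le> ramp \<eta> v"
proof -
  have "exp (\<eta> * u) / \<eta> - exp (s0 * u) \<le> exp (\<eta> * v) / \<eta> - exp (s0 * v)" if "u \<le> v" "v \<le> 0" for u v
  proof (rule DERIV_nonneg_imp_nondecreasing[OF that(1)])
    fix x assume "u \<le> x" "x \<le> v"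
    then have x: "x \<le> 0" using that by simp
    have "((\<lambda>x. exp (\<eta> * x) / \<eta> - exp (s0 * x)) has_real_derivative (exp (\<eta> * x) - s0 * exp (s0 * x))) (at x)"
      using \<eta> by (auto intro!: derivative_eq_intros)
    moreover have "s0 * exp (s0 * x) \<le> 1 * exp (\<eta> * x)"
      using s0_half x \<eta> by (intro mult_mono) (auto intro: mult_right_mono_neg)
    ultimately show "\<exists>d. ((\<lambda>x. exp (\<eta> * x) / \<eta> - exp (s0 * x)) has_real_derivative d) (at x) \<and> 0 \<le> d"
      by (intro exI[of _ "exp (\<eta> * x) - s0 * exp (s0 * x)"]) auto
  qed
  from this[of "min u 0" "min v 0"] show ?thesis using \<open>u \<le> v\<close> unfolding ramp_def by auto
qed

lemma ramp_bounds: "0 < \<eta> \<Longrightarrow> - 1 \<le> ramp \<eta> u \<and> ramp \<eta> u \<le> 1 / \<eta>"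
proof -
  assume \<eta>: "0 < \<eta>"
  have "exp (\<eta> * min u 0) \<le> 1" "exp (s0 * min u 0) \<le> 1"
    using \<eta> s0_pos by (simp_all add: mult_nonneg_nonpos)
  then have "exp (\<eta> * min u 0) / \<eta> \<le> 1 / \<eta>" "0 \<le> exp (\<eta> * min u 0) / \<eta>"
    using \<eta> by (simp_all add: divide_right_mono)
  then show ?thesis
    unfolding ramp_def using \<open>exp (s0 * min u 0) \<le> 1\<close> exp_ge_zero[of "s0 * min u 0"] by linarith
qed

lemma ramp_drift:
  assumes \<phi>: "\<phi> \<in> Adm" and c: "far_left (\<phi> 0)" and \<eta>: "0 < \<eta>" "\<eta> \<le> s0"
  shows "(\<integral>y. ramp \<eta> (next_curve \<phi> y) \<partial>unit_interval)
     \<le> (\<integral>y. ramp \<eta> (\<phi> y) \<partial>unit_interval) + \<eta> * N\<^sup>2 - \<theta> * exp (s0 * \<phi> 0)"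
proof -
  let ?c = "\<phi> 0" let ?d = "defect (\<phi> 0)"
  note L = far_left_curve(2,3)[OF \<phi> c]
  note D = far_left_defect[OF c]
  let ?I = "\<lambda>s g. \<integral>y. exp (s * g y) \<partial>unit_interval"
  have i: "integrable unit_interval (\<lambda>y. exp (s * next_curve \<phi> y))"
     "integrable unit_interval (\<lambda>y. exp (s * \<phi> y))" for s
    by (intro integrable_next integrable_curve \<phi> continuous_intros)+
  have e: "(\<integral>y. ramp \<eta> (g y) \<partial>unit_interval) = ?I \<eta> g / \<eta> - ?I s0 g"
    if "\<And>t. t \<in> {0..<1} \<Longrightarrow> g t \<le> 0"
      "\<And>s. integrable unit_interval (\<lambda>y. exp (s * g y))" for g
  proof -
    have "(\<integral>y. ramp \<eta> (g y) \<partial>unit_interval)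
        = (\<integral>y. exp (\<eta> * g y) / \<eta> - exp (s0 * g y) \<partial>unit_interval)"
      unfolding ramp_def using that(1)
      by (rule integral_clamp[of g "\<lambda>u. exp (\<eta> * u) / \<eta> - exp (s0 * u)"])
    then show ?thesis using that(2) by simp
  qed
  have 1: "?I \<eta> (next_curve \<phi>) / \<eta> - ?I \<eta> \<phi> / \<eta> \<le> ?d + \<eta> * N\<^sup>2"
  proof -
    have "exp (\<eta> * ?c) * (\<eta> * ?d + \<eta>\<^sup>2 * N\<^sup>2) \<le> 1 * (\<eta> * ?d + \<eta>\<^sup>2 * N\<^sup>2)"
      using D \<eta> by (intro mult_right_mono) (auto simp: mult_nonneg_nonpos)
    then have "?I \<eta> (next_curve \<phi>) - ?I \<eta> \<phi> \<le> \<eta> * (?d + \<eta> * N\<^sup>2)"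
      using exp_drift_upper[OF \<phi> c \<eta>] by (simp add: distrib_left power2_eq_square mult.assoc)
    then show ?thesis using \<eta> by (simp add: divide_le_eq mult.commute flip: diff_divide_distrib)
  qed
  have 2: "2 * \<theta> * exp (s0 * ?c) - s0 * ?d \<le> ?I s0 (next_curve \<phi>) - ?I s0 \<phi>"
  proof -
    have "exp (s0 * ?c) * (s0 * ?d) \<le> 1 * (s0 * ?d)"
      using D s0_pos by (intro mult_right_mono) (auto simp: mult_nonneg_nonpos)
    then show ?thesis
      using exp_drift_lower[OF \<phi> c s0_pos order_refl] unfolding two_\<theta>
      by (simp add: right_diff_distrib mult.commute)
  qed
  show ?thesis
    using 1 2 D(1) e[OF L(2) i(1)] e[OF L(1) i(2)] by (simp add: algebra_simps)
qed

text \<open>Where the truncation is inactive it can only lower the drift, an average of minima being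
  at most the minimum of the averages; where it is active the drift is at most 0, so nothing has to
  be known right of \<open>K\<close>. On the strip it is inactive. The frequency is thus at most
  \<open>\<eta> * N\<^sup>2 / w\<close> in the limit, with \<open>w\<close> independent of
  \<eta>.\<close>

lemma rare_left_strip:
  assumes K: "left_level K" and \<phi>: "\<phi> \<in> Adm"
  shows "rare (strip a K) \<phi>"
proof -
  let ?P = "strip a K"
  define Q where "Q \<eta> \<psi> = min (\<integral>t. ramp \<eta> (\<psi> t) \<partial>unit_interval) (ramp \<eta> K)" for \<eta> \<psi>
  define w where "w = \<theta> * exp (s0 * a)"
  have w: "w > 0" using \<theta>_pos by (simp add: w_def)
  have ir: "integrable unit_interval (\<lambda>t. ramp \<eta> (\<psi> t))" if "0 < \<eta>" "\<psi> \<in> Adm" for \<eta> \<psi>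
    by (rule integrable_curve[OF that(2) ramp_cont[OF that(1)]])
  have Qb: "\<bar>Q \<eta> \<psi>\<bar> \<le> 1 / \<eta> + 1" if \<eta>: "0 < \<eta>" and \<psi>: "\<psi> \<in> Adm" for \<eta> \<psi>
  proof -
    have "(\<integral>t. ramp \<eta> (\<psi> t) \<partial>unit_interval) \<le> 1 / \<eta>" "- 1 \<le> (\<integral>t. ramp \<eta> (\<psi> t) \<partial>unit_interval)"
      using ramp_bounds[OF \<eta>] by (intro integral_unit_le integral_unit_ge ir \<eta> \<psi>; blast)+
    moreover have "0 \<le> 1 / \<eta>" using \<eta> by simp
    ultimately show ?thesis using ramp_bounds[OF \<eta>, of K] unfolding Q_def by linarith
  qed
  have dr: "drift (Q \<eta>) \<psi> \<le> \<eta> * N\<^sup>2 - w * indicator ?P \<psi>" if \<eta>: "0 < \<eta>" "\<eta> \<le> s0" and \<psi>: "\<psi> \<in> Adm" for \<eta> \<psi>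
  proof -
    let ?X = "\<integral>t. ramp \<eta> (\<psi> t) \<partial>unit_interval"
    have av1: "average m (\<lambda>a. Q \<eta> (T a \<psi>)) \<le> (\<integral>y. ramp \<eta> (next_curve \<psi> y) \<partial>unit_interval)"
      unfolding average_T[OF \<psi> ramp_cont[OF \<eta>(1)], symmetric] by (intro average_mono) (simp add: Q_def)
    have "average m (\<lambda>a. Q \<eta> (T a \<psi>)) \<le> average m (\<lambda>_. ramp \<eta> K)"
      by (intro average_mono) (simp add: Q_def)
    then have av2: "average m (\<lambda>a. Q \<eta> (T a \<psi>)) \<le> ramp \<eta> K" by simp
    have pos_rhs: "0 \<le> \<eta> * N\<^sup>2" using \<eta> by simp
    show ?thesis
    proof (cases "\<exists>t\<in>{0..<1}. \<psi> t \<le> K")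
      case False
      then have "K \<le> \<psi> t" if "t \<in> {0..<1}" for t using that by force
      then have "ramp \<eta> K \<le> ?X" by (intro integral_unit_ge ir \<eta> \<psi> ramp_mono)
      moreover have "\<psi> \<notin> ?P" using False by (auto simp: strip_def intro!: bexI[of _ 0])
      ultimately show ?thesis using av2 pos_rhs by (simp add: drift_def Q_def)
    next
      case True
      then have c: "far_left (\<psi> 0)" using left_level_far_left[OF K \<psi>] by blast
      note rd = ramp_drift[OF \<psi> c \<eta>]
      show ?thesis
      proof (cases "\<psi> \<in> ?P")
        case True
        then have "a \<le> \<psi> 0" "?X \<le> ramp \<eta> K"
          by (auto simp: strip_def intro!: integral_unit_le ir \<eta> \<psi> ramp_mono)
        moreover have "w \<le> \<theta> * exp (s0 * \<psi> 0)"
          unfolding w_def using \<open>a \<le> \<psi> 0\<close> \<theta>_pos s0_pos by (intro mult_left_mono) auto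
        ultimately show ?thesis using av1 rd True by (simp add: drift_def Q_def)
      next
        case False
        moreover have "0 \<le> \<theta> * exp (s0 * \<psi> 0)" using \<theta>_pos by simp
        ultimately show ?thesis using av1 av2 rd pos_rhs by (auto simp: drift_def Q_def min_def)
      qed
    qed
  qed
  \<comment> \<open>Countably many values of \<eta> tending to 0, so that one null set serves all of
    them.\<close>
  have "AE y in unit_interval. (\<lambda>n. (Q (s0 / Suc j) (state n \<phi> y)
      - (\<Sum>i<n. drift (Q (s0 / Suc j)) (state i \<phi> y))) / real n) \<longlonglongrightarrow> 0" for j
  proof (rule drift_law_of_large_numbers[OF _ \<phi>])
    let ?\<eta> = "s0 / Suc j"
    have \<eta>: "0 < ?\<eta>" using s0_pos by simp
    show "\<bar>Q ?\<eta> (T a \<psi>) - Q ?\<eta> \<psi>\<bar> \<le> 2 * (1 / ?\<eta> + 1)" if "\<psi> \<in> Adm" "a < m" for \<psi> a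
    proof -
      have "\<bar>u - v\<bar> \<le> 2 * c" if "\<bar>u\<bar> \<le> c" "\<bar>v\<bar> \<le> c" for u v c :: real using that by linarith
      then show ?thesis using Qb[OF \<eta> that(1)] Qb[OF \<eta> T_Adm[OF that(2,1)]] by blast
    qed
  qed
  then have "AE y in unit_interval. \<forall>j. (\<lambda>n. (Q (s0 / Suc j) (state n \<phi> y)
      - (\<Sum>i<n. drift (Q (s0 / Suc j)) (state i \<phi> y))) / real n) \<longlonglongrightarrow> 0"
    by (simp add: AE_all_countable)
  then show ?thesis
    using AE_space[of unit_interval] unfolding rare_def
  proof eventually_elim
    case (elim y)
    then have y: "y \<in> {0..<1}" by simp
    show ?case
    proof (rule sandwich_0)
      show "0 \<le> visits ?P n \<phi> y / real n" for n by (simp add: visits_nonneg)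
      fix e :: real assume e: "0 < e"
      obtain j where j: "s0 * N\<^sup>2 / (w * e) < real (Suc j)" using reals_Archimedean2
        by (metis less_trans of_nat_less_iff lessI)
      define \<eta> where "\<eta> = s0 / Suc j"
      have \<eta>: "0 < \<eta>" "\<eta> \<le> s0" using s0_pos by (auto simp: \<eta>_def field_simps)
      have "s0 * N\<^sup>2 < real (Suc j) * (w * e)"
        using j w e by (simp add: pos_divide_less_eq del: of_nat_Suc)
      then have "\<eta> * N\<^sup>2 \<le> w * e"
        by (simp add: \<eta>_def divide_le_eq mult.commute del: of_nat_Suc)
      then have small: "\<eta> * N\<^sup>2 / w \<le> e" using w by (simp add: divide_le_eq mult.commute)
      define g where "g n = (2 * (1 / \<eta> + 1) / w) / real n + ((Q \<eta> (state n \<phi> y)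
        - (\<Sum>i<n. drift (Q \<eta>) (state i \<phi> y))) / real n) / w" for n
      have "(\<lambda>n. (Q \<eta> (state n \<phi> y) - (\<Sum>i<n. drift (Q \<eta>) (state i \<phi> y))) / real n) \<longlonglongrightarrow> 0"
        using elim(1) unfolding \<eta>_def by blast
      then have "g \<longlonglongrightarrow> 0 + 0 / w" unfolding g_def
        by (intro tendsto_add tendsto_divide tendsto_divide_0[OF tendsto_const]
          filterlim_real_at_infinity_sequentially) (use w in auto)
      moreover have "visits ?P n \<phi> y / real n \<le> e + g n" for n
      proof (cases "n = 0")
        case True
        then show ?thesis using e by (simp add: g_def)
      next
        case False
        have "(\<Sum>i<n. drift (Q \<eta>) (state i \<phi> y)) \<le> (\<Sum>i<n. \<eta> * N\<^sup>2 - w * indicator ?P (state i \<phi> y))"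
          by (intro sum_mono dr \<eta> state_Adm y \<phi>)
        also have "\<dots> = real n * (\<eta> * N\<^sup>2) - w * visits ?P n \<phi> y"
          by (simp add: sum_subtractf visits_def flip: sum_distrib_left)
        finally have "w * visits ?P n \<phi> y
            \<le> real n * (\<eta> * N\<^sup>2) + (2 * (1 / \<eta> + 1)
              + (Q \<eta> (state n \<phi> y) - (\<Sum>i<n. drift (Q \<eta>) (state i \<phi> y))))"
          using Qb[OF \<eta>(1) state_Adm[OF y \<phi>], of n] \<eta> by (simp add: abs_le_iff)
        moreover have "V / real n \<le> x / w + ((a / w) / real n + (b / real n) / w)"
          if "w * V \<le> real n * x + (a + b)" for V x a b
          using that w False by (simp add: field_simps)
        ultimately have "visits ?P n \<phi> y / real n \<le> \<eta> * N\<^sup>2 / w + g n"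
          unfolding g_def by blast
        then show ?thesis using small by linarith
      qed
      ultimately show "\<exists>g. g \<longlonglongrightarrow> 0 \<and> (\<forall>n. visits ?P n \<phi> y / real n \<le> e + g n)"
        by (intro exI[of _ g]) auto
    qed
  qed
qed

text \<open>Reading \<open>astar\<close> lowers a whole curve by at least \<open>c1\<close> and at
  most \<open>M\<close>, so each use of \<open>rare_pullback\<close> raises the upper edge by
  \<open>c1\<close>. The lower edge moves too, hence the induction over all \<open>a\<close>. This
  replaces a drift estimate at heights where curves may oscillate strongly.\<close>

lemma rare_strip:
  assumes \<phi>: "\<phi> \<in> Adm"
  shows "rare (strip a b) \<phi>"
proof -
  obtain K where K: "left_level K" using left_level_exists by blast
  have "rare (strip a (K + real n * c1)) \<phi>" for n a
  proof (induction n arbitrary: a)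
    case 0
    then show ?case using rare_left_strip[OF K \<phi>] by simp
  next
    case (Suc n)
    show ?case
    proof (rule rare_pullback[OF astar(1) _ \<phi> Suc.IH[of "a - M"]])
      fix \<psi> assume \<psi>: "\<psi> \<in> strip a (K + real (Suc n) * c1)"
      have "a - M \<le> T astar \<psi> t \<and> T astar \<psi> t \<le> K + real n * c1" if t: "t \<in> {0..<1}" for t
      proof -
        let ?y = "branch m astar t"
        have y: "?y \<in> {0..<1}" using branch_in[OF astar(1) t] .
        have "a \<le> \<psi> ?y" "\<psi> ?y \<le> K + real n * c1 + c1"
          using \<psi> y by (auto simp: strip_def algebra_simps simp del: atLeastLessThan_iff)
        then show ?thesis using astar(2)[OF t, of "\<psi> ?y"] D_bound[OF y, of "\<psi> ?y"]
          by (auto simp: T_def next_curve_def abs_le_iff)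
      qed
      then show "T astar \<psi> \<in> strip (a - M) (K + real n * c1)" by (simp add: strip_def)
    qed
  qed
  moreover obtain n where "(b - K) / c1 < real n" using reals_Archimedean2 by blast
  then have "b \<le> K + real n * c1" using pos by (simp add: field_simps)
  ultimately show ?thesis by (rule_tac rare_subset[of "strip a (K + real n * c1)"]) (auto simp: strip_def)
qed

section \<open>The half-line to the right\<close>

lemma integrable_increment:
  assumes \<phi>: "\<phi> \<in> Adm" shows "integrable unit_interval (\<lambda>y. D y (\<phi> y))"
proof -
  have "integrable unit_interval (\<lambda>y. next_curve \<phi> y - \<phi> y)"
    using integrable_next[OF \<phi>, of "\<lambda>u. u"] integrable_curve[OF \<phi>, of "\<lambda>u. u"] by auto
  then show ?thesis by (simp add: next_curve_def)
qed

text \<open>The potential is the mean height above \<open>K1\<close>. It is nonnegative, falls by at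
  least \<open>L / 2\<close> on average in the right region, stays constant on curves far below
  \<open>K1\<close>, and rises by at most \<open>M\<close> otherwise. By bounded oscillation the
  remaining curves lie in one strip, which is already known to be rare.\<close>

lemma rare_right:
  assumes \<phi>: "\<phi> \<in> Adm"
  shows "rare {\<psi>. \<forall>t\<in>{0..<1}. K1 + M \<le> \<psi> t} \<phi>"
proof -
  let ?R = "{\<psi>. \<forall>t\<in>{0..<1}. K1 + M \<le> \<psi> t}"
  define V where "V = \<kappa> + B"
  let ?J = "strip (K1 - M - V) (K1 + M + V)"
  define G where "G u = max (u - K1) 0" for u
  define Q where "Q \<psi> = (\<integral>t. G (\<psi> t) \<partial>unit_interval)" for \<psi>
  have Gc: "continuous_on UNIV G" unfolding G_def[abs_def] by (intro continuous_intros)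
  have GL: "\<bar>G u - G v\<bar> \<le> \<bar>u - v\<bar>" for u v by (auto simp: G_def)
  have Qinc: "\<bar>Q (T a \<psi>) - Q \<psi>\<bar> \<le> M + V" if \<psi>: "\<psi> \<in> Adm" and a: "a < m" for \<psi> a
  proof -
    have i: "integrable unit_interval (\<lambda>t. G (T a \<psi> t))" "integrable unit_interval (\<lambda>t. G (\<psi> t))"
      by (intro integrable_curve Gc \<psi> T_Adm a)+
    have "\<bar>G (T a \<psi> t) - G (\<psi> t)\<bar> \<le> M + V" if t: "t \<in> {0..<1}" for t
    proof -
      have y: "branch m a t \<in> {0..<1}" using branch_in[OF a t] .
      have "\<bar>T a \<psi> t - \<psi> t\<bar> \<le> M + V"
        using next_bound[OF y, of \<psi>] curve_osc'[OF \<psi> y t] by (auto simp: T_def V_def abs_le_iff)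
      then show ?thesis using GL[of "T a \<psi> t" "\<psi> t"] by linarith
    qed
    then have "(\<integral>t. G (T a \<psi> t) - G (\<psi> t) \<partial>unit_interval) \<le> M + V"
        "- (M + V) \<le> (\<integral>t. G (T a \<psi> t) - G (\<psi> t) \<partial>unit_interval)"
      by (intro integral_unit_le integral_unit_ge Bochner_Integration.integrable_diff i;
          fastforce simp: abs_le_iff)+
    then show ?thesis using i by (simp add: Q_def abs_le_iff)
  qed
  have dr: "drift Q \<psi> \<le> M * indicator ?J \<psi> - L / 2 * indicator ?R \<psi>" if \<psi>: "\<psi> \<in> Adm" for \<psi>
  proof -
    have i: "integrable unit_interval (\<lambda>y. G (next_curve \<psi> y))" "integrable unit_interval (\<lambda>y. G (\<psi> y))"
      by (intro integrable_next integrable_curve Gc \<psi>)+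
    have d: "drift Q \<psi> = (\<integral>y. G (next_curve \<psi> y) - G (\<psi> y) \<partial>unit_interval)"
      using i by (simp add: drift_def Q_def average_T[OF \<psi> Gc])
    have id: "integrable unit_interval (\<lambda>y. G (next_curve \<psi> y) - G (\<psi> y))" using i by simp
    consider "\<psi> \<in> ?R" | "\<psi> \<notin> ?R" "\<forall>t\<in>{0..<1}. \<psi> t \<le> K1 - M" | "\<psi> \<notin> ?R" "\<exists>t\<in>{0..<1}. K1 - M < \<psi> t"
      by force
    then show ?thesis
    proof cases
      case 1
      then have r: "K1 + M \<le> \<psi> t" if "t \<in> {0..<1}" for t using that by blast
      \<comment> \<open>The margin \<open>M\<close> keeps the next position above \<open>K1\<close>,
        so \<open>G\<close> is linear along the step.\<close>
      have "drift Q \<psi> \<le> (\<integral>y. D y (\<psi> y) \<partial>unit_interval)"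
        unfolding d
      proof (rule integral_unit_mono[OF id integrable_increment[OF \<psi>]])
        fix y :: real assume y: "y \<in> {0..<1}"
        show "G (next_curve \<psi> y) - G (\<psi> y) \<le> D y (\<psi> y)"
          using r[OF y] next_bound[OF y, of \<psi>] pos by (auto simp: G_def next_curve_def abs_le_iff)
      qed
      also have "\<dots> \<le> (\<integral>y. \<zeta> y + L / 2 \<partial>unit_interval)"
      proof (rule integral_unit_mono[OF integrable_increment[OF \<psi>]])
        show "integrable unit_interval (\<lambda>y. \<zeta> y + L / 2)"
          using continuous_on_bounded_interval_integrable(1)[OF \<zeta>_cont \<zeta>_bound, of "\<lambda>u. u"] by auto
        fix y :: real assume y: "y \<in> {0..<1}"
        have "K1 \<le> \<psi> y" using r[OF y] pos by simp
        from D_right[OF y this] show "D y (\<psi> y) \<le> \<zeta> y + L / 2" by linarith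
      qed
      also have "\<dots> = - (L / 2)"
        using continuous_on_bounded_interval_integrable(1)[OF \<zeta>_cont \<zeta>_bound, of "\<lambda>u. u"]
        by (simp add: \<zeta>_mean)
      finally show ?thesis using 1 pos by (auto simp: indicator_def)
    next
      case 2
      have "drift Q \<psi> = (\<integral>y. 0 \<partial>unit_interval)"
        unfolding d
      proof (rule Bochner_Integration.integral_cong[OF refl])
        fix y assume "y \<in> space unit_interval"
        then have y: "y \<in> {0..<1}" by simp
        have "\<psi> y \<le> K1 - M" using 2(2) y by blast
        then show "G (next_curve \<psi> y) - G (\<psi> y) = 0"
          using next_bound[OF y, of \<psi>] pos by (auto simp: G_def abs_le_iff)
      qed
      then show ?thesis using 2(1) pos by (auto simp: indicator_def)
    next
      case 3
      obtain t1 t2 where t: "t1 \<in> {0..<1}" "K1 - M < \<psi> t1" "t2 \<in> {0..<1}" "\<psi> t2 < K1 + M"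
        using 3 by (auto simp: not_le)
      have "\<psi> \<in> ?J"
        using curve_osc'[OF \<psi> t(1)] curve_osc'[OF \<psi> t(3)] t(2,4)
        unfolding strip_def V_def by (fastforce simp: abs_le_iff)
      moreover have "drift Q \<psi> \<le> M"
        unfolding d
      proof (rule integral_unit_le[OF id])
        fix y :: real assume y: "y \<in> {0..<1}"
        show "G (next_curve \<psi> y) - G (\<psi> y) \<le> M"
          using next_bound[OF y, of \<psi>] GL[of "next_curve \<psi> y" "\<psi> y"] by linarith
      qed
      ultimately show ?thesis using 3(1) by (auto simp: indicator_def)
    qed
  qed
  have Q0: "0 \<le> Q \<psi>" if "\<psi> \<in> Adm" for \<psi>
    unfolding Q_def by (intro integral_unit_ge integrable_curve Gc that) (simp add: G_def)
  have "AE y in unit_interval. (\<lambda>n. (Q (state n \<phi> y) - (\<Sum>i<n. drift Q (state i \<phi> y))) / real n) \<longlonglongrightarrow> 0"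
    by (rule drift_law_of_large_numbers[OF Qinc \<phi>])
  moreover have "AE y in unit_interval. (\<lambda>n. visits ?J n \<phi> y / real n) \<longlonglongrightarrow> 0"
    using rare_strip[OF \<phi>] unfolding rare_def .
  ultimately show ?thesis
    using AE_space[of unit_interval] unfolding rare_def
  proof eventually_elim
    case (elim y)
    then have y: "y \<in> {0..<1}" by simp
    define g where "g n = 2 / L * (M * (visits ?J n \<phi> y / real n) +
      (Q (state n \<phi> y) - (\<Sum>i<n. drift Q (state i \<phi> y))) / real n)" for n
    have "g \<longlonglongrightarrow> 2 / L * (M * 0 + 0)"
      unfolding g_def by (intro tendsto_intros elim)
    then have lim: "g \<longlonglongrightarrow> 0" by simp
    have "visits ?R n \<phi> y / real n \<le> g n" for n
    proof -
      have "(\<Sum>i<n. drift Q (state i \<phi> y))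
          \<le> (\<Sum>i<n. M * indicator ?J (state i \<phi> y) - L / 2 * indicator ?R (state i \<phi> y))"
        by (intro sum_mono dr state_Adm y \<phi>)
      also have "\<dots> = M * visits ?J n \<phi> y - L / 2 * visits ?R n \<phi> y"
        by (simp add: sum_subtractf visits_def sum_distrib_left)
      finally have "L / 2 * visits ?R n \<phi> y
         \<le> M * visits ?J n \<phi> y + (Q (state n \<phi> y) - (\<Sum>i<n. drift Q (state i \<phi> y)))"
        using Q0[OF state_Adm[OF y \<phi>], of n] by linarith
      then have "visits ?R n \<phi> y
         \<le> 2 / L * (M * visits ?J n \<phi> y + (Q (state n \<phi> y) - (\<Sum>i<n. drift Q (state i \<phi> y))))"
        using pos by (simp add: field_simps)
      then have "visits ?R n \<phi> y / real n
         \<le> 2 / L * (M * visits ?J n \<phi> y + (Q (state n \<phi> y) - (\<Sum>i<n. drift Q (state i \<phi> y)))) / real n"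
        by (rule divide_right_mono) simp
      then show ?thesis
        unfolding g_def by (simp only: times_divide_eq_right[symmetric] add_divide_distrib)
    qed
    then show ?case
      by (intro Lim_null_comparison[OF _ lim] always_eventually allI) (simp add: visits_nonneg)
  qed
qed

text \<open>If the actual point of a curve is at or above \<open>K\<close>, the curve either lies
  entirely in the right region or has a point below \<open>K1 + M\<close>; in the second case
  bounded oscillation confines it to a strip.\<close>

theorem zero_frequency:
  assumes \<phi>: "\<phi> \<in> Adm"
  shows "AE y in unit_interval.
    (\<lambda>n. (\<Sum>i<n. indicator {K..} (walk i (\<phi> y) y)) / real n) \<longlonglongrightarrow> (0::real)"
proof -
  define V where "V = \<kappa> + B"
  let ?R = "{\<psi>. \<forall>t\<in>{0..<1}. K1 + M \<le> \<psi> t}"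
  let ?P = "strip (K - V) (K1 + M + V) \<union> ?R"
  have "rare ?P \<phi>" by (intro rare_Un rare_strip rare_right \<phi>)
  then show ?thesis
    using AE_space[of unit_interval] unfolding rare_def
  proof eventually_elim
    case (elim y)
    then have y: "y \<in> {0..<1}" by simp
    have "(\<Sum>i<n. indicator {K..} (walk i (\<phi> y) y)) \<le> visits ?P n \<phi> y" for n
      unfolding visits_def
    proof (rule sum_mono)
      fix i
      let ?\<psi> = "state i \<phi> y"
      have \<psi>: "?\<psi> \<in> Adm" by (rule state_Adm[OF y \<phi>])
      have "?\<psi> \<in> ?P" if "K \<le> walk i (\<phi> y) y"
      proof (cases "?\<psi> \<in> ?R")
        case False
        then obtain t where t: "t \<in> {0..<1}" "?\<psi> t < K1 + M" by (auto simp: not_le)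
        have s: "(E ^^ i) y \<in> {0..<1}" "K \<le> ?\<psi> ((E ^^ i) y)"
          using that state_walk[OF y] E_iterate_in[OF y] by simp_all
        have "K - V \<le> ?\<psi> x \<and> ?\<psi> x \<le> K1 + M + V" if "x \<in> {0..<1}" for x
          using curve_osc'[OF \<psi> t(1) that] curve_osc'[OF \<psi> s(1) that] t(2) s(2)
          unfolding V_def by linarith
        then show ?thesis unfolding strip_def by blast
      qed blast
      then show "indicator {K..} (walk i (\<phi> y) y) \<le> (indicator ?P ?\<psi> :: real)"
        by (auto simp: indicator_def simp del: state.simps walk.simps)
    qed
    then show ?case
      by (intro Lim_null_comparison[OF _ elim(1)] always_eventually allI)
        (simp add: divide_right_mono sum_nonneg)
  qed
qed

end

section \<open>Fibre maps in logistic coordinates\<close>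

definition logistic :: "real \<Rightarrow> real" where
  "logistic u = exp u / (1 + exp u)"

definition logit :: "real \<Rightarrow> real" where
  "logit x = ln x - ln (1 - x)"

lemma one_minus_logistic: "1 - logistic u = 1 / (1 + exp u)"
proof -
  have "1 + exp u \<noteq> 0" using exp_gt_zero[of u] by linarith
  then show ?thesis by (simp add: logistic_def field_simps)
qed

lemma logistic_pos: "0 < logistic u" and logistic_less_1: "logistic u < 1"
  using exp_gt_zero[of u] by (auto simp: logistic_def field_simps add_pos_pos)

lemma logit_logistic [simp]: "logit (logistic u) = u"
proof -
  have "0 < 1 + exp u" using exp_gt_zero[of u] by linarith
  then show ?thesis unfolding logit_def one_minus_logistic by (simp add: logistic_def ln_div)
qed

lemma logistic_logit [simp]: "0 < x \<Longrightarrow> x < 1 \<Longrightarrow> logistic (logit x) = x"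
  by (simp add: logistic_def logit_def exp_diff field_simps)

lemma logit_le_iff:
  assumes "0 < x" "x < 1" "0 < z" "z < 1" shows "logit x \<le> logit z \<longleftrightarrow> x \<le> z"
proof
  assume "x \<le> z"
  then have "ln x \<le> ln z" "ln (1 - z) \<le> ln (1 - x)" using assms by auto
  then show "logit x \<le> logit z" by (simp add: logit_def)
next
  show "x \<le> z" if "logit x \<le> logit z"
  proof (rule ccontr)
    assume "\<not> x \<le> z"
    then have "ln z < ln x" "ln (1 - x) < ln (1 - z)" using assms by auto
    then show False using that by (simp add: logit_def)
  qed
qed

lemma logistic_le_exp: "logistic u \<le> exp u"
  by (simp add: logistic_def divide_le_eq add_pos_pos distrib_left)

lemma half_less_logistic: "1 / 2 < logistic u \<Longrightarrow> 1 \<le> exp u"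
  using exp_gt_zero[of u] by (simp add: logistic_def field_simps add_pos_pos)

lemma logistic_deriv: "(logistic has_real_derivative logistic u * (1 - logistic u)) (at u)"
proof -
  have "1 + exp u \<noteq> 0" using exp_gt_zero[of u] by linarith
  then have "((\<lambda>u. exp u / (1 + exp u)) has_real_derivative logistic u * (1 - logistic u)) (at u)"
    unfolding one_minus_logistic
    by (auto intro!: derivative_eq_intros simp: logistic_def field_simps)
  then show ?thesis by (simp add: logistic_def[abs_def])
qed

lemma ln_diff_bound:
  fixes p q k :: real
  assumes "0 < k" "k \<le> p" "k \<le> q" shows "\<bar>ln p - ln q\<bar> \<le> \<bar>p - q\<bar> / k"
proof -
  have *: "ln p - ln q \<le> \<bar>p - q\<bar> / k" if "k \<le> p" "k \<le> q" for p q
  proof -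
    have pq: "0 < p" "0 < q" using that assms(1) by linarith+
    have "ln p - ln q = ln (p / q)" using pq by (simp add: ln_div)
    also have "\<dots> \<le> p / q - 1" using pq by (intro ln_le_minus_one) simp
    also have "\<dots> = (p - q) / q" using pq by (simp add: field_simps)
    also have "\<dots> \<le> \<bar>p - q\<bar> / k" using pq that assms(1) by (intro frac_le) auto
    finally show ?thesis .
  qed
  show ?thesis using *[OF assms(2,3)] *[OF assms(3,2)] by (simp add: abs_minus_commute abs_le_iff)
qed

text \<open>In the coordinate \<open>u = logit x\<close> the unperturbed fibre map is the translation by \<open>\<xi> y\<close>.\<close>

locale fiber_family =
  fixes g gx :: "real \<Rightarrow> real \<Rightarrow> real" and \<xi> :: "real \<Rightarrow> real" and X C r0 C2 L\<xi> :: real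
  assumes nonneg: "0 \<le> X" "0 < C" "0 < r0" "0 \<le> C2" "0 \<le> L\<xi>"
    and \<xi>_bound: "y \<in> {0..1} \<Longrightarrow> \<bar>\<xi> y\<bar> \<le> X"
    and \<xi>_Lipschitz: "y \<in> {0..1} \<Longrightarrow> z \<in> {0..1} \<Longrightarrow> \<bar>\<xi> y - \<xi> z\<bar> \<le> L\<xi> * \<bar>y - z\<bar>"
    and r0_small: "r0 \<le> 1" "4 * exp X * r0 \<le> 1"
    and g_cont: "continuous_on ({0..1} \<times> {0..1}) (\<lambda>(y, x). g y x)"
    and gx_cont: "continuous_on ({0..1} \<times> {0..1}) (\<lambda>(y, x). gx y x)"
    and g_deriv: "y \<in> {0..1} \<Longrightarrow> x \<in> {0..1} \<Longrightarrow> (g y has_real_derivative gx y x) (at x within {0..1})"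
    and gx_Lipschitz: "y \<in> {0..1} \<Longrightarrow> z \<in> {0..1} \<Longrightarrow> x \<in> {0..1} \<Longrightarrow> \<bar>gx y x - gx z x\<bar> \<le> C2 * \<bar>y - z\<bar>"
    and r_left: "y \<in> {0..1} \<Longrightarrow> x \<in> {0..1} \<Longrightarrow>
       \<bar>g y x - exp (\<xi> y) * x / (1 + (exp (\<xi> y) - 1) * x)\<bar> \<le> C * x\<^sup>2"
    and r_right: "y \<in> {0..1} \<Longrightarrow> x \<in> {0..1} \<Longrightarrow>
       \<bar>g y x - exp (\<xi> y) * x / (1 + (exp (\<xi> y) - 1) * x)\<bar> \<le> C * \<bar>1 - x\<bar>"
    and rx: "y \<in> {0..1} \<Longrightarrow> x \<in> {0..1} \<Longrightarrow>
       \<bar>gx y x - exp (\<xi> y) / (1 + (exp (\<xi> y) - 1) * x)\<^sup>2\<bar> \<le> r0"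
begin

text \<open>\<Lambda> bounds \<open>exp (\<xi> y)\<close> and its inverse. \<open>Lu\<close> depends
  on \<open>X\<close> alone and is known before the map, whereas \<open>C2\<close>, and with it
  \<open>C3\<close> and \<open>B\<close>, belongs to the individual map.\<close>

definition "\<Lambda> = exp X"
definition "den y x = 1 + (exp (\<xi> y) - 1) * x"
definition "base y x = exp (\<xi> y) * x / den y x"
definition "c0 = 4 * \<Lambda> * (C + 1)"
definition "Lu = 4 * \<Lambda> * (\<Lambda> ^ 3 + 1)"
definition "C3 = 4 * \<Lambda> * C2 + L\<xi>"
definition "B = sqrt (2 * c0 * C3) + C3"
definition "D y u = logit (g y (logistic u)) - u"

lemma \<Lambda>_ge_1: "1 \<le> \<Lambda>" and \<Lambda>_pos: "0 < \<Lambda>"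
  using nonneg by (auto simp: \<Lambda>_def)

lemma r0_\<Lambda>: "4 * \<Lambda> * r0 \<le> 1" "r0 \<le> 1 / (2 * \<Lambda>)"
  using r0_small \<Lambda>_pos nonneg by (auto simp: \<Lambda>_def field_simps)

lemma exp_\<xi>: "y \<in> {0..1} \<Longrightarrow> exp (\<xi> y) \<le> \<Lambda>" "y \<in> {0..1} \<Longrightarrow> 1 / \<Lambda> \<le> exp (\<xi> y)"
proof -
  show "exp (\<xi> y) \<le> \<Lambda>" if "y \<in> {0..1}" using \<xi>_bound[OF that] by (simp add: \<Lambda>_def)
  show "1 / \<Lambda> \<le> exp (\<xi> y)" if "y \<in> {0..1}"
  proof -
    have "exp (- X) \<le> exp (\<xi> y)" using \<xi>_bound[OF that] by simp
    then show ?thesis by (simp add: \<Lambda>_def exp_minus inverse_eq_divide)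
  qed
qed

lemma den_bounds:
  assumes y: "y \<in> {0..1}" and x: "x \<in> {0..1}"
  shows "1 / \<Lambda> \<le> den y x" "den y x \<le> \<Lambda>" "0 < den y x" "den y x \<le> exp (\<xi> y) * \<Lambda>"
proof -
  have d: "den y x = (1 - x) * 1 + x * exp (\<xi> y)" by (simp add: den_def algebra_simps)
  have l: "1 / \<Lambda> \<le> 1" using \<Lambda>_ge_1 by simp
  have cc: "(1 - x) * a + x * a = a" for a :: real by (simp add: algebra_simps)
  have "(1 - x) * (1 / \<Lambda>) + x * (1 / \<Lambda>) \<le> den y x"
    unfolding d using x l exp_\<xi>(2)[OF y] by (intro add_mono mult_left_mono) auto
  then show 1: "1 / \<Lambda> \<le> den y x" unfolding cc .
  then show "0 < den y x" using \<Lambda>_pos by (meson less_le_trans zero_less_divide_1_iff)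
  have "den y x \<le> (1 - x) * \<Lambda> + x * \<Lambda>"
    unfolding d using x \<Lambda>_ge_1 exp_\<xi>(1)[OF y] by (intro add_mono mult_left_mono) auto
  then show "den y x \<le> \<Lambda>" unfolding cc .
  have "1 \<le> exp (\<xi> y) * \<Lambda>"
    using exp_\<xi>(2)[OF y] \<Lambda>_pos by (simp add: field_simps)
  moreover have "exp (\<xi> y) * 1 \<le> exp (\<xi> y) * \<Lambda>" using \<Lambda>_ge_1 by (intro mult_left_mono) auto
  ultimately have "den y x \<le> (1 - x) * (exp (\<xi> y) * \<Lambda>) + x * (exp (\<xi> y) * \<Lambda>)"
    unfolding d using x by (intro add_mono mult_left_mono) auto
  then show "den y x \<le> exp (\<xi> y) * \<Lambda>" unfolding cc .
qed

lemma one_minus_base: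
  assumes "y \<in> {0..1}" "x \<in> {0..1}" shows "1 - base y x = (1 - x) / den y x"
  using den_bounds(3)[OF assms] by (simp add: base_def field_simps) (simp add: den_def algebra_simps)

lemma base_ge:
  assumes y: "y \<in> {0..1}" and x: "x \<in> {0..1}"
  shows "x / \<Lambda> \<le> base y x" "(1 - x) / \<Lambda> \<le> 1 - base y x"
proof -
  note d = den_bounds[OF y x]
  have "den y x * x \<le> exp (\<xi> y) * \<Lambda> * x" using d(4) x by (intro mult_right_mono) auto
  then show "x / \<Lambda> \<le> base y x" using d \<Lambda>_pos by (simp add: base_def field_simps)
  show "(1 - x) / \<Lambda> \<le> 1 - base y x"
    unfolding one_minus_base[OF y x] using d x by (intro frac_le) auto
qed

lemma logit_base:
  assumes y: "y \<in> {0..1}" and x: "0 < x" "x < 1" shows "logit (base y x) = logit x + \<xi> y"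
proof -
  have d: "0 < den y x" using den_bounds(3)[OF y] x by simp
  have "1 - base y x = (1 - x) / den y x" by (rule one_minus_base) (use y x in auto)
  then show ?thesis using d x by (simp add: logit_def base_def ln_div ln_mult)
qed

lemma base_deriv:
  assumes y: "y \<in> {0..1}" and x: "x \<in> {0..1}"
  shows "(base y has_real_derivative exp (\<xi> y) / (den y x)\<^sup>2) (at x within {0..1})"
proof -
  have d: "den y x \<noteq> 0" using den_bounds(3)[OF y x] by simp
  have "((\<lambda>x. exp (\<xi> y) * x / den y x) has_real_derivative exp (\<xi> y) / (den y x)\<^sup>2) (at x within {0..1})"
    unfolding den_def using d[unfolded den_def]
    by (auto intro!: derivative_eq_intros simp: divide_simps power2_eq_square) (simp add: algebra_simps)
  then show ?thesis by (simp add: base_def[abs_def])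
qed

text \<open>The bounds by \<open>C * x\<^sup>2\<close> and \<open>C * \<bar>1 - x\<bar>\<close>
  force the remainder to vanish at both ends, where the derivative bound \<open>r0\<close> makes it
  linearly small. This is what keeps the perturbation small in the logistic coordinate up to both
  ends.\<close>

lemma remainder_linear:
  assumes y: "y \<in> {0..1}" and x: "x \<in> {0..1}"
  shows "\<bar>g y x - base y x\<bar> \<le> r0 * x" "\<bar>g y x - base y x\<bar> \<le> r0 * (1 - x)"
proof -
  define r where "r t = g y t - base y t" for t
  have L: "\<bar>r a - r b\<bar> \<le> r0 * \<bar>a - b\<bar>" if "a \<in> {0..1}" "b \<in> {0..1}" for a b
  proof -
    have "norm (r a - r b) \<le> r0 * norm (a - b)"
    proof (rule field_differentiable_bound[of "{0..1}"])
      fix t :: real assume t: "t \<in> {0..1}"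
      show "(r has_real_derivative gx y t - exp (\<xi> y) / (den y t)\<^sup>2) (at t within {0..1})"
        unfolding r_def by (intro DERIV_diff g_deriv base_deriv y t)
      show "norm (gx y t - exp (\<xi> y) / (den y t)\<^sup>2) \<le> r0"
        using rx[OF y t] by (simp add: den_def)
    qed (use that in auto)
    then show ?thesis by simp
  qed
  have "r 0 = 0" using r_left[OF y, of 0] by (simp add: r_def base_def)
  then show "\<bar>g y x - base y x\<bar> \<le> r0 * x" using L[OF x, of 0] x by (simp add: r_def)
  have "r 1 = 0" using r_right[OF y, of 1] by (simp add: r_def base_def den_def)
  then show "\<bar>g y x - base y x\<bar> \<le> r0 * (1 - x)" using L[OF x, of 1] x by (simp add: r_def)
qed

lemma g_end: "y \<in> {0..1} \<Longrightarrow> g y 0 = 0" "y \<in> {0..1} \<Longrightarrow> g y 1 = 1"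
  using r_left[of y 0] r_right[of y 1] by auto

text \<open>Because of \<open>r0 \<le> 1 / (2 * \<Lambda>)\<close> the perturbation takes away at
  most half of the distance that the unperturbed image keeps from either end.\<close>

lemma g_ge:
  assumes y: "y \<in> {0..1}" and x: "x \<in> {0..1}"
  shows "x / (2 * \<Lambda>) \<le> g y x" "(1 - x) / (2 * \<Lambda>) \<le> 1 - g y x"
proof -
  have "r0 * x \<le> 1 / (2 * \<Lambda>) * x" "r0 * (1 - x) \<le> 1 / (2 * \<Lambda>) * (1 - x)"
    using x by (intro mult_right_mono r0_\<Lambda>(2); simp)+
  moreover have "w / \<Lambda> = 2 * (1 / (2 * \<Lambda>) * w)" "w / (2 * \<Lambda>) = 1 / (2 * \<Lambda>) * w" for w
    by auto
  ultimately show "x / (2 * \<Lambda>) \<le> g y x" "(1 - x) / (2 * \<Lambda>) \<le> 1 - g y x"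
    using base_ge[OF y x] remainder_linear[OF y x] by smt+
qed

lemma g_in:
  assumes y: "y \<in> {0..1}" and x: "0 < x" "x < 1" shows "0 < g y x" "g y x < 1"
proof -
  have "0 < x / (2 * \<Lambda>)" "0 < (1 - x) / (2 * \<Lambda>)" using x \<Lambda>_pos by auto
  then show "0 < g y x" "g y x < 1" using g_ge[OF y, of x] x by auto
qed

lemma gx_bound:
  assumes y: "y \<in> {0..1}" and x: "x \<in> {0..1}"
  shows "\<bar>gx y x\<bar> \<le> \<Lambda> ^ 3 + 1"
proof -
  note d = den_bounds[OF y x]
  have "exp (\<xi> y) / (den y x)\<^sup>2 \<le> \<Lambda> / (1 / \<Lambda>)\<^sup>2"
    using d exp_\<xi>(1)[OF y] \<Lambda>_pos by (intro frac_le power_mono) auto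
  also have "\<dots> = \<Lambda> ^ 3" by (simp add: power_divide power2_eq_square power3_eq_cube)
  finally have "exp (\<xi> y) / (den y x)\<^sup>2 \<le> \<Lambda> ^ 3" .
  moreover have "0 \<le> exp (\<xi> y) / (den y x)\<^sup>2" by simp
  ultimately show ?thesis using rx[OF y x] r0_small(1) unfolding den_def by linarith
qed

lemma gx_end_ge: "y \<in> {0..1} \<Longrightarrow> 1 / (2 * \<Lambda>) \<le> gx y 1"
proof -
  assume y: "y \<in> {0..1}"
  have "exp (- X) \<le> exp (- \<xi> y)" using \<xi>_bound[OF y] by simp
  then have 1: "1 / \<Lambda> \<le> 1 / exp (\<xi> y)" by (simp add: \<Lambda>_def exp_minus inverse_eq_divide)
  have e: "exp (\<xi> y) / (1 + (exp (\<xi> y) - 1) * 1)\<^sup>2 = 1 / exp (\<xi> y)"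
    by (simp add: power2_eq_square)
  have "\<bar>gx y 1 - 1 / exp (\<xi> y)\<bar> \<le> r0" using rx[OF y, of 1] unfolding e by simp
  moreover have "1 / \<Lambda> = 2 * (1 / (2 * \<Lambda>))" by simp
  ultimately show ?thesis using 1 r0_\<Lambda>(2) by linarith
qed

text \<open>\<open>logit\<close> is singular at both ends, so differences are measured relative to
  \<open>x\<close> and \<open>1 - x\<close>. The differences to which this is applied vanish
  linearly at both ends, which keeps the quotients bounded.\<close>

lemma logit_diff_bound:
  assumes x: "0 < x" "x < 1"
    and p: "x / (2 * \<Lambda>) \<le> p" "(1 - x) / (2 * \<Lambda>) \<le> 1 - p"
    and q: "x / (2 * \<Lambda>) \<le> q" "(1 - x) / (2 * \<Lambda>) \<le> 1 - q"
  shows "\<bar>logit p - logit q\<bar> \<le> 2 * \<Lambda> * (\<bar>p - q\<bar> / x + \<bar>p - q\<bar> / (1 - x))"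
proof -
  have "\<bar>ln p - ln q\<bar> \<le> \<bar>p - q\<bar> / (x / (2 * \<Lambda>))"
    using x \<Lambda>_pos by (intro ln_diff_bound p q) simp
  moreover have "\<bar>ln (1 - p) - ln (1 - q)\<bar> \<le> \<bar>(1 - p) - (1 - q)\<bar> / ((1 - x) / (2 * \<Lambda>))"
    using x \<Lambda>_pos by (intro ln_diff_bound p q) simp
  moreover have "\<bar>(1 - p) - (1 - q)\<bar> = \<bar>p - q\<bar>" by simp
  moreover have "\<bar>(a - b) - (c - d)\<bar> \<le> s + t" if "\<bar>a - c\<bar> \<le> s" "\<bar>b - d\<bar> \<le> t"
    for a b c d s t :: real using that by linarith
  ultimately have "\<bar>logit p - logit q\<bar>
      \<le> \<bar>p - q\<bar> / (x / (2 * \<Lambda>)) + \<bar>p - q\<bar> / ((1 - x) / (2 * \<Lambda>))"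
    unfolding logit_def by metis
  also have "\<dots> = 2 * \<Lambda> * (\<bar>p - q\<bar> / x + \<bar>p - q\<bar> / (1 - x))"
    by (simp add: distrib_left mult.commute)
  finally show ?thesis .
qed

lemma base_ge_half:
  assumes y: "y \<in> {0..1}" and x: "x \<in> {0..1}"
  shows "x / (2 * \<Lambda>) \<le> base y x" "(1 - x) / (2 * \<Lambda>) \<le> 1 - base y x"
proof -
  have "x / (2 * \<Lambda>) \<le> x / \<Lambda>" "(1 - x) / (2 * \<Lambda>) \<le> (1 - x) / \<Lambda>"
    using x \<Lambda>_pos by (auto intro!: divide_left_mono)
  then show "x / (2 * \<Lambda>) \<le> base y x" "(1 - x) / (2 * \<Lambda>) \<le> 1 - base y x"
    using base_ge[OF y x] by linarith+
qed

text \<open>The first bound rests on linear smallness at both ends. For the second, quadratic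
  smallness at 0 leaves a further factor \<open>x\<close>, which is at most \<open>exp u\<close>;
  right of \<open>x = 1 / 2\<close> the first bound suffices because there
  \<open>exp u \<ge> 1\<close>.\<close>

lemma D_near:
  assumes y: "y \<in> {0..1}" shows "\<bar>D y u - \<xi> y\<bar> \<le> 4 * \<Lambda> * r0"
    and "\<bar>D y u - \<xi> y\<bar> \<le> c0 * exp u"
proof -
  define x where "x = logistic u"
  have x: "0 < x" "x < 1" by (auto simp: x_def logistic_pos logistic_less_1)
  then have xI: "x \<in> {0..1}" by simp
  define r where "r = \<bar>g y x - base y x\<bar>"
  have "D y u - \<xi> y = logit (g y x) - logit (base y x)"
    unfolding logit_base[OF y x] by (simp add: D_def x_def)
  then have *: "\<bar>D y u - \<xi> y\<bar> \<le> 2 * \<Lambda> * (r / x + r / (1 - x))"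
    using logit_diff_bound[OF x g_ge[OF y xI] base_ge_half[OF y xI]] by (simp add: r_def)
  have "r / x \<le> r0" "r / (1 - x) \<le> r0"
    using remainder_linear[OF y xI] x by (auto simp: r_def divide_le_eq)
  then have "2 * \<Lambda> * (r / x + r / (1 - x)) \<le> 2 * \<Lambda> * (r0 + r0)"
    using \<Lambda>_pos by (intro mult_left_mono) auto
  moreover have "2 * \<Lambda> * (r0 + r0) = 4 * \<Lambda> * r0" by simp
  ultimately show 1: "\<bar>D y u - \<xi> y\<bar> \<le> 4 * \<Lambda> * r0" using * by linarith
  show "\<bar>D y u - \<xi> y\<bar> \<le> c0 * exp u"
  proof (cases "x \<le> 1 / 2")
    case True
    have rC: "r \<le> C * x\<^sup>2" using r_left[OF y xI] by (simp add: r_def base_def den_def)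
    then have "r / x \<le> C * x" using x by (simp add: divide_le_eq power2_eq_square mult.assoc)
    moreover have "r / (1 - x) \<le> C * x"
    proof -
      have "x * x \<le> x * (1 - x)" using True x by (intro mult_left_mono) auto
      then have "C * (x * x) \<le> C * (x * (1 - x))" by (rule mult_left_mono) (use nonneg in auto)
      then have "r \<le> C * x * (1 - x)" using rC by (simp only: power2_eq_square mult.assoc)
      then show ?thesis using x by (simp add: pos_divide_le_eq)
    qed
    ultimately have "2 * \<Lambda> * (r / x + r / (1 - x)) \<le> 2 * \<Lambda> * (C * x + C * x)"
      using \<Lambda>_pos by (intro mult_left_mono) auto
    also have "\<dots> = 4 * \<Lambda> * C * x" by simp
    also have "\<dots> \<le> c0 * exp u"
      unfolding c0_def x_def using \<Lambda>_pos nonneg logistic_le_exp[of u]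
      by (intro mult_mono mult_left_mono) (auto simp: less_imp_le[OF logistic_pos])
    finally show ?thesis using * by linarith
  next
    case False
    then have e: "1 \<le> exp u" using half_less_logistic[of u] by (simp add: x_def)
    have "4 * \<Lambda> * r0 \<le> c0 * 1"
      unfolding c0_def using r0_small(1) \<Lambda>_pos nonneg by simp
    also have "\<dots> \<le> c0 * exp u"
      using e \<Lambda>_pos nonneg by (intro mult_left_mono) (auto simp: c0_def)
    finally show ?thesis using 1 by linarith
  qed
qed

text \<open>The factor \<open>x * (1 - x)\<close> from the derivative of \<open>logistic\<close>
  cancels the singularities of \<open>logit\<close> at the image point by \<open>g_ge\<close>, so
  the derivative of the lifted map is bounded in terms of \<open>X\<close> alone.\<close>

lemma step_Lipschitz:
  assumes y: "y \<in> {0..1}" shows "\<bar>(u + D y u) - (v + D y v)\<bar> \<le> Lu * \<bar>u - v\<bar>"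
proof -
  define h where "h u = logit (g y (logistic u))" for u
  have "norm (h u - h v) \<le> Lu * norm (u - v)"
  proof (rule field_differentiable_bound[of UNIV])
    fix w :: real
    define x where "x = logistic w"
    have x: "0 < x" "x < 1" by (auto simp: x_def logistic_pos logistic_less_1)
    then have xI: "x \<in> {0..1}" by simp
    note gi = g_in[OF y x]
    have "(g y has_real_derivative gx y x) (at x)"
    proof -
      have "(g y has_real_derivative gx y x) (at x within {0<..<1})"
        by (rule has_field_derivative_subset[OF g_deriv[OF y xI]]) auto
      then show ?thesis using x by (simp add: at_within_open[of x "{0<..<1}"])
    qed
    then have gl: "((\<lambda>w. g y (logistic w)) has_real_derivative gx y x * (x * (1 - x))) (at w)"
      unfolding x_def by (rule DERIV_chain2[OF _ logistic_deriv])
    show "(h has_real_derivative gx y x * (x * (1 - x)) / g y x + gx y x * (x * (1 - x)) / (1 - g y x))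
        (at w within UNIV)"
      unfolding h_def logit_def using gi
      by (auto intro!: derivative_eq_intros gl simp: x_def divide_inverse)
    have k: "x * (1 - x) / g y x \<le> 2 * \<Lambda>" "x * (1 - x) / (1 - g y x) \<le> 2 * \<Lambda>"
    proof -
      have "x * (1 - x) \<le> x * 1" using x by (intro mult_left_mono) auto
      also have "\<dots> \<le> 2 * \<Lambda> * g y x" using g_ge(1)[OF y xI] \<Lambda>_pos by (simp add: field_simps)
      finally show "x * (1 - x) / g y x \<le> 2 * \<Lambda>" using gi by (simp add: divide_le_eq)
      have "x * (1 - x) \<le> 1 * (1 - x)" using x by (intro mult_right_mono) auto
      also have "\<dots> \<le> 2 * \<Lambda> * (1 - g y x)" using g_ge(2)[OF y xI] \<Lambda>_pos by (simp add: field_simps)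
      finally show "x * (1 - x) / (1 - g y x) \<le> 2 * \<Lambda>" using gi by (simp add: divide_le_eq)
    qed
    have "norm (gx y x * (x * (1 - x)) / g y x + gx y x * (x * (1 - x)) / (1 - g y x))
        = \<bar>gx y x\<bar> * (x * (1 - x) / g y x + x * (1 - x) / (1 - g y x))"
      using x gi by (simp add: abs_mult flip: distrib_left times_divide_eq_right)
    also have "\<dots> \<le> (\<Lambda> ^ 3 + 1) * (2 * \<Lambda> + 2 * \<Lambda>)"
      using k gi x gx_bound[OF y xI] by (intro mult_mono add_mono) auto
    also have "\<dots> = Lu" by (simp add: Lu_def algebra_simps)
    finally show "norm (gx y x * (x * (1 - x)) / g y x + gx y x * (x * (1 - x)) / (1 - g y x)) \<le> Lu" .
  qed auto
  then show ?thesis by (simp add: h_def D_def)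
qed

lemma g_Lipschitz:
  assumes y: "y \<in> {0..1}" and z: "z \<in> {0..1}" and x: "x \<in> {0..1}"
  shows "\<bar>g y x - g z x\<bar> \<le> C2 * \<bar>y - z\<bar> * x" "\<bar>g y x - g z x\<bar> \<le> C2 * \<bar>y - z\<bar> * (1 - x)"
proof -
  define h where "h t = g y t - g z t" for t
  have L: "\<bar>h a - h b\<bar> \<le> C2 * \<bar>y - z\<bar> * \<bar>a - b\<bar>" if "a \<in> {0..1}" "b \<in> {0..1}" for a b
  proof -
    have "norm (h a - h b) \<le> C2 * \<bar>y - z\<bar> * norm (a - b)"
    proof (rule field_differentiable_bound[of "{0..1}"])
      fix t :: real assume t: "t \<in> {0..1}"
      show "(h has_real_derivative gx y t - gx z t) (at t within {0..1})"
        unfolding h_def by (intro DERIV_diff g_deriv y z t)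
      show "norm (gx y t - gx z t) \<le> C2 * \<bar>y - z\<bar>" using gx_Lipschitz[OF y z t] by simp
    qed (use that in auto)
    then show ?thesis by simp
  qed
  have "h 0 = 0" "h 1 = 0" using g_end y z by (auto simp: h_def)
  then show "\<bar>g y x - g z x\<bar> \<le> C2 * \<bar>y - z\<bar> * x" "\<bar>g y x - g z x\<bar> \<le> C2 * \<bar>y - z\<bar> * (1 - x)"
    using L[OF x, of 0] L[OF x, of 1] x by (auto simp: h_def)
qed

lemma D_Lipschitz:
  assumes y: "y \<in> {0..1}" and z: "z \<in> {0..1}"
  shows "\<bar>D y u - D z u\<bar> \<le> 4 * \<Lambda> * C2 * \<bar>y - z\<bar>"
proof -
  define x where "x = logistic u"
  have x: "0 < x" "x < 1" by (auto simp: x_def logistic_pos logistic_less_1)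
  then have xI: "x \<in> {0..1}" by simp
  define r where "r = \<bar>g y x - g z x\<bar>"
  have "\<bar>D y u - D z u\<bar> \<le> 2 * \<Lambda> * (r / x + r / (1 - x))"
    using logit_diff_bound[OF x g_ge[OF y xI] g_ge[OF z xI]] by (simp add: r_def D_def x_def)
  also have "\<dots> \<le> 2 * \<Lambda> * (C2 * \<bar>y - z\<bar> + C2 * \<bar>y - z\<bar>)"
    using g_Lipschitz[OF y z xI] x \<Lambda>_pos
    by (intro mult_left_mono add_mono) (auto simp: r_def divide_le_eq)
  finally show ?thesis by simp
qed

lemma consts_nonneg: "0 < c0" "0 \<le> Lu" "0 \<le> C3" "0 \<le> B"
  using \<Lambda>_pos nonneg by (auto simp: c0_def Lu_def C3_def B_def)

text \<open>\<xi> is split off because its variation does not decay in \<open>u\<close>, but has a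
  constant independent of the map. The rest is interpolated between its two bounds for
  \<open>u \<le> 0\<close>; for \<open>u > 0\<close> the weight is 1 and the Lipschitz bound is
  enough, as distances are at most 1.\<close>

lemma D_holder:
  assumes y: "y \<in> {0..1}" and z: "z \<in> {0..1}"
  shows "\<bar>D y u - D z u\<bar> \<le> L\<xi> * \<bar>y - z\<bar> + B * weight u * sqrt \<bar>y - z\<bar>"
proof -
  define h where "h = sqrt \<bar>y - z\<bar>"
  have h2: "h\<^sup>2 = \<bar>y - z\<bar>" and h0: "0 \<le> h" by (simp_all add: h_def)
  have h1: "h \<le> 1" using y z by (auto simp: h_def abs_if)
  define \<delta> where "\<delta> = \<bar>(D y u - \<xi> y) - (D z u - \<xi> z)\<bar>"
  have \<delta>0: "0 \<le> \<delta>" by (simp add: \<delta>_def)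
  have \<delta>1: "\<delta> \<le> 2 * c0 * exp u"
    using D_near(2)[OF y, of u] D_near(2)[OF z, of u] by (simp add: \<delta>_def abs_le_iff)
  have \<delta>2: "\<delta> \<le> C3 * h\<^sup>2"
    using D_Lipschitz[OF y z, of u] \<xi>_Lipschitz[OF y z]
    unfolding \<delta>_def C3_def h2 distrib_right by (simp add: abs_le_iff)
  have "\<delta> \<le> B * weight u * h"
  proof (cases "u \<le> 0")
    case True
    have "\<delta>\<^sup>2 \<le> (2 * c0 * exp u) * (C3 * h\<^sup>2)"
      unfolding power2_eq_square[of \<delta>] using \<delta>0 \<delta>1 \<delta>2 consts_nonneg by (intro mult_mono) auto
    also have "\<dots> = (sqrt (2 * c0 * C3) * weight u * h)\<^sup>2"
    proof -
      have "(weight u)\<^sup>2 = exp u"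
        using True by (simp add: weight_def power2_eq_square flip: exp_add)
      then show ?thesis using consts_nonneg by (simp add: power_mult_distrib)
    qed
    finally have "\<delta> \<le> sqrt (2 * c0 * C3) * weight u * h"
      by (rule power2_le_imp_le) (use consts_nonneg h0 in auto)
    also have "\<dots> \<le> B * weight u * h"
      using consts_nonneg h0 by (intro mult_right_mono) (auto simp: B_def)
    finally show ?thesis .
  next
    case False
    have "C3 * h\<^sup>2 \<le> C3 * h"
      using h0 h1 consts_nonneg by (intro mult_left_mono) (auto simp: power2_eq_square mult_left_le)
    also have "\<dots> \<le> B * weight u * h"
      using False h0 consts_nonneg by (intro mult_right_mono) (auto simp: B_def weight_def)
    finally show ?thesis using \<delta>2 by linarith
  qed
  then show ?thesis
    using \<xi>_Lipschitz[OF y z] unfolding \<delta>_def h_def by linarith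
qed

text \<open>By the mean value theorem \<open>(1 - g y x) / (1 - x)\<close> is some
  \<open>gx y t\<close> with \<open>t\<close> between \<open>x\<close> and 1, so the increment is
  \<open>(ln (g y x) - ln x) - ln (gx y t)\<close>. The first difference tends to 0 and
  \<open>t\<close> tends to 1, uniformly in \<open>y\<close> by compactness.\<close>

lemma D_right:
  assumes L: "0 < L"
  shows "\<exists>K1. \<forall>y\<in>{0..1}. \<forall>u\<ge>K1. \<bar>D y u - (- ln (gx y 1))\<bar> \<le> L / 2"
proof -
  define e where "e = L / (8 * \<Lambda>)"
  have e: "0 < e" using L \<Lambda>_pos by (simp add: e_def)
  have "uniformly_continuous_on ({0..1} \<times> {0..1}) (\<lambda>(y, x). gx y x)"
    by (intro compact_uniformly_continuous gx_cont compact_Times) auto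
  then obtain d where d: "0 < d" and uc: "\<And>p q. p \<in> {0..1} \<times> {0..1} \<Longrightarrow> q \<in> {0..1} \<times> {0..1} \<Longrightarrow>
      dist q p < d \<Longrightarrow> dist (case q of (y, x) \<Rightarrow> gx y x) (case p of (y, x) \<Rightarrow> gx y x) < e"
    unfolding uniformly_continuous_on_def using e by meson
  define A where "A = 4 * \<Lambda> * (\<Lambda> ^ 3 + 2)"
  have A: "0 < A" using \<Lambda>_pos by (simp add: A_def add_pos_pos)
  \<comment> \<open>The three terms serve uniform continuity of \<open>gx\<close>, the bound
    \<open>x \<ge> 1 / 2\<close>, and the estimate of \<open>ln (g y x) - ln x\<close> by
    \<open>A * \<rho>\<close>.\<close>
  define \<rho> where "\<rho> = min (d / 2) (min (1 / 2) (L / (4 * A)))"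
  have \<rho>: "0 < \<rho>" "\<rho> < d" "\<rho> \<le> 1 / 2" "A * \<rho> \<le> L / 4"
  proof -
    show "0 < \<rho>" "\<rho> < d" "\<rho> \<le> 1 / 2" using d L A by (auto simp: \<rho>_def)
    have "A * \<rho> \<le> A * (L / (4 * A))" using A by (intro mult_left_mono) (auto simp: \<rho>_def)
    then show "A * \<rho> \<le> L / 4" using A by simp
  qed
  show ?thesis
  proof (intro exI[of _ "- ln \<rho>"] ballI allI impI)
    fix y u :: real assume y: "y \<in> {0..1}" and u: "- ln \<rho> \<le> u"
    define x where "x = logistic u"
    have x: "0 < x" "x < 1" by (auto simp: x_def logistic_pos logistic_less_1)
    then have xI: "x \<in> {0..1}" by simp
    have x1: "1 - x \<le> \<rho>"
    proof -
      have "1 / \<rho> \<le> exp u"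
        using u \<rho>(1) by (metis exp_le_cancel_iff exp_ln exp_minus inverse_eq_divide)
      then have "1 / (1 + exp u) \<le> 1 / (1 / \<rho>)" using \<rho>(1) by (intro divide_left_mono) (auto simp: add_pos_pos)
      then show ?thesis by (simp add: x_def one_minus_logistic)
    qed
    have "\<exists>t\<in>{x<..<1}. g y 1 - g y x = gx y t * (1 - x)"
    proof (rule mvt_simple[OF x(2)])
      fix t assume "x \<le> t" "t \<le> 1"
      then show "(g y has_derivative (*) (gx y t)) (at t within {x..1})"
        using has_field_derivative_subset[OF g_deriv[OF y, of t], of "{x..1}"] x
        by (simp add: has_field_derivative_def)
    qed
    then obtain t where t: "x < t" "t < 1" "1 - g y x = (1 - x) * gx y t"
      using g_end(2)[OF y] by (auto simp: mult.commute)
    then have tI: "t \<in> {0..1}" using x by simp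
    have q: "(1 - g y x) / (1 - x) = gx y t" using t x by simp
    have "dist (y, t) (y, 1) < d"
      using t x1 \<rho>(2) by (simp add: dist_Pair_Pair dist_real_def)
    then have gt: "\<bar>gx y t - gx y 1\<bar> < e"
      using uc[of "(y, 1)" "(y, t)"] y tI by (simp add: dist_real_def)
    have gtge: "1 / (2 * \<Lambda>) \<le> gx y t"
      using g_ge(2)[OF y xI] x unfolding q[symmetric] by (simp add: field_simps)
    have ln1: "\<bar>ln (gx y t) - ln (gx y 1)\<bar> \<le> L / 4"
    proof -
      have "\<bar>ln (gx y t) - ln (gx y 1)\<bar> \<le> \<bar>gx y t - gx y 1\<bar> / (1 / (2 * \<Lambda>))"
        using \<Lambda>_pos by (intro ln_diff_bound gtge gx_end_ge y) auto
      also have "\<dots> \<le> e / (1 / (2 * \<Lambda>))"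
        using gt \<Lambda>_pos by (intro divide_right_mono) auto
      finally show ?thesis using \<Lambda>_pos by (simp add: e_def)
    qed
    have ln2: "\<bar>ln (g y x) - ln x\<bar> \<le> L / 4"
    proof -
      have "1 - g y x \<le> (1 - x) * (\<Lambda> ^ 3 + 1)"
        unfolding t(3) using gx_bound[OF y tI] x by (intro mult_left_mono) auto
      moreover have "0 < 1 - g y x" using g_in[OF y x] by simp
      ultimately have gd: "\<bar>g y x - x\<bar> \<le> (1 - x) * (\<Lambda> ^ 3 + 2)"
        using x by (simp add: abs_le_iff algebra_simps)
      have hx: "1 / (4 * \<Lambda>) \<le> x / (2 * \<Lambda>)" using x1 \<rho>(3) \<Lambda>_pos by (simp add: field_simps)
      have hx2: "x / (2 * \<Lambda>) \<le> x" using x \<Lambda>_ge_1 by (simp add: field_simps)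
      have "\<bar>ln (g y x) - ln x\<bar> \<le> \<bar>g y x - x\<bar> / (1 / (4 * \<Lambda>))"
        using hx hx2 g_ge(1)[OF y xI] \<Lambda>_pos by (intro ln_diff_bound) auto
      also have "\<dots> \<le> (1 - x) * (\<Lambda> ^ 3 + 2) / (1 / (4 * \<Lambda>))"
        using gd \<Lambda>_pos by (intro divide_right_mono) auto
      also have "\<dots> = A * (1 - x)" by (simp add: A_def)
      also have "\<dots> \<le> A * \<rho>" using A x1 by (intro mult_left_mono) auto
      finally show ?thesis using \<rho>(4) by linarith
    qed
    have "u = ln x - ln (1 - x)" using logit_logistic[of u] by (simp add: x_def logit_def)
    moreover have "ln (gx y t) = ln (1 - g y x) - ln (1 - x)"
      using g_in[OF y x] x unfolding q[symmetric] by (simp add: ln_div)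
    ultimately have "D y u - (- ln (gx y 1)) = (ln (g y x) - ln x) - (ln (gx y t) - ln (gx y 1))"
      unfolding D_def logit_def x_def[symmetric] by linarith
    then show "\<bar>D y u - (- ln (gx y 1))\<bar> \<le> L / 2" using ln1 ln2 by linarith
  qed
qed

lemma D_cont: "continuous_on ({0..<1} \<times> UNIV) (\<lambda>(y, u). D y u)"
proof -
  have ls: "continuous_on UNIV logistic"
    by (rule DERIV_continuous_on) (rule has_field_derivative_at_within[OF logistic_deriv])
  have "continuous_on ({0..<1} \<times> UNIV) ((\<lambda>(y, x). g y x) \<circ> (\<lambda>p. (fst p, logistic (snd p))))"
    by (intro continuous_on_compose continuous_on_subset[OF g_cont] continuous_intros
        continuous_on_compose2[OF ls])
      (auto simp: less_imp_le[OF logistic_pos] less_imp_le[OF logistic_less_1])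
  then have c: "continuous_on ({0..<1} \<times> UNIV) (\<lambda>p. g (fst p) (logistic (snd p)))"
    by (simp add: comp_def)
  have i: "0 < g (fst p) (logistic (snd p))" "g (fst p) (logistic (snd p)) < 1" if "p \<in> {0..<1} \<times> UNIV" for p
    using that by (auto intro!: g_in simp: logistic_pos logistic_less_1)
  have nz: "g (fst p) (logistic (snd p)) \<noteq> 0" "1 - g (fst p) (logistic (snd p)) \<noteq> 0"
    if "p \<in> {0..<1} \<times> UNIV" for p
    using i[OF that] by linarith+
  show ?thesis
    unfolding D_def logit_def case_prod_unfold
    by (intro continuous_on_diff continuous_on_ln c continuous_on_const continuous_on_snd
        continuous_on_id ballI nz)
qed

end

section \<open>Smoothness and the choice of constants\<close>

lemma integral_unit_eq:
  fixes f :: "real \<Rightarrow> real"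
  assumes "continuous_on {0..1} f"
  shows "(\<integral>t. f t \<partial>unit_interval) = integral {0..1} f"
proof -
  have i: "set_integrable lborel {0..<1} f"
    by (rule set_integrable_subset[OF borel_integrable_atLeastAtMost'[OF assms]]) auto
  have "(\<integral>t. f t \<partial>unit_interval) = (LINT t : {0..<1} | lborel. f t)"
    unfolding set_lebesgue_integral_def by (subst integral_restrict_space) auto
  also have "\<dots> = integral {0..<1} f" by (rule set_borel_integral_eq_integral(2)[OF i])
  also have "\<dots> = integral {0..1} f"
    by (rule integral_spike_set; rule negligible_subset[of "{1}"]) auto
  finally show ?thesis .
qed

text \<open>The half-open interval, on which digits are unambiguous, misses only the null point 1;
  Borel null sets pass to Lebesgue measure by completion.\<close>

lemma AE_unit_imp_lebesgue_on:
  assumes "AE y in unit_interval. P y" shows "AE y in lebesgue_on {0..1}. P y"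
proof -
  have "AE y in lborel. y \<in> {0..<1} \<longrightarrow> P y"
    using assms by (subst (asm) AE_restrict_space_iff) auto
  moreover have "AE y in lborel. y \<noteq> (1::real)" by (rule AE_lborel_singleton)
  ultimately have "AE y in lborel. y \<in> {0..1} \<longrightarrow> P y"
    by eventually_elim auto
  then have "AE y in lebesgue. y \<in> {0..1} \<longrightarrow> P y" by (rule AE_completion)
  then show ?thesis by (subst AE_restrict_space_iff) auto
qed

section \<open>Partial derivatives and Lipschitz bounds from smooth extensions\<close>

lemma frechet_derivative_real:
  fixes F :: "real \<Rightarrow> real"
  assumes "F differentiable (at x)"
  shows "(F has_real_derivative frechet_derivative F (at x) 1) (at x)"
proof -
  have d: "(F has_derivative frechet_derivative F (at x)) (at x)"
    using assms by (simp add: frechet_derivative_works)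
  have "frechet_derivative F (at x) = (*) (frechet_derivative F (at x) 1)"
  proof
    fix h show "frechet_derivative F (at x) h = frechet_derivative F (at x) 1 * h"
      using linear_cmul[OF has_derivative_linear[OF d], of h 1] by simp
  qed
  then show ?thesis using d unfolding has_field_derivative_def by metis
qed

lemma has_partial_derivatives:
  fixes F :: "real \<times> real \<Rightarrow> real"
  assumes "F differentiable (at (y, x))"
  shows "((\<lambda>t. F (y, t)) has_real_derivative frechet_derivative F (at (y, x)) (0, 1)) (at x)"
    and "((\<lambda>s. F (s, x)) has_real_derivative frechet_derivative F (at (y, x)) (1, 0)) (at y)"
proof -
  let ?D = "frechet_derivative F (at (y, x))"
  have d: "(F has_derivative ?D) (at (y, x))" using assms by (simp add: frechet_derivative_works)
  note lin = linear_cmul[OF has_derivative_linear[OF d]]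
  have "((\<lambda>t. F (y, t)) has_derivative (\<lambda>h. ?D (0, h))) (at x)"
    by (rule has_derivative_compose[of "\<lambda>t. (y, t)" "\<lambda>h. (0, h)" x UNIV F ?D])
      (use d in \<open>auto intro!: derivative_eq_intros\<close>)
  moreover have "(\<lambda>h. ?D (0, h)) = (*) (?D (0, 1))"
  proof
    fix h show "?D (0, h) = ?D (0, 1) * h" using lin[of h "(0, 1)"] by simp
  qed
  ultimately show "((\<lambda>t. F (y, t)) has_real_derivative ?D (0, 1)) (at x)"
    by (simp add: has_field_derivative_def)
  have "((\<lambda>s. F (s, x)) has_derivative (\<lambda>h. ?D (h, 0))) (at y)"
    by (rule has_derivative_compose[of "\<lambda>s. (s, x)" "\<lambda>h. (h, 0)" y UNIV F ?D])
      (use d in \<open>auto intro!: derivative_eq_intros\<close>)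
  moreover have "(\<lambda>h. ?D (h, 0)) = (*) (?D (1, 0))"
  proof
    fix h show "?D (h, 0) = ?D (1, 0) * h" using lin[of h "(1, 0)"] by simp
  qed
  ultimately show "((\<lambda>s. F (s, x)) has_real_derivative ?D (1, 0)) (at y)"
    by (simp add: has_field_derivative_def)
qed

lemma continuous_compact_bound:
  fixes f :: "'a::topological_space \<Rightarrow> real"
  assumes "continuous_on S f" "compact S"
  shows "\<exists>b\<ge>0. \<forall>x\<in>S. \<bar>f x\<bar> \<le> b"
proof -
  obtain b where "\<forall>x\<in>f ` S. norm x \<le> b"
    using compact_imp_bounded[OF compact_continuous_image[OF assms]] unfolding bounded_iff by blast
  then show ?thesis by (intro exI[of _ "\<bar>b\<bar>"]) force
qed

lemma smooth_on_interval_Lipschitz: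
  fixes f :: "real \<Rightarrow> real"
  assumes "smooth_on {0..1} f"
  shows "continuous_on {0..1} f" "\<exists>L\<ge>0. \<forall>y\<in>{0..1}. \<forall>z\<in>{0..1}. \<bar>f y - f z\<bar> \<le> L * \<bar>y - z\<bar>"
proof -
  obtain U F where U: "open U" "{0..1} \<subseteq> U" and Ck: "\<And>k. Ck_on k F U" and F: "\<And>x. x \<in> {0..1} \<Longrightarrow> F x = f x"
    using assms unfolding smooth_on_def by blast
  have "continuous_on {0..1} F" using Ck[of 0] U(2) by (auto intro: continuous_on_subset)
  then show "continuous_on {0..1} f" by (rule continuous_on_eq) (use F in blast)
  have d: "F differentiable (at x)" if "x \<in> {0..1}" for x using Ck[of 1] U(2) that by auto
  have "continuous_on U (\<lambda>x. frechet_derivative F (at x) 1)" using Ck[of 1] by simp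
  then have "continuous_on {0..1} (\<lambda>x. frechet_derivative F (at x) 1)"
    using U(2) by (rule continuous_on_subset)
  then obtain L where L: "0 \<le> L" "\<And>x. x \<in> {0..1} \<Longrightarrow> \<bar>frechet_derivative F (at x) 1\<bar> \<le> L"
    using continuous_compact_bound[of "{0..1}"] by (metis compact_Icc)
  have "norm (F y - F z) \<le> L * norm (y - z)" if "y \<in> {0..1}" "z \<in> {0..1}" for y z
    by (rule field_differentiable_bound[of "{0..1}" _ "\<lambda>x. frechet_derivative F (at x) 1"])
      (use that L(2) in \<open>auto intro!: has_field_derivative_at_within[OF frechet_derivative_real] d\<close>)
  then show "\<exists>L\<ge>0. \<forall>y\<in>{0..1}. \<forall>z\<in>{0..1}. \<bar>f y - f z\<bar> \<le> L * \<bar>y - z\<bar>"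
    using L(1) F by (intro exI[of _ L]) auto
qed

text \<open>\<open>K\<close> bounds the mixed second derivative of an extension on the compact
  square. It is finite for each map and becomes the constant \<open>C2\<close>.\<close>

lemma smooth_on_square_partial:
  fixes f :: "real \<Rightarrow> real \<Rightarrow> real"
  assumes "smooth_on ({0..1} \<times> {0..1}) (\<lambda>(y, x). f y x)"
  shows "continuous_on ({0..1} \<times> {0..1}) (\<lambda>(y, x). f y x)"
    "\<exists>fx K. 0 \<le> K \<and> continuous_on ({0..1} \<times> {0..1}) (\<lambda>(y, x). fx y x) \<and>
      (\<forall>y\<in>{0..1}. \<forall>x\<in>{0..1}. (f y has_real_derivative fx y x) (at x within {0..1})) \<and>
      (\<forall>y\<in>{0..1}. \<forall>z\<in>{0..1}. \<forall>x\<in>{0..1}. \<bar>fx y x - fx z x\<bar> \<le> K * \<bar>y - z\<bar>)"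
proof -
  let ?S = "{0..1} \<times> {0..1} :: (real \<times> real) set"
  obtain U F where U: "open U" "?S \<subseteq> U" and Ck: "\<And>k. Ck_on k F U"
    and F: "\<And>p. p \<in> ?S \<Longrightarrow> F p = (\<lambda>(y, x). f y x) p"
    using assms unfolding smooth_on_def by blast
  have "continuous_on ?S F" using Ck[of 0] U(2) by (auto intro: continuous_on_subset)
  then show "continuous_on ?S (\<lambda>(y, x). f y x)"
    by (rule continuous_on_eq) (use F in blast)
  define G where "G p = frechet_derivative F (at p) (0, 1)" for p
  have Gk: "Ck_on k G U" for k using Ck[of "Suc k"] by (simp add: G_def[abs_def])
  have Gc: "continuous_on ?S G" using Gk[of 0] U(2) by (auto intro: continuous_on_subset)
  have "continuous_on U (\<lambda>p. frechet_derivative G (at p) (1, 0))" using Gk[of 1] by simp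
  then have "continuous_on ?S (\<lambda>p. frechet_derivative G (at p) (1, 0))"
    using U(2) by (rule continuous_on_subset)
  then obtain K where K: "0 \<le> K" "\<And>p. p \<in> ?S \<Longrightarrow> \<bar>frechet_derivative G (at p) (1, 0)\<bar> \<le> K"
    using continuous_compact_bound[of ?S] by (metis compact_Icc compact_Times)
  have dF: "F differentiable (at p)" and dG: "G differentiable (at p)" if "p \<in> ?S" for p
    using Ck[of 1] Gk[of 1] U(2) that by auto
  define fx where "fx y x = G (y, x)" for y x
  have "(f y has_real_derivative fx y x) (at x within {0..1})" if y: "y \<in> {0..1}" and x: "x \<in> {0..1}" for y x
  proof (rule has_field_derivative_transform_within[OF _ zero_less_one x])
    show "((\<lambda>t. F (y, t)) has_real_derivative fx y x) (at x within {0..1})"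
      unfolding fx_def G_def using y x
      by (intro has_field_derivative_at_within[OF has_partial_derivatives(1)] dF) simp
    show "F (y, t) = f y t" if "t \<in> {0..1}" for t using F[of "(y, t)"] y that by simp
  qed
  moreover have "\<bar>fx y x - fx z x\<bar> \<le> K * \<bar>y - z\<bar>"
    if y: "y \<in> {0..1}" and z: "z \<in> {0..1}" and x: "x \<in> {0..1}" for y z x
  proof -
    have "norm (G (y, x) - G (z, x)) \<le> K * norm (y - z)"
    proof (rule field_differentiable_bound[of "{0..1}" "\<lambda>s. G (s, x)"
          "\<lambda>s. frechet_derivative G (at (s, x)) (1, 0)"])
      fix s :: real assume s: "s \<in> {0..1}"
      show "((\<lambda>s. G (s, x)) has_real_derivative frechet_derivative G (at (s, x)) (1, 0)) (at s within {0..1})"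
        using s x by (intro has_field_derivative_at_within[OF has_partial_derivatives(2)] dG) simp
      show "norm (frechet_derivative G (at (s, x)) (1, 0)) \<le> K" using K(2)[of "(s, x)"] s x by simp
    qed (use y z in auto)
    then show ?thesis by (simp add: fx_def)
  qed
  moreover have "continuous_on ?S (\<lambda>(y, x). fx y x)"
    using Gc by (simp add: fx_def case_prod_unfold)
  ultimately show "\<exists>fx K. 0 \<le> K \<and> continuous_on ?S (\<lambda>(y, x). fx y x) \<and>
      (\<forall>y\<in>{0..1}. \<forall>x\<in>{0..1}. (f y has_real_derivative fx y x) (at x within {0..1})) \<and>
      (\<forall>y\<in>{0..1}. \<forall>z\<in>{0..1}. \<forall>x\<in>{0..1}. \<bar>fx y x - fx z x\<bar> \<le> K * \<bar>y - z\<bar>)"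
    using K(1) by blast
qed

lemma vector_derivative_eq_real_derivative:
  fixes f :: "real \<Rightarrow> real"
  assumes "(f has_real_derivative d) (at x within {0..1})" "x \<in> {0..1}"
  shows "vector_derivative f (at x within {0..1}) = d"
  by (rule vector_derivative_within_closed_interval)
    (use assms in \<open>auto simp: has_real_derivative_iff_has_vector_derivative\<close>)

context fiber_family
begin

text \<open>\<open>4 * X + 2\<close> can serve as \<open>M\<close>: increments are at most
  \<open>X + 1\<close> in absolute value, and \<open>ln (gx y 1)\<close> lies between
  \<open>- (X + 1)\<close> and \<open>3 * X + 1\<close>. On the branch \<open>a\<close> the
  perturbation, at most \<open>c1\<close>, takes back at most half of the push
  \<open>- 2 * c1\<close>.\<close>

lemma driven_walk:
  assumes m: "m \<ge> 2" and \<kappa>: "0 < \<kappa>" "28 * (2 * \<kappa>)\<^sup>2 \<le> \<sigma>2"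
    and large: "L\<xi> + Lu * \<kappa> \<le> \<kappa> * sqrt m" "(1 + Lu) * exp ((4 * X + 2) / 2) \<le> sqrt m"
    and \<xi>0: "integral {0..1} \<xi> = 0" and \<sigma>2: "integral {0..1} (\<lambda>y. (\<xi> y)\<^sup>2) = \<sigma>2" "0 < \<sigma>2"
    and c1: "0 < c1" "4 * \<Lambda> * r0 \<le> c1"
    and a: "a < m" "\<And>t. t \<in> {0..<1} \<Longrightarrow> \<xi> (branch m a t) \<le> - 2 * c1"
    and L: "0 < integral {0..1} (\<lambda>y. ln (gx y 1))"
  shows "\<exists>K1. driven_walk m D \<xi> (\<lambda>y. - ln (gx y 1)) (4 * X + 2) \<kappa> B c0 Lu L\<xi> \<sigma>2 c1 K1
    (integral {0..1} (\<lambda>y. ln (gx y 1))) a"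
proof -
  define \<zeta> where "\<zeta> y = - ln (gx y 1)" for y
  let ?L = "integral {0..1} (\<lambda>y. ln (gx y 1))"
  interpret expansion m by standard (rule m)
  obtain K1 where K1: "\<And>y u. y \<in> {0..1} \<Longrightarrow> K1 \<le> u \<Longrightarrow> \<bar>D y u - \<zeta> y\<bar> \<le> ?L / 2"
    using D_right[OF L] unfolding \<zeta>_def by blast
  have \<xi>c: "continuous_on {0..1} \<xi>"
  proof (rule continuous_on_iff[THEN iffD2], intro ballI allI impI)
    fix y e :: real assume y: "y \<in> {0..1}" and e: "0 < e"
    show "\<exists>d>0. \<forall>z\<in>{0..1}. dist z y < d \<longrightarrow> dist (\<xi> z) (\<xi> y) < e"
    proof (intro exI[of _ "e / (L\<xi> + 1)"] conjI ballI impI)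
      show "0 < e / (L\<xi> + 1)" using e nonneg by simp
      fix z assume z: "z \<in> {0..1}" and "dist z y < e / (L\<xi> + 1)"
      then have "(L\<xi> + 1) * \<bar>z - y\<bar> < e" using nonneg by (simp add: dist_real_def field_simps)
      then show "dist (\<xi> z) (\<xi> y) < e"
        using \<xi>_Lipschitz[OF z y] by (simp add: dist_real_def distrib_right)
    qed
  qed
  have gx1: "continuous_on {0..1} (\<lambda>y. gx y 1)"
  proof -
    have "continuous_on {0..1} ((\<lambda>(y, x). gx y x) \<circ> (\<lambda>y. (y, 1)))"
      by (intro continuous_on_compose continuous_on_subset[OF gx_cont] continuous_intros) auto
    then show ?thesis by (simp add: comp_def)
  qed
  have gxpos: "0 < gx y 1" if "y \<in> {0..1}" for y
    using gx_end_ge[OF that] \<Lambda>_pos by (meson less_le_trans zero_less_divide_1_iff zero_less_mult_iff zero_less_numeral)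
  then have \<zeta>c: "continuous_on {0..1} \<zeta>"
    unfolding \<zeta>_def by (intro continuous_intros gx1) (metis less_irrefl)
  have \<zeta>b: "\<bar>\<zeta> y\<bar> \<le> 4 * X + 2" if y: "y \<in> {0..1}" for y
  proof -
    have e1: "2 \<le> exp (1::real)" using exp_ge_add_one_self[of 1] by simp
    have up: "gx y 1 \<le> exp (3 * X + 1)"
    proof -
      have "\<Lambda> ^ 3 = exp (3 * X)" by (simp add: \<Lambda>_def exp_of_nat_mult[symmetric])
      moreover have "1 \<le> exp (3 * X)" using nonneg by simp
      moreover have "exp (3 * X) * 2 \<le> exp (3 * X) * exp 1" using e1 by (intro mult_left_mono) auto
      ultimately show ?thesis using gx_bound[OF y, of 1, simplified] unfolding exp_add by linarith
    qed
    have lo: "exp (- (X + 1)) \<le> gx y 1"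
    proof -
      have "\<Lambda> * 2 \<le> \<Lambda> * exp 1" using e1 \<Lambda>_pos by (intro mult_left_mono) auto
      then have "1 / (\<Lambda> * exp 1) \<le> 1 / (2 * \<Lambda>)" using \<Lambda>_pos by (intro divide_left_mono) auto
      moreover have "exp (- (X + 1)) = 1 / (\<Lambda> * exp 1)"
        by (simp only: \<Lambda>_def exp_minus exp_add inverse_eq_divide)
      ultimately show ?thesis using gx_end_ge[OF y] by linarith
    qed
    have "ln (gx y 1) \<le> ln (exp (3 * X + 1))"
      using up gxpos[OF y] by (subst ln_le_cancel_iff) auto
    then have "ln (gx y 1) \<le> 3 * X + 1" by simp
    moreover have "- (X + 1) \<le> ln (gx y 1)" using lo gxpos[OF y] by (simp add: ln_ge_iff)
    ultimately show ?thesis using nonneg(1) by (simp add: \<zeta>_def abs_le_iff)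
  qed
  have Db: "\<bar>D y u\<bar> \<le> 4 * X + 2" if y: "y \<in> {0..1}" for y u
    using D_near(1)[OF y, of u] \<xi>_bound[OF y] r0_\<Lambda>(1) nonneg(1) by linarith
  have I: "y \<in> {0..1}" if "y \<in> {0..<1}" for y :: real using that by simp
  have "driven_walk m D \<xi> \<zeta> (4 * X + 2) \<kappa> B c0 Lu L\<xi> \<sigma>2 c1 K1 ?L a"
  proof
    show "0 < 4 * X + 2" "0 < \<kappa>" "0 \<le> B" "0 < c0" "0 \<le> Lu" "0 \<le> L\<xi>" "0 < \<sigma>2" "0 < c1" "0 < ?L"
      using nonneg consts_nonneg \<kappa> \<sigma>2 c1 L by auto
    show "continuous_on ({0..<1} \<times> UNIV) (\<lambda>(y, u). D y u)" by (rule D_cont)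
    show "(\<integral>y. \<xi> y \<partial>unit_interval) = 0" using integral_unit_eq[OF \<xi>c] \<xi>0 by simp
    show "(\<integral>y. (\<xi> y)\<^sup>2 \<partial>unit_interval) = \<sigma>2"
      using integral_unit_eq[of "\<lambda>y. (\<xi> y)\<^sup>2"] \<xi>c \<sigma>2 by (simp add: continuous_on_power)
    show "(\<integral>y. \<zeta> y \<partial>unit_interval) = - ?L"
      unfolding integral_unit_eq[OF \<zeta>c] unfolding \<zeta>_def by (rule integral_neg)
    show "continuous_on {0..<1} \<xi>" "continuous_on {0..<1} \<zeta>"
      by (rule continuous_on_subset[OF \<xi>c], force) (rule continuous_on_subset[OF \<zeta>c], force)
    show "D (branch m a t) u \<le> - c1" if t: "t \<in> {0..<1}" for t u
      using D_near(1)[OF I[OF branch_in[OF a(1) t]], of u] a(2)[OF t] c1(2) by linarith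
    fix y u v z :: real assume y: "y \<in> {0..<1}"
    show "\<bar>D y u\<bar> \<le> 4 * X + 2" by (rule Db[OF I[OF y]])
    show "\<bar>D y u - \<xi> y\<bar> \<le> c0 * exp u" by (rule D_near(2)[OF I[OF y]])
    show "\<bar>(u + D y u) - (v + D y v)\<bar> \<le> Lu * \<bar>u - v\<bar>" by (rule step_Lipschitz[OF I[OF y]])
    show "\<bar>\<xi> y\<bar> \<le> 4 * X + 2" using \<xi>_bound[OF I[OF y]] nonneg(1) by simp
    show "\<bar>\<zeta> y\<bar> \<le> 4 * X + 2" by (rule \<zeta>b[OF I[OF y]])
    show "\<bar>D y u - D z u\<bar> \<le> L\<xi> * \<bar>y - z\<bar> + B * weight u * sqrt \<bar>y - z\<bar>" if "z \<in> {0..<1}"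
      by (rule D_holder[OF I[OF y] I[OF that]])
    show "\<bar>D y u - \<zeta> y\<bar> \<le> ?L / 2" if "K1 \<le> u" by (rule K1[OF I[OF y] that])
  qed (use m \<kappa> large a in auto)
  then show ?thesis unfolding \<zeta>_def by blast
qed

end

text \<open>A branch has length \<open>1 / m\<close>, over which \<xi> varies by at most
  \<open>L / m\<close>, hence by at most \<open>e\<close>.\<close>

lemma negative_branch:
  fixes \<xi> :: "real \<Rightarrow> real"
  assumes L: "\<And>y z. y \<in> {0..1} \<Longrightarrow> z \<in> {0..1} \<Longrightarrow> \<bar>\<xi> y - \<xi> z\<bar> \<le> L * \<bar>y - z\<bar>" "0 \<le> L"
    and y: "y \<in> {0..1}" and m: "m \<ge> 2" "L \<le> e * real m"
  shows "\<exists>a<m. \<forall>t\<in>{0..<1}. \<xi> (branch m a t) \<le> \<xi> y + e"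
proof -
  interpret expansion m by standard (rule m)
  \<comment> \<open>For \<open>y = 1\<close> the value of \<open>digit m y\<close> is
    \<open>m\<close>, which names no branch; the last branch takes its place.\<close>
  define a where "a = min (digit m y) (m - 1)"
  have am: "a < m" using m by (simp add: a_def)
  have fl: "real (digit m y) \<le> real m * y" "real m * y < real (digit m y) + 1"
    using y by (auto simp: digit_def)
  have ay: "real a \<le> real m * y" "real m * y \<le> real a + 1"
  proof -
    have "real a \<le> real (digit m y)" by (simp add: a_def)
    then show "real a \<le> real m * y" using fl(1) by linarith
    show "real m * y \<le> real a + 1"
    proof (cases "digit m y \<le> m - 1")
      case True
      then show ?thesis using fl(2) by (simp add: a_def min_absorb1)
    next
      case False
      then have "real a + 1 = real m" using m by (simp add: a_def min_absorb2 of_nat_diff)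
      then show ?thesis using y by simp
    qed
  qed
  have "\<xi> (branch m a t) \<le> \<xi> y + e" if t: "t \<in> {0..<1}" for t
  proof -
    have b: "branch m a t \<in> {0..1}" using branch_in[OF am t] by simp
    have "branch m a t - y = (real a + t - real m * y) / real m" by (simp add: branch_def field_simps)
    moreover have "\<bar>real a + t - real m * y\<bar> \<le> 1" using ay t by (simp add: abs_le_iff)
    ultimately have "\<bar>branch m a t - y\<bar> \<le> 1 / real m"
      by (simp add: abs_divide divide_right_mono)
    then have "L * \<bar>branch m a t - y\<bar> \<le> L * (1 / real m)" using L(2) by (intro mult_left_mono)
    also have "\<dots> \<le> e" using m by (simp add: divide_le_eq)
    finally show ?thesis using L(1)[OF b y] by linarith
  qed
  then show ?thesis using am by blast
qed

theorem theorem1p4: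
  fixes \<xi> :: "real \<Rightarrow> real" and C :: real
  assumes "smooth_on {0..1} \<xi>"
    and "\<exists>y\<in>{0..1}. \<xi> y \<noteq> 0"
    and "integral {0..1} \<xi> = 0"
    and "C > 0"
  shows "\<exists>m0\<ge>2. \<forall>m\<ge>m0. \<exists>rbar>0. \<forall>r0. 0 < r0 \<and> r0 \<le> rbar \<longrightarrow>
    (\<forall>G \<in> skew_products \<xi> C m r0.
       fiber_lyapunov G 0 = 0 \<and> fiber_lyapunov G 1 > 0 \<longrightarrow>
       (\<exists>\<epsilon>0>0. \<forall>\<epsilon>. 0 < \<epsilon> \<and> \<epsilon> < \<epsilon>0 \<longrightarrow>
          (\<forall>x. 0 < x \<and> x < 1 \<longrightarrow>
             (AE y in lebesgue_on {0..1}.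
                infinite {i. fiber_iterate m G i y x \<in> {\<epsilon>..1}} \<and>
                (\<lambda>n. (\<Sum>i<n. indicator {\<epsilon>..1} (fiber_iterate m G i y x)) / real n)
                  \<longlonglongrightarrow> 0))))"
proof -
  note \<xi>c = smooth_on_interval_Lipschitz(1)[OF assms(1)]
  obtain L\<xi> where L\<xi>: "0 \<le> L\<xi>" "\<And>y z. y \<in> {0..1} \<Longrightarrow> z \<in> {0..1} \<Longrightarrow> \<bar>\<xi> y - \<xi> z\<bar> \<le> L\<xi> * \<bar>y - z\<bar>"
    using smooth_on_interval_Lipschitz(2)[OF assms(1)] by blast
  obtain X where X: "0 \<le> X" "\<And>y. y \<in> {0..1} \<Longrightarrow> \<bar>\<xi> y\<bar> \<le> X"
    using continuous_compact_bound[OF \<xi>c] by auto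
  define \<sigma>2 where "\<sigma>2 = integral {0..1} (\<lambda>y. (\<xi> y)\<^sup>2)"
  have sqc: "continuous_on {0..1} (\<lambda>y. (\<xi> y)\<^sup>2)" by (intro continuous_intros \<xi>c)
  have \<sigma>2: "0 < \<sigma>2"
  proof -
    have "0 \<le> \<sigma>2"
      unfolding \<sigma>2_def by (intro integral_nonneg integrable_continuous_real sqc) simp
    moreover have "\<sigma>2 \<noteq> 0"
      using integral_eq_0_iff[OF sqc] assms(2) unfolding \<sigma>2_def by auto
    ultimately show ?thesis by simp
  qed
  obtain y1 where y1: "y1 \<in> {0..1}" "\<xi> y1 < 0"
  proof (rule ccontr)
    assume "\<not> thesis"
    then have "0 \<le> \<xi> y" if "y \<in> {0..1}" for y using that \<open>\<And>y1. y1 \<in> {0..1} \<Longrightarrow> \<xi> y1 < 0 \<Longrightarrow> thesis\<close> by force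
    then show False using integral_eq_0_iff[OF \<xi>c] assms(2,3) by auto
  qed
  \<comment> \<open>\<xi> equals \<open>- 4 * c1\<close> at \<open>y1\<close>. Its variation on a
    branch may cost \<open>2 * c1\<close> and the perturbation \<open>c1\<close>, which leaves a
    push of \<open>c1\<close> to the left.\<close>
  define c1 where "c1 = - \<xi> y1 / 4"
  have c1: "0 < c1" using y1 by (simp add: c1_def)
  \<comment> \<open>The largest value compatible with \<open>\<kappa>_small\<close>:
    \<open>28 * (2 * \<kappa>)\<^sup>2\<close> equals \<open>\<sigma>2\<close>.\<close>
  define \<kappa> where "\<kappa> = sqrt (\<sigma>2 / 112)"
  have \<kappa>: "0 < \<kappa>" "28 * (2 * \<kappa>)\<^sup>2 \<le> \<sigma>2" using \<sigma>2 by (auto simp: \<kappa>_def power_mult_distrib)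
  \<comment> \<open>Outside its locale the constant takes only \<open>X\<close> as an argument, so
    it is available before a map is given.\<close>
  define Lu where "Lu = fiber_family.Lu X"
  define W where "W = max ((L\<xi> + Lu * \<kappa>) / \<kappa>) ((1 + Lu) * exp ((4 * X + 2) / 2))"
  obtain m0 :: nat where m0: "W\<^sup>2 + L\<xi> / (2 * c1) + 2 \<le> real m0" using real_arch_simple by blast
  have m0': "2 \<le> m0" "W\<^sup>2 \<le> real m0" "L\<xi> / (2 * c1) \<le> real m0"
  proof -
    have "0 \<le> W\<^sup>2" "0 \<le> L\<xi> / (2 * c1)" using L\<xi> c1 by auto
    then show "2 \<le> m0" "W\<^sup>2 \<le> real m0" "L\<xi> / (2 * c1) \<le> real m0" using m0 by linarith+
  qed
  \<comment> \<open>The inner minimum bounds the perturbation of the increment, which is at most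
    \<open>4 * exp X * r0\<close>, by 1 and by \<open>c1\<close>. The same value works for every
    \<open>m\<close>.\<close>
  define rbar where "rbar = min 1 (min 1 c1 / (4 * exp X))"
  have rbar: "0 < rbar" using c1 by (simp add: rbar_def)
  show ?thesis
  proof (intro exI[of _ m0] conjI allI impI ballI)
    show "2 \<le> m0" by (rule m0')
    fix m assume m: "m0 \<le> m"
    then have m2: "2 \<le> m" and mr: "real m0 \<le> real m" using m0' by auto
    have W: "W \<le> sqrt m" using m0'(2) mr by (intro real_le_rsqrt) linarith
    then have large: "L\<xi> + Lu * \<kappa> \<le> \<kappa> * sqrt m" "(1 + Lu) * exp ((4 * X + 2) / 2) \<le> sqrt m"
      using \<kappa>(1) by (auto simp: W_def divide_le_eq mult.commute)
    have "L\<xi> / (2 * c1) \<le> real m" using m0'(3) mr by linarith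
    then have "L\<xi> \<le> 2 * c1 * real m" using c1 by (simp add: pos_divide_le_eq mult.commute)
    from negative_branch[OF L\<xi>(2,1) y1(1) m2 this]
    obtain a where a: "a < m" "\<And>t. t \<in> {0..<1} \<Longrightarrow> \<xi> (branch m a t) \<le> - 2 * c1"
      by (auto simp: c1_def)
    show "\<exists>rbar>0. \<forall>r0. 0 < r0 \<and> r0 \<le> rbar \<longrightarrow>
      (\<forall>G \<in> skew_products \<xi> C m r0.
       fiber_lyapunov G 0 = 0 \<and> fiber_lyapunov G 1 > 0 \<longrightarrow>
       (\<exists>\<epsilon>0>0. \<forall>\<epsilon>. 0 < \<epsilon> \<and> \<epsilon> < \<epsilon>0 \<longrightarrow>
          (\<forall>x. 0 < x \<and> x < 1 \<longrightarrow>
             (AE y in lebesgue_on {0..1}.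
                infinite {i. fiber_iterate m G i y x \<in> {\<epsilon>..1}} \<and>
                (\<lambda>n. (\<Sum>i<n. indicator {\<epsilon>..1} (fiber_iterate m G i y x)) / real n)
                  \<longlonglongrightarrow> 0))))"
    proof (rule exI[of _ rbar], rule conjI[OF rbar], intro allI impI ballI)
      fix r0 G
      assume r0: "0 < r0 \<and> r0 \<le> rbar" and G: "G \<in> skew_products \<xi> C m r0"
        and lyap: "fiber_lyapunov G 0 = 0 \<and> fiber_lyapunov G 1 > 0"
      have r0': "r0 \<le> 1" "4 * exp X * r0 \<le> 1" "4 * exp X * r0 \<le> c1"
      proof -
        show "r0 \<le> 1" using r0 by (simp add: rbar_def)
        have "4 * exp X * r0 \<le> 4 * exp X * (min 1 c1 / (4 * exp X))"
          using r0 by (intro mult_left_mono) (auto simp: rbar_def)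
        then have "4 * exp X * r0 \<le> min 1 c1" by simp
        then show "4 * exp X * r0 \<le> 1" "4 * exp X * r0 \<le> c1" by auto
      qed
      have sm: "smooth_on ({0..1} \<times> {0..1}) (\<lambda>(y, x). fiber_map G y x)"
        and rem: "\<And>y x. y \<in> {0..1} \<Longrightarrow> x \<in> {0..1} \<Longrightarrow> \<bar>remainder \<xi> G y x\<bar> \<le> C * x\<^sup>2 \<and>
          \<bar>remainder \<xi> G y x\<bar> \<le> C * \<bar>1 - x\<bar> \<and>
          \<bar>vector_derivative (\<lambda>t. remainder \<xi> G y t) (at x within {0..1})\<bar> \<le> r0"
        using G unfolding skew_products_def by blast+
      note gc = smooth_on_square_partial(1)[OF sm]
      obtain gx K where K: "0 \<le> K" and gxc: "continuous_on ({0..1} \<times> {0..1}) (\<lambda>(y, x). gx y x)"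
        and gd: "\<And>y x. y \<in> {0..1} \<Longrightarrow> x \<in> {0..1} \<Longrightarrow>
          (fiber_map G y has_real_derivative gx y x) (at x within {0..1})"
        and gL: "\<And>y z x. y \<in> {0..1} \<Longrightarrow> z \<in> {0..1} \<Longrightarrow> x \<in> {0..1} \<Longrightarrow>
          \<bar>gx y x - gx z x\<bar> \<le> K * \<bar>y - z\<bar>"
        using smooth_on_square_partial(2)[OF sm] by (elim exE conjE) blast
      have rxb: "\<bar>gx y x - exp (\<xi> y) / (1 + (exp (\<xi> y) - 1) * x)\<^sup>2\<bar> \<le> r0"
        if y: "y \<in> {0..1}" and x: "x \<in> {0..1}" for y x
      proof -
        have "1 + (exp (\<xi> y) - 1) * x \<noteq> 0"
        proof -
          have "0 < (1 - x) + exp (\<xi> y) * x"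
            using x by (cases "x = 0") (auto intro: add_nonneg_pos)
          then show ?thesis by (simp add: algebra_simps)
        qed
        then have "((\<lambda>t. exp (\<xi> y) * t / (1 + (exp (\<xi> y) - 1) * t)) has_real_derivative
            exp (\<xi> y) / (1 + (exp (\<xi> y) - 1) * x)\<^sup>2) (at x within {0..1})"
          by (auto intro!: derivative_eq_intros simp: divide_simps power2_eq_square)
            (simp add: algebra_simps)
        from DERIV_diff[OF gd[OF y x] this]
        have "vector_derivative (\<lambda>t. remainder \<xi> G y t) (at x within {0..1})
            = gx y x - exp (\<xi> y) / (1 + (exp (\<xi> y) - 1) * x)\<^sup>2"
          unfolding remainder_def by (rule vector_derivative_eq_real_derivative[OF _ x])
        then show ?thesis using rem[OF y x] by simp
      qed
      interpret F: fiber_family "fiber_map G" gx \<xi> X C r0 K L\<xi>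
      proof
        show "0 \<le> X" "0 < C" "0 < r0" "0 \<le> K" "0 \<le> L\<xi>" using X assms(4) r0 K L\<xi> by auto
        fix y z x :: real assume y: "y \<in> {0..1}"
        show "\<bar>\<xi> y\<bar> \<le> X" by (rule X(2)[OF y])
        show "\<bar>\<xi> y - \<xi> z\<bar> \<le> L\<xi> * \<bar>y - z\<bar>" if "z \<in> {0..1}" by (rule L\<xi>(2)[OF y that])
        assume x: "x \<in> {0..1}"
        show "(fiber_map G y has_real_derivative gx y x) (at x within {0..1})" by (rule gd[OF y x])
        show "\<bar>fiber_map G y x - exp (\<xi> y) * x / (1 + (exp (\<xi> y) - 1) * x)\<bar> \<le> C * x\<^sup>2"
          "\<bar>fiber_map G y x - exp (\<xi> y) * x / (1 + (exp (\<xi> y) - 1) * x)\<bar> \<le> C * \<bar>1 - x\<bar>"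
          using rem[OF y x] by (simp_all add: remainder_def)
        show "\<bar>gx y x - exp (\<xi> y) / (1 + (exp (\<xi> y) - 1) * x)\<^sup>2\<bar> \<le> r0" by (rule rxb[OF y x])
      qed (use r0' gc gxc gL in auto)
      have L1: "integral {0..1} (\<lambda>y. ln (gx y 1)) = fiber_lyapunov G 1"
        unfolding fiber_lyapunov_def
        by (rule Henstock_Kurzweil_Integration.integral_cong)
          (simp add: vector_derivative_eq_real_derivative[OF gd])
      have "\<exists>K1. driven_walk m F.D \<xi> (\<lambda>y. - ln (gx y 1)) (4 * X + 2) \<kappa> F.B F.c0 F.Lu L\<xi> \<sigma>2 c1 K1
          (integral {0..1} (\<lambda>y. ln (gx y 1))) a"
        by (rule F.driven_walk)
          (use m2 \<kappa> large assms(3) \<sigma>2 c1 r0' a lyap in \<open>auto simp: \<sigma>2_def Lu_def F.\<Lambda>_def L1\<close>)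
      then obtain K1 where "driven_walk m F.D \<xi> (\<lambda>y. - ln (gx y 1)) (4 * X + 2) \<kappa> F.B F.c0 F.Lu L\<xi>
          \<sigma>2 c1 K1 (integral {0..1} (\<lambda>y. ln (gx y 1))) a" ..
      then interpret W: driven_walk m F.D \<xi> "\<lambda>y. - ln (gx y 1)" "4 * X + 2" \<kappa> F.B F.c0 F.Lu L\<xi> \<sigma>2 c1
        K1 "integral {0..1} (\<lambda>y. ln (gx y 1))" a .
      have iter: "0 < fiber_iterate m G i y x \<and> fiber_iterate m G i y x < 1 \<and>
          logit (fiber_iterate m G i y x) = W.walk i (logit x) y"
        if y: "y \<in> {0..<1}" and x: "0 < x" "x < 1" for i y x
      proof (induction i)
        case 0
        then show ?case using x by simp
      next
        case (Suc i)
        let ?z = "fiber_iterate m G i y x" and ?y = "(expanding_map m ^^ i) y"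
        have yi: "?y \<in> {0..1}" using W.E_iterate_in[OF y, of i] by simp
        have z: "0 < ?z" "?z < 1" "W.walk i (logit x) y = logit ?z" using Suc by simp_all
        have "W.walk (Suc i) (logit x) y = logit (fiber_map G ?y ?z)"
          using z by (simp add: F.D_def)
        then show ?case using F.g_in[OF yi z(1,2)] by simp
      qed
      obtain K where K: "W.left_level K" using W.left_level_exists by blast
      show "\<exists>\<epsilon>0>0. \<forall>\<epsilon>. 0 < \<epsilon> \<and> \<epsilon> < \<epsilon>0 \<longrightarrow>
          (\<forall>x. 0 < x \<and> x < 1 \<longrightarrow>
             (AE y in lebesgue_on {0..1}.
                infinite {i. fiber_iterate m G i y x \<in> {\<epsilon>..1}} \<and>
                (\<lambda>n. (\<Sum>i<n. indicator {\<epsilon>..1} (fiber_iterate m G i y x)) / real n)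
                  \<longlonglongrightarrow> 0))"
      \<comment> \<open>The frequency statement holds at every level; recurrence is known for
        \<open>K\<close>, hence for all lower levels. \<open>K\<close> does not depend on
        \<open>x\<close>, so one threshold serves all starting points.\<close>
      proof (rule exI[of _ "logistic K"], rule conjI[OF logistic_pos], intro allI impI)
        fix \<epsilon> x :: real assume \<epsilon>: "0 < \<epsilon> \<and> \<epsilon> < logistic K" and x: "0 < x \<and> x < 1"
        have \<epsilon>1: "0 < \<epsilon>" "\<epsilon> < 1" using \<epsilon> logistic_less_1[of K] by linarith+
        have \<epsilon>K: "logit \<epsilon> \<le> K"
          using logit_le_iff[OF \<epsilon>1 logistic_pos[of K] logistic_less_1] \<epsilon> by simp
        \<comment> \<open>A fixed starting point is the constant curve with value
          \<open>logit x\<close>.\<close>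
        have "AE y in unit_interval. infinite {i. K \<le> W.walk i (logit x) y}"
          by (rule W.infinitely_many_visits[OF K W.const_Adm])
        moreover have "AE y in unit_interval. (\<lambda>n. (\<Sum>i<n. indicator {logit \<epsilon>..} (W.walk i (logit x) y))
            / real n) \<longlonglongrightarrow> (0::real)"
          by (rule W.zero_frequency[OF W.const_Adm])
        ultimately have "AE y in unit_interval.
                infinite {i. fiber_iterate m G i y x \<in> {\<epsilon>..1}} \<and>
                (\<lambda>n. (\<Sum>i<n. indicator {\<epsilon>..1} (fiber_iterate m G i y x)) / real n)
                  \<longlonglongrightarrow> (0::real)"
          using AE_space[of unit_interval]
        proof eventually_elim
          case (elim y)
          then have y: "y \<in> {0..<1}" by simp
          have mem: "fiber_iterate m G i y x \<in> {\<epsilon>..1} \<longleftrightarrow> logit \<epsilon> \<le> W.walk i (logit x) y" for i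
            using iter[OF y, of x i] x logit_le_iff[OF \<epsilon>1, of "fiber_iterate m G i y x"] by auto
          have "{i. K \<le> W.walk i (logit x) y} \<subseteq> {i. fiber_iterate m G i y x \<in> {\<epsilon>..1}}"
            unfolding mem using \<epsilon>K by auto
          then have "infinite {i. fiber_iterate m G i y x \<in> {\<epsilon>..1}}"
            using elim(1) finite_subset by blast
          moreover have "indicator {\<epsilon>..1} (fiber_iterate m G i y x)
              = (indicator {logit \<epsilon>..} (W.walk i (logit x) y) :: real)" for i
            using mem[of i] by (simp add: indicator_def)
          ultimately show ?case using elim(2) by simp
        qed
        then show "AE y in lebesgue_on {0..1}.
                infinite {i. fiber_iterate m G i y x \<in> {\<epsilon>..1}} \<and>
                (\<lambda>n. (\<Sum>i<n. indicator {\<epsilon>..1} (fiber_iterate m G i y x)) / real n) \<longlonglongrightarrow> 0"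
          by (rule AE_unit_imp_lebesgue_on)
      qed
    qed
  qed
qed

end
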